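(* For $N\ge1$ let $q_N(\xi,\eta)=\sum_{\ell=1}^Nq(\xi,\eta)e_\ell(\xi)e_\ell(\eta)$, $$\|q_N\|_2:=\sup_{\|f\|_2\le1}\int_{\mathcal{O}^2}q_N(\xi,\eta)f(\xi)f(\eta)\,d\xi\,d\eta,$$ where the supremum is over $f\in L^2(\mathcal{O})$, and suppose $\tilde\kappa_1:=\sup_{N\ge1}\|q_N\|_2<\infty$. If $$2(\lambda_1+\beta_0)-\beta_1^2\tilde\kappa_1>0,$$ then the system $$dU_N(t)=-(\Lambda^N+B^N)U_N(t)\,dt+\beta_1\sum_{j=1}^\infty A_j^NU_N(t)\,dB_j(t),\qquad U_N(0)=P_Nu^0,$$ is stable in the mean square sense, namely $$\lim_{t\to\infty}\sup_{N\ge1}\left(\mathbb{E}\|U_N(t)\|_2^2\right)^{1/2}=0 .$$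
   Context: $\mathcal{O}\subset\mathbb{R}^d$ is a bounded domain with smooth boundary, $\|\cdot\|_2$ is the norm of $L^2(\mathcal{O})$ (and also the Euclidean norm on $\mathbb{R}^N$), and $\beta_0,\beta_1\in\mathbb{R}$ are constants. $0<\lambda_1\le\lambda_2\le\cdots$ are the eigenvalues of $-\Delta$ on $\mathcal{O}$ with Dirichlet boundary condition and $(e_k)_{k\ge1}$ is a corresponding orthonormal basis of $L^2(\mathcal{O})$ of eigenfunctions. $q:\mathcal{O}\times\mathcal{O}\to\mathbb{R}$ is a positive and positive definite function (the spatial covariance of a Gaussian noise white in time). Put $\alpha_{ij}=\int_{\mathcal{O}^2}q(x,y)e_i(x)e_j(y)\,dx\,dy$. $(B_j)_{j\ge1}$ is a family of jointly Gaussian Brownian motions with $\mathbb{E}[B_i(t)B_j(s)]=\alpha_{ij}\min(t,s)$. $\Lambda^N=\mathrm{Diag}(\lambda_1,\dots,\lambda_N)$, $B^N=\beta_0I_N$, and $A_j^N$ is the $N\times N$ matrix with entries $\int_{\mathcal{O}}e_j(x)e_i(x)e_k(x)\,dx$, $1\le i,k\le N$. $P_N$ is the orthogonal projection of $L^2(\mathcal{O})$ onto $S_N=\mathrm{span}\{e_1,\dots,e_N\}$, and $S_N$ is identified with $\mathbb{R}^N$ via coordinates in $e_1,\dots,e_N$. $u^0\in L^2(\mathcal{O})$ is a given initial value. The equation is an Itô equation in $\mathbb{R}^N$. *)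

theory Defs
  imports "HOL-Probability.Probability"
begin

section \<open>Smoothly bounded domains, the Dirichlet Laplacian and L2\<close>

primrec Ck_on :: "nat \<Rightarrow> 'a::euclidean_space set \<Rightarrow> ('a \<Rightarrow> real) \<Rightarrow> bool" where
  "Ck_on 0 S f \<longleftrightarrow> continuous_on S f"
| "Ck_on (Suc k) S f \<longleftrightarrow> f differentiable_on S \<and>
     (\<forall>b\<in>Basis. Ck_on k S (\<lambda>x. frechet_derivative f (at x) b))"

text \<open>These notions are only used for open sets \<open>S\<close>.\<close>

definition smooth_fun_on :: "'a::euclidean_space set \<Rightarrow> ('a \<Rightarrow> real) \<Rightarrow> bool" where
  "smooth_fun_on S f \<longleftrightarrow> (\<forall>k. Ck_on k S f)"

text \<open>Near each boundary point the domain is, in the direction of some unit vector \<open>\<nu>\<close>, the part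
  above the graph of a smooth function \<open>\<gamma>\<close> over the hyperplane orthogonal to \<open>\<nu>\<close>
  (only the values of \<open>\<gamma>\<close> on that hyperplane matter).\<close>

definition smooth_boundary :: "'a::euclidean_space set \<Rightarrow> bool" where
  "smooth_boundary \<O> \<longleftrightarrow>
    (\<forall>p\<in>frontier \<O>. \<exists>r>0. \<exists>\<nu> \<gamma>. norm \<nu> = 1 \<and> smooth_fun_on UNIV \<gamma> \<and>
       \<O> \<inter> ball p r = {x \<in> ball p r. \<gamma> (x - (x \<bullet> \<nu>) *\<^sub>R \<nu>) < x \<bullet> \<nu>})"

definition bounded_smooth_domain :: "'a::euclidean_space set \<Rightarrow> bool" where
  "bounded_smooth_domain \<O> \<longleftrightarrow>
     open \<O> \<and> connected \<O> \<and> \<O> \<noteq> {} \<and> bounded \<O> \<and> smooth_boundary \<O>"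

definition laplacian :: "('a::euclidean_space \<Rightarrow> real) \<Rightarrow> 'a \<Rightarrow> real" where
  "laplacian f x =
     (\<Sum>b\<in>Basis. frechet_derivative (\<lambda>y. frechet_derivative f (at y) b) (at x) b)"

text \<open>Classical eigenfunctions; on a smoothly bounded domain the weak eigenfunctions are
  smooth up to the boundary, so that this is no restriction.\<close>

definition dirichlet_eigenfunction :: "'a::euclidean_space set \<Rightarrow> real \<Rightarrow> ('a \<Rightarrow> real) \<Rightarrow> bool" where
  "dirichlet_eigenfunction \<O> \<mu> f \<longleftrightarrow>
     Ck_on 2 \<O> f \<and> continuous_on (closure \<O>) f \<and> (\<exists>x\<in>\<O>. f x \<noteq> 0) \<and>
     (\<forall>x\<in>\<O>. - laplacian f x = \<mu> * f x) \<and> (\<forall>x\<in>frontier \<O>. f x = 0)"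

text \<open>Elements of \<open>L\<^sup>2(\<O>)\<close> are represented by Borel functions, which every class contains.\<close>

definition L2_fun :: "'a::euclidean_space set \<Rightarrow> ('a \<Rightarrow> real) \<Rightarrow> bool" where
  "L2_fun \<O> f \<longleftrightarrow> set_borel_measurable lborel \<O> f \<and> set_integrable lborel \<O> (\<lambda>x. (f x)\<^sup>2)"

definition L2_inner :: "'a::euclidean_space set \<Rightarrow> ('a \<Rightarrow> real) \<Rightarrow> ('a \<Rightarrow> real) \<Rightarrow> real" where
  "L2_inner \<O> f g = (LINT x:\<O>|lborel. f x * g x)"

definition L2_norm :: "'a::euclidean_space set \<Rightarrow> ('a \<Rightarrow> real) \<Rightarrow> real" where
  "L2_norm \<O> f = sqrt (L2_inner \<O> f f)"

text \<open>Sequences are indexed from 1; the value at index 0 is irrelevant throughout.\<close>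

definition L2_orthonormal_basis :: "'a::euclidean_space set \<Rightarrow> (nat \<Rightarrow> 'a \<Rightarrow> real) \<Rightarrow> bool" where
  "L2_orthonormal_basis \<O> e \<longleftrightarrow>
     (\<forall>k\<ge>1. L2_fun \<O> (e k)) \<and>
     (\<forall>j\<ge>1. \<forall>k\<ge>1. L2_inner \<O> (e j) (e k) = (if j = k then 1 else 0)) \<and>
     (\<forall>f. L2_fun \<O> f \<longrightarrow>
        (\<lambda>n. L2_norm \<O> (\<lambda>x. f x - (\<Sum>k=1..n. L2_inner \<O> f (e k) * e k x))) \<longlonglongrightarrow> 0)"

text \<open>Since the eigenfunctions form a basis, \<open>\<lambda>\<close> lists all eigenvalues with multiplicity.\<close>

definition dirichlet_eigenbasis ::
  "'a::euclidean_space set \<Rightarrow> (nat \<Rightarrow> real) \<Rightarrow> (nat \<Rightarrow> 'a \<Rightarrow> real) \<Rightarrow> bool" where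
  "dirichlet_eigenbasis \<O> lam e \<longleftrightarrow>
     (\<forall>k\<ge>1. 0 < lam k \<and> lam k \<le> lam (Suc k)) \<and>
     (\<forall>k\<ge>1. dirichlet_eigenfunction \<O> (lam k) (e k)) \<and>
     L2_orthonormal_basis \<O> e"

section \<open>The covariance kernel\<close>

definition positive_definite_on :: "'a set \<Rightarrow> ('a \<Rightarrow> 'a \<Rightarrow> real) \<Rightarrow> bool" where
  "positive_definite_on S q \<longleftrightarrow>
     (\<forall>x\<in>S. \<forall>y\<in>S. q x y = q y x) \<and>
     (\<forall>X c. finite X \<and> X \<subseteq> S \<longrightarrow> 0 \<le> (\<Sum>x\<in>X. \<Sum>y\<in>X. c x * c y * q x y))"

definition noise_cov ::
  "'a::euclidean_space set \<Rightarrow> ('a \<Rightarrow> 'a \<Rightarrow> real) \<Rightarrow> (nat \<Rightarrow> 'a \<Rightarrow> real) \<Rightarrow> nat \<Rightarrow> nat \<Rightarrow> real" where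
  "noise_cov \<O> q e i j = (LINT (x, y):\<O> \<times> \<O>|lborel. q x y * e i x * e j y)"

definition q_trunc ::
  "('a \<Rightarrow> 'a \<Rightarrow> real) \<Rightarrow> (nat \<Rightarrow> 'a \<Rightarrow> real) \<Rightarrow> nat \<Rightarrow> 'a \<Rightarrow> 'a \<Rightarrow> real" where
  "q_trunc q e N x y = (\<Sum>l=1..N. q x y * e l x * e l y)"

text \<open>The supremum is taken in the extended reals, so that it is \<open>\<infinity>\<close> when unbounded.\<close>

definition kernel_norm :: "'a::euclidean_space set \<Rightarrow> ('a \<Rightarrow> 'a \<Rightarrow> real) \<Rightarrow> ereal" where
  "kernel_norm \<O> k =
     (SUP f\<in>{f. L2_fun \<O> f \<and> L2_norm \<O> f \<le> 1}.
        ereal (LINT (x, y):\<O> \<times> \<O>|lborel. k x y * f x * f y))"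

section \<open>Brownian motions and Ito integrals\<close>

definition is_filtration :: "'w measure \<Rightarrow> (real \<Rightarrow> 'w measure) \<Rightarrow> bool" where
  "is_filtration M F \<longleftrightarrow> filtration (space M) F \<and> (\<forall>t. sets (F t) \<subseteq> sets M)"

text \<open>Centred Gaussian, possibly degenerate.\<close>

definition centred_gaussian :: "'w measure \<Rightarrow> ('w \<Rightarrow> real) \<Rightarrow> bool" where
  "centred_gaussian M X \<longleftrightarrow> X \<in> borel_measurable M \<and>
     ((AE \<omega> in M. X \<omega> = 0) \<or> (\<exists>\<sigma>>0. distributed M lborel X (\<lambda>x. ennreal (normal_density 0 \<sigma> x))))"

text \<open>A jointly Gaussian family of Brownian motions relative to a filtration, with
  \<open>E[B\<^sub>i(t) B\<^sub>j(s)] = \<alpha>\<^sub>i\<^sub>j min(t,s)\<close>; thus \<open>B\<^sub>j\<close> has variance \<open>\<alpha>\<^sub>j\<^sub>j t\<close>, and may vanish.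
  For the natural filtration the last condition (the increments of the whole family over
  \<open>[s,t]\<close> are independent of the past) follows from the others.\<close>

definition brownian_family ::
  "'w measure \<Rightarrow> (real \<Rightarrow> 'w measure) \<Rightarrow> (nat \<Rightarrow> nat \<Rightarrow> real) \<Rightarrow> (nat \<Rightarrow> real \<Rightarrow> 'w \<Rightarrow> real) \<Rightarrow> bool" where
  "brownian_family M F \<alpha> B \<longleftrightarrow>
     (\<forall>j\<ge>1. \<forall>t\<ge>0. B j t \<in> borel_measurable (F t)) \<and>
     (\<forall>j\<ge>1. AE \<omega> in M. B j 0 \<omega> = 0 \<and> continuous_on {0..} (\<lambda>t. B j t \<omega>)) \<and>
     (\<forall>I c. finite I \<and> I \<subseteq> {1..} \<times> {0..} \<longrightarrow>
        centred_gaussian M (\<lambda>\<omega>. \<Sum>(j, t)\<in>I. c j t * B j t \<omega>)) \<and>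
     (\<forall>i\<ge>1. \<forall>j\<ge>1. \<forall>t\<ge>0. \<forall>s\<ge>0. (\<integral>\<omega>. B i t \<omega> * B j s \<omega> \<partial>M) = \<alpha> i j * min t s) \<and>
     (\<forall>s\<ge>0. \<forall>t\<ge>s. prob_space.indep_set M (sets (F s))
        (sets (vimage_algebra (space M) (\<lambda>\<omega>. \<lambda>j\<in>{1..}. B j t \<omega> - B j s \<omega>)
          (Pi\<^sub>M {1..} (\<lambda>_. borel)))))"

definition progressive :: "(real \<Rightarrow> 'w measure) \<Rightarrow> (real \<Rightarrow> 'w \<Rightarrow> real) \<Rightarrow> bool" where
  "progressive F H \<longleftrightarrow>
     (\<forall>T\<ge>0. (\<lambda>(t, \<omega>). H t \<omega>) \<in> borel_measurable (restrict_space borel {0..T} \<Otimes>\<^sub>M F T))"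

text \<open>\<open>E \<integral>\<^sub>0\<^sup>T H\<^sub>t\<^sup>2 dt\<close>\<close>

definition energy :: "'w measure \<Rightarrow> real \<Rightarrow> (real \<Rightarrow> 'w \<Rightarrow> real) \<Rightarrow> ennreal" where
  "energy M T H = (\<integral>\<^sup>+\<omega>. (\<integral>\<^sup>+t\<in>{0..T}. ennreal ((H t \<omega>)\<^sup>2) \<partial>lborel) \<partial>M)"

text \<open>The triple \<open>(n, \<tau>, \<xi>)\<close> represents the simple process
  \<open>\<Sum>\<^sub>i\<^sub><\<^sub>n \<xi>\<^sub>i 1\<close> on the intervals from \<open>\<tau>\<^sub>i\<close> (excluded) to \<open>\<tau>\<^sub>i\<^sub>+\<^sub>1\<close> (included).\<close>

type_synonym 'w simple_proc = "nat \<times> (nat \<Rightarrow> real) \<times> (nat \<Rightarrow> 'w \<Rightarrow> real)"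

definition simple_process :: "'w measure \<Rightarrow> (real \<Rightarrow> 'w measure) \<Rightarrow> 'w simple_proc \<Rightarrow> bool" where
  "simple_process M F S \<longleftrightarrow> (case S of (n, \<tau>, \<xi>) \<Rightarrow>
     0 \<le> \<tau> 0 \<and> (\<forall>i<n. \<tau> i \<le> \<tau> (Suc i)) \<and>
     (\<forall>i<n. \<xi> i \<in> borel_measurable (F (\<tau> i)) \<and> (\<exists>c. \<forall>\<omega>\<in>space M. \<bar>\<xi> i \<omega>\<bar> \<le> c)))"

definition simple_value :: "'w simple_proc \<Rightarrow> real \<Rightarrow> 'w \<Rightarrow> real" where
  "simple_value S t \<omega> = (case S of (n, \<tau>, \<xi>) \<Rightarrow>
     \<Sum>i<n. \<xi> i \<omega> * indicator {\<tau> i<..\<tau> (Suc i)} t)"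

definition simple_integral :: "'w simple_proc \<Rightarrow> (real \<Rightarrow> 'w \<Rightarrow> real) \<Rightarrow> real \<Rightarrow> 'w \<Rightarrow> real" where
  "simple_integral S W T \<omega> = (case S of (n, \<tau>, \<xi>) \<Rightarrow>
     \<Sum>i<n. \<xi> i \<omega> * (W (min T (\<tau> (Suc i))) \<omega> - W (min T (\<tau> i)) \<omega>))"

definition ms_tendsto :: "'w measure \<Rightarrow> (nat \<Rightarrow> 'w \<Rightarrow> real) \<Rightarrow> ('w \<Rightarrow> real) \<Rightarrow> bool" where
  "ms_tendsto M X Y \<longleftrightarrow> Y \<in> borel_measurable M \<and>
     (\<lambda>n. \<integral>\<^sup>+\<omega>. ennreal ((X n \<omega> - Y \<omega>)\<^sup>2) \<partial>M) \<longlonglongrightarrow> 0"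

text \<open>\<open>I\<close> is (a version of) the Ito integral \<open>\<integral>\<^sub>0\<^sup>T H dW\<close> of a square integrable progressive
  integrand: the mean square limit of the integrals of simple processes converging to \<open>H\<close>.\<close>

definition has_ito_integral ::
  "'w measure \<Rightarrow> (real \<Rightarrow> 'w measure) \<Rightarrow> (real \<Rightarrow> 'w \<Rightarrow> real) \<Rightarrow> real \<Rightarrow> (real \<Rightarrow> 'w \<Rightarrow> real)
     \<Rightarrow> ('w \<Rightarrow> real) \<Rightarrow> bool" where
  "has_ito_integral M F W T H I \<longleftrightarrow>
     progressive F H \<and> energy M T H < \<infinity> \<and>
     (\<exists>S. (\<forall>m. simple_process M F (S m)) \<and>
          (\<lambda>m. energy M T (\<lambda>t \<omega>. simple_value (S m) t \<omega> - H t \<omega>)) \<longlonglongrightarrow> 0 \<and>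
          ms_tendsto M (\<lambda>m. simple_integral (S m) W T) I)"

section \<open>Linear Ito systems\<close>

text \<open>Vectors in \<open>\<real>\<^sup>N\<close> and \<open>N \<times> N\<close> matrices are functions of indices in \<open>{1..N}\<close>, as \<open>N\<close> varies.\<close>

definition mat_vec :: "nat \<Rightarrow> (nat \<Rightarrow> nat \<Rightarrow> real) \<Rightarrow> (nat \<Rightarrow> real) \<Rightarrow> nat \<Rightarrow> real" where
  "mat_vec N A v i = (\<Sum>k=1..N. A i k * v k)"

text \<open>\<open>U\<close> is a (square integrable, continuous, adapted) solution in \<open>\<real>\<^sup>N\<close> of
  \<open>dU = - G U dt + b \<Sum>\<^sub>j A\<^sub>j U dB\<^sub>j\<close>, \<open>U(0) = x\<^sub>0\<close>, in integral form. The
  vector \<open>J\<^sub>j\<close> is the Ito integral of \<open>A\<^sub>j U\<close> against \<open>B\<^sub>j\<close> up to time \<open>t\<close>, and \<open>Z\<close>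
  is the sum of the \<open>J\<^sub>j\<close>, which is a mean square limit of partial sums. The initial condition
  is the case \<open>t = 0\<close>.\<close>

definition linear_ito_solution ::
  "'w measure \<Rightarrow> (real \<Rightarrow> 'w measure) \<Rightarrow> (nat \<Rightarrow> real \<Rightarrow> 'w \<Rightarrow> real) \<Rightarrow> nat \<Rightarrow>
   (nat \<Rightarrow> nat \<Rightarrow> real) \<Rightarrow> real \<Rightarrow> (nat \<Rightarrow> nat \<Rightarrow> nat \<Rightarrow> real) \<Rightarrow> (nat \<Rightarrow> real) \<Rightarrow>
   (real \<Rightarrow> 'w \<Rightarrow> nat \<Rightarrow> real) \<Rightarrow> bool" where
  "linear_ito_solution M F B N G b A x0 U \<longleftrightarrow>
     (\<forall>i\<in>{1..N}. progressive F (\<lambda>t \<omega>. U t \<omega> i) \<and>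
        (AE \<omega> in M. continuous_on {0..} (\<lambda>t. U t \<omega> i)) \<and>
        (\<forall>T\<ge>0. energy M T (\<lambda>t \<omega>. U t \<omega> i) < \<infinity>)) \<and>
     (\<forall>t\<ge>0. \<exists>J Z.
        (\<forall>j\<ge>1. \<forall>i\<in>{1..N}.
           has_ito_integral M F (B j) t (\<lambda>s \<omega>. mat_vec N (A j) (U s \<omega>) i) (\<lambda>\<omega>. J j \<omega> i)) \<and>
        (\<forall>i\<in>{1..N}. ms_tendsto M (\<lambda>n \<omega>. \<Sum>j=1..n. J j \<omega> i) (\<lambda>\<omega>. Z \<omega> i)) \<and>
        (AE \<omega> in M. \<forall>i\<in>{1..N}.
           U t \<omega> i = x0 i - (LINT s:{0..t}|lborel. mat_vec N G (U s \<omega>) i) + b * Z \<omega> i))"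

definition Lambda_mat :: "(nat \<Rightarrow> real) \<Rightarrow> nat \<Rightarrow> nat \<Rightarrow> real" where
  "Lambda_mat lam i k = (if i = k then lam i else 0)"

definition B_mat :: "real \<Rightarrow> nat \<Rightarrow> nat \<Rightarrow> real" where
  "B_mat \<beta>0 i k = (if i = k then \<beta>0 else 0)"

definition A_mat ::
  "'a::euclidean_space set \<Rightarrow> (nat \<Rightarrow> 'a \<Rightarrow> real) \<Rightarrow> nat \<Rightarrow> nat \<Rightarrow> nat \<Rightarrow> real" where
  "A_mat \<O> e j i k = (LINT x:\<O>|lborel. e j x * e i x * e k x)"

text \<open>Coordinates of \<open>P\<^sub>N u\<close>, the orthogonal projection onto the span of \<open>e\<^sub>1, \<dots>, e\<^sub>N\<close>.\<close>

definition proj_coords ::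
  "'a::euclidean_space set \<Rightarrow> (nat \<Rightarrow> 'a \<Rightarrow> real) \<Rightarrow> ('a \<Rightarrow> real) \<Rightarrow> nat \<Rightarrow> real" where
  "proj_coords \<O> e u k = L2_inner \<O> u (e k)"

definition galerkin_solution ::
  "'a::euclidean_space set \<Rightarrow> (nat \<Rightarrow> real) \<Rightarrow> (nat \<Rightarrow> 'a \<Rightarrow> real) \<Rightarrow> real \<Rightarrow> real \<Rightarrow> ('a \<Rightarrow> real) \<Rightarrow>
   'w measure \<Rightarrow> (real \<Rightarrow> 'w measure) \<Rightarrow> (nat \<Rightarrow> real \<Rightarrow> 'w \<Rightarrow> real) \<Rightarrow> nat \<Rightarrow>
   (real \<Rightarrow> 'w \<Rightarrow> nat \<Rightarrow> real) \<Rightarrow> bool" where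
  "galerkin_solution \<O> lam e \<beta>0 \<beta>1 u0 M F B N U \<longleftrightarrow>
     linear_ito_solution M F B N (\<lambda>i k. Lambda_mat lam i k + B_mat \<beta>0 i k) \<beta>1
       (A_mat \<O> e) (proj_coords \<O> e u0) U"

text \<open>\<open>(E \<parallel>X\<parallel>\<^sub>2\<^sup>2)\<^sup>1\<^sup>/\<^sup>2\<close> for an \<open>\<real>\<^sup>N\<close>-valued \<open>X\<close>; the case distinction keeps an infinite second
  moment from being read as 0.\<close>

definition rms_norm :: "'w measure \<Rightarrow> nat \<Rightarrow> ('w \<Rightarrow> nat \<Rightarrow> real) \<Rightarrow> ereal" where
  "rms_norm M N X =
     (if integrable M (\<lambda>\<omega>. (L2_set (X \<omega>) {1..N})\<^sup>2)
      then ereal (sqrt (\<integral>\<omega>. (L2_set (X \<omega>) {1..N})\<^sup>2 \<partial>M)) else \<infinity>)"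

end

theory Submission
  imports Defs
begin

text \<open>For one fixed \<open>N\<close> let \<open>\<phi>(t) = E \<parallel>U\<^sub>N(t)\<parallel>\<^sup>2\<close>. The energy identity is
  \<open>\<phi>' = -2 E \<langle>U, (\<Lambda> + \<beta>\<^sub>0) U\<rangle> + \<beta>\<^sub>1\<^sup>2 E \<Sum>\<^sub>i \<Sum>\<^sub>j\<^sub>,\<^sub>l \<alpha>\<^sub>j\<^sub>l (A\<^sub>j U)\<^sub>i (A\<^sub>l U)\<^sub>i\<close>. Expanding \<open>e\<^sub>i U\<close> in the
  basis, the last sum becomes \<open>\<integral>\<integral> q\<^sub>N(x,y) U(x) U(y) dx dy \<le> \<kappa>\<^sub>1 \<parallel>U\<parallel>\<^sup>2\<close>, hence \<open>\<phi>' \<le> -c \<phi>\<close> with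
  \<open>c = 2(\<lambda>\<^sub>1 + \<beta>\<^sub>0) - \<beta>\<^sub>1\<^sup>2 \<kappa>\<^sub>1 > 0\<close>, and \<open>(1 + c t) \<phi>(t) \<le> \<parallel>u\<^sup>0\<parallel>\<^sup>2\<close> uniformly in \<open>N\<close>.

  The expansion in the basis needs the form of \<open>q\<close> to be bounded on \<open>L\<^sup>2\<close>, which is not assumed.
  It follows from \<open>\<kappa>\<^sub>1 < \<infinity>\<close>: testing \<open>q\<^sub>N\<close> with the indicator of \<open>{x. q(x,x) \<le> n}\<close>, on whose square
  \<open>q\<close> is bounded, bounds the trace and therefore the norm of the truncated operator by
  \<open>\<kappa>\<^sub>1\<close> times the volume, uniformly in \<open>n\<close>; as \<open>q \<ge> 0\<close>, monotone convergence removes the truncation.\<close>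

section \<open>Square integrable functions\<close>

text \<open>Two obstacles shape the proof. Points are instead sampled independently from the domain:
  n diagonal terms stand against n(n-1) off-diagonal ones and are lost in the limit, and boundedness
  of the truncated kernel keeps the diagonal finite. Second, the noise is an infinite sum of
  integrals against correlated Brownian motions. Its variance is a limit of square partial sums of
  \<alpha> paired with the entries \<open>A_mat \<O> e j i k\<close>, which are the Fourier
  coefficients of \<open>e i * e k\<close> with respect to \<open>e j\<close>. Only continuity of
  the covariance form on all of L^2 identifies this limit, so a bound for the form has to precede
  every stochastic estimate. The proof settles for decay of order 1/t of the mean square: the energy
  identity is available in integrated form, and monotonicity of the mean square takes the place of
  Gronwall's lemma.\<close>

definition sq_int :: "'b measure \<Rightarrow> ('b \<Rightarrow> real) \<Rightarrow> bool" where
  "sq_int M f \<longleftrightarrow> f \<in> borel_measurable M \<and> integrable M (\<lambda>x. (f x)\<^sup>2)"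

lemma sq_int_measurable: "sq_int M f \<Longrightarrow> f \<in> borel_measurable M"
  by (simp add: sq_int_def)

lemma sq_int_square: "sq_int M f \<Longrightarrow> integrable M (\<lambda>x. (f x)\<^sup>2)"
  by (simp add: sq_int_def)

lemma sq_int_mult:
  assumes "sq_int M f" "sq_int M g"
  shows "integrable M (\<lambda>x. f x * g x)"
proof (rule Bochner_Integration.integrable_bound)
  show "integrable M (\<lambda>x. (f x)\<^sup>2 + (g x)\<^sup>2)"
    using assms by (simp add: sq_int_def)
  show "(\<lambda>x. f x * g x) \<in> borel_measurable M"
    using assms by (intro borel_measurable_times sq_int_measurable)
  have "\<bar>a * b\<bar> \<le> a\<^sup>2 + b\<^sup>2" for a b :: real
  proof -
    have "0 \<le> (\<bar>a\<bar> - \<bar>b\<bar>)\<^sup>2" by simp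
    then have "2 * \<bar>a * b\<bar> \<le> a\<^sup>2 + b\<^sup>2" by (simp add: power2_diff abs_mult)
    moreover have "0 \<le> \<bar>a * b\<bar>" by simp
    ultimately show ?thesis by linarith
  qed
  then show "AE x in M. norm (f x * g x) \<le> norm ((f x)\<^sup>2 + (g x)\<^sup>2)"
    by (intro always_eventually allI) (smt (verit) real_norm_def zero_le_power2)
qed

lemma sq_int_scale: "sq_int M f \<Longrightarrow> sq_int M (\<lambda>x. c * f x)"
  by (auto simp: sq_int_def power_mult_distrib)

lemma sq_int_add:
  assumes "sq_int M f" "sq_int M g"
  shows "sq_int M (\<lambda>x. f x + g x)"
proof -
  have "integrable M (\<lambda>x. (f x)\<^sup>2 + (g x)\<^sup>2 + 2 * (f x * g x))"
    using assms sq_int_mult[OF assms] by (auto simp: sq_int_def)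
  then show ?thesis
    using assms by (auto simp: sq_int_def power2_sum mult.assoc)
qed

lemma sq_int_diff:
  assumes "sq_int M f" "sq_int M g"
  shows "sq_int M (\<lambda>x. f x - g x)"
  using sq_int_add[OF assms(1) sq_int_scale[OF assms(2), of "-1"]] by simp

lemma sq_int_zero: "sq_int M (\<lambda>x. 0)"
  by (simp add: sq_int_def)

lemma sq_int_sum: "(\<And>i. i \<in> I \<Longrightarrow> sq_int M (f i)) \<Longrightarrow> sq_int M (\<lambda>x. \<Sum>i\<in>I. f i x)"
  by (induction I rule: infinite_finite_induct) (auto intro: sq_int_add sq_int_zero)

lemma sq_int_abs: "sq_int M f \<Longrightarrow> sq_int M (\<lambda>x. \<bar>f x\<bar>)"
  by (auto simp: sq_int_def)

lemma sq_int_cong_AE: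
  assumes "sq_int M f" "g \<in> borel_measurable M" "AE x in M. f x = g x"
  shows "sq_int M g"
proof -
  have "integrable M (\<lambda>x. (g x)\<^sup>2)"
    using assms by (intro integrable_cong_AE_imp[OF sq_int_square[OF assms(1)]]) auto
  then show ?thesis using assms by (simp add: sq_int_def)
qed

lemma sq_int_bounded_mult:
  assumes "sq_int M f" "g \<in> borel_measurable M" "\<And>x. x \<in> space M \<Longrightarrow> \<bar>g x\<bar> \<le> c"
  shows "sq_int M (\<lambda>x. g x * f x)"
proof -
  have "integrable M (\<lambda>x. (g x * f x)\<^sup>2)"
  proof (rule Bochner_Integration.integrable_bound)
    show "integrable M (\<lambda>x. c\<^sup>2 * (f x)\<^sup>2)" using assms by (simp add: sq_int_def)
    show "(\<lambda>x. (g x * f x)\<^sup>2) \<in> borel_measurable M" using assms by (auto simp: sq_int_def)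
    show "AE x in M. norm ((g x * f x)\<^sup>2) \<le> norm (c\<^sup>2 * (f x)\<^sup>2)"
    proof (rule AE_I2)
      fix x assume "x \<in> space M"
      then have "(g x)\<^sup>2 \<le> c\<^sup>2"
        using assms(3) by (metis abs_ge_zero power2_abs power_mono)
      then show "norm ((g x * f x)\<^sup>2) \<le> norm (c\<^sup>2 * (f x)\<^sup>2)"
        by (simp add: power_mult_distrib mult_right_mono)
    qed
  qed
  then show ?thesis using assms by (auto simp: sq_int_def)
qed

lemma (in finite_measure) sq_int_const: "sq_int M (\<lambda>x. c)"
  by (simp add: sq_int_def)

lemma (in finite_measure) sq_int_integrable:
  assumes "sq_int M f"
  shows "integrable M f"
  using sq_int_mult[OF assms sq_int_const[of 1]] by simp

text \<open>The polynomial \<open>a + 2 * s * b + s\<^sup>2 * c\<close>, the integral of the square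
  of \<open>f + s * g\<close>, is nonnegative for every s; its value at the minimiser s = -b/c gives
  the claim.\<close>

lemma sq_int_Cauchy_Schwarz:
  assumes f: "sq_int M f" and g: "sq_int M g"
  shows "(\<integral>x. f x * g x \<partial>M)\<^sup>2 \<le> (\<integral>x. (f x)\<^sup>2 \<partial>M) * (\<integral>x. (g x)\<^sup>2 \<partial>M)"
proof -
  define a b c where "a = (\<integral>x. (f x)\<^sup>2 \<partial>M)" "b = (\<integral>x. f x * g x \<partial>M)" "c = (\<integral>x. (g x)\<^sup>2 \<partial>M)"
  note int = sq_int_square[OF f] sq_int_square[OF g] sq_int_mult[OF f g]
  have quad: "0 \<le> a + 2 * s * b + s\<^sup>2 * c" for s
  proof -
    have "0 \<le> (\<integral>x. (f x + s * g x)\<^sup>2 \<partial>M)" by simp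
    also have "\<dots> = (\<integral>x. (f x)\<^sup>2 + 2 * s * (f x * g x) + s\<^sup>2 * (g x)\<^sup>2 \<partial>M)"
      by (simp add: power2_sum power_mult_distrib algebra_simps)
    also have "\<dots> = a + 2 * s * b + s\<^sup>2 * c"
      using int by (simp add: a_b_c_def)
    finally show ?thesis .
  qed
  have c: "0 \<le> c" by (simp add: a_b_c_def)
  have "b\<^sup>2 \<le> a * c"
  proof (cases "c = 0")
    case False
    then have "0 < c" using c by simp
    have "0 \<le> a + 2 * (- b / c) * b + (- b / c)\<^sup>2 * c" by (rule quad)
    also have "\<dots> = a - b\<^sup>2 / c" using \<open>0 < c\<close> by (simp add: field_simps power2_eq_square)
    finally show ?thesis using \<open>0 < c\<close> by (simp add: field_simps)
  next
    case True
    have "b = 0"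
    proof (rule ccontr)
      assume "b \<noteq> 0"
      \<comment> \<open>With c = 0 the polynomial is affine in s; at this s its value would be
        -1.\<close>
      have "0 \<le> a + 2 * (- (a + 1) / (2 * b)) * b" using quad[of "- (a + 1) / (2 * b)"] True by simp
      also have "\<dots> = -1" using \<open>b \<noteq> 0\<close> by (simp add: field_simps)
      finally show False by simp
    qed
    then show ?thesis using True by simp
  qed
  then show ?thesis by (simp add: a_b_c_def)
qed

section \<open>Mean square convergence\<close>

definition sq_lim :: "'b measure \<Rightarrow> (nat \<Rightarrow> 'b \<Rightarrow> real) \<Rightarrow> ('b \<Rightarrow> real) \<Rightarrow> bool" where
  "sq_lim M X Y \<longleftrightarrow> (\<forall>n. sq_int M (X n)) \<and> sq_int M Y \<and>
     (\<lambda>n. \<integral>x. (X n x - Y x)\<^sup>2 \<partial>M) \<longlonglongrightarrow> 0"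

lemma sq_lim_const: "sq_int M Y \<Longrightarrow> sq_lim M (\<lambda>n. Y) Y"
  by (simp add: sq_lim_def)

lemma integral_square_add_le:
  assumes "sq_int M f" "sq_int M g"
  shows "(\<integral>x. (f x + g x)\<^sup>2 \<partial>M) \<le> 2 * (\<integral>x. (f x)\<^sup>2 \<partial>M) + 2 * (\<integral>x. (g x)\<^sup>2 \<partial>M)"
proof -
  have *: "(a + b)\<^sup>2 \<le> 2 * a\<^sup>2 + 2 * b\<^sup>2" for a b :: real
    using zero_le_power2[of "a - b"] by (simp add: power2_sum power2_diff)
  have "(\<integral>x. (f x + g x)\<^sup>2 \<partial>M) \<le> (\<integral>x. 2 * (f x)\<^sup>2 + 2 * (g x)\<^sup>2 \<partial>M)"
    using assms sq_int_add[OF assms] by (intro integral_mono *) (auto simp: sq_int_def)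
  then show ?thesis using assms by (simp add: sq_int_def)
qed

lemma sq_lim_add:
  assumes "sq_lim M X Y" "sq_lim M X' Y'"
  shows "sq_lim M (\<lambda>n x. X n x + X' n x) (\<lambda>x. Y x + Y' x)"
proof -
  have "(\<lambda>n. \<integral>x. (X n x + X' n x - (Y x + Y' x))\<^sup>2 \<partial>M) \<longlonglongrightarrow> 0"
  proof (rule tendsto_sandwich[OF _ _ tendsto_const])
    show "(\<lambda>n. 2 * (\<integral>x. (X n x - Y x)\<^sup>2 \<partial>M) + 2 * (\<integral>x. (X' n x - Y' x)\<^sup>2 \<partial>M)) \<longlonglongrightarrow> 0"
      using tendsto_add[OF tendsto_mult_left[of _ 0 _ 2] tendsto_mult_left[of _ 0 _ 2]] assms
      by (fastforce simp: sq_lim_def)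
    show "\<forall>\<^sub>F n in sequentially. (\<integral>x. (X n x + X' n x - (Y x + Y' x))\<^sup>2 \<partial>M)
        \<le> 2 * (\<integral>x. (X n x - Y x)\<^sup>2 \<partial>M) + 2 * (\<integral>x. (X' n x - Y' x)\<^sup>2 \<partial>M)"
    proof (intro always_eventually allI)
      fix n
      show "(\<integral>x. (X n x + X' n x - (Y x + Y' x))\<^sup>2 \<partial>M)
        \<le> 2 * (\<integral>x. (X n x - Y x)\<^sup>2 \<partial>M) + 2 * (\<integral>x. (X' n x - Y' x)\<^sup>2 \<partial>M)"
        using integral_square_add_le[of M "\<lambda>x. X n x - Y x" "\<lambda>x. X' n x - Y' x"] assms
        by (auto simp: sq_lim_def algebra_simps intro: sq_int_diff)
    qed
  qed auto
  then show ?thesis using assms by (auto simp: sq_lim_def intro: sq_int_add)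
qed

text \<open>\<open>X n * X' n - Y * Y'\<close> splits into
  \<open>?A n * ?B n + ?A n * Y' + Y * ?B n\<close>, where both differences tend to 0 in L^2, and
  Cauchy-Schwarz bounds each piece. The limits in the isometry, the martingale property and the
  variance of the noise rest on this continuity.\<close>

lemma sq_lim_integral_mult:
  assumes X: "sq_lim M X Y" and X': "sq_lim M X' Y'"
  shows "(\<lambda>n. \<integral>x. X n x * X' n x \<partial>M) \<longlonglongrightarrow> (\<integral>x. Y x * Y' x \<partial>M)"
proof -
  let ?A = "\<lambda>n x. X n x - Y x" and ?B = "\<lambda>n x. X' n x - Y' x"
  have sq: "sq_int M (X n)" "sq_int M (X' n)" "sq_int M Y" "sq_int M Y'" "sq_int M (?A n)" "sq_int M (?B n)" for n
    using X X' by (auto simp: sq_lim_def intro: sq_int_diff)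
  have small: "(\<lambda>n. \<integral>x. F n x * G n x \<partial>M) \<longlonglongrightarrow> 0"
    if "\<And>n. sq_int M (F n)" "\<And>n. sq_int M (G n)" "(\<lambda>n. (\<integral>x. (F n x)\<^sup>2 \<partial>M) * (\<integral>x. (G n x)\<^sup>2 \<partial>M)) \<longlonglongrightarrow> 0" for F G
  proof -
    have "(\<lambda>n. (\<integral>x. F n x * G n x \<partial>M)\<^sup>2) \<longlonglongrightarrow> 0"
      by (rule tendsto_sandwich[OF _ _ tendsto_const that(3)])
        (auto intro!: always_eventually sq_int_Cauchy_Schwarz that)
    from tendsto_real_sqrt[OF this] show ?thesis
      by (simp add: tendsto_rabs_zero_iff)
  qed
  have A: "(\<lambda>n. \<integral>x. (?A n x)\<^sup>2 \<partial>M) \<longlonglongrightarrow> 0" and B: "(\<lambda>n. \<integral>x. (?B n x)\<^sup>2 \<partial>M) \<longlonglongrightarrow> 0"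
    using X X' by (auto simp: sq_lim_def)
  have "(\<lambda>n. \<integral>x. ?A n x * ?B n x \<partial>M) \<longlonglongrightarrow> 0"
    using tendsto_mult[OF A B] by (intro small sq) simp
  moreover have "(\<lambda>n. \<integral>x. ?A n x * Y' x \<partial>M) \<longlonglongrightarrow> 0"
    using tendsto_mult_right[OF A, of "\<integral>x. (Y' x)\<^sup>2 \<partial>M"] by (intro small sq) simp
  moreover have "(\<lambda>n. \<integral>x. Y x * ?B n x \<partial>M) \<longlonglongrightarrow> 0"
    using tendsto_mult_left[OF B, of "\<integral>x. (Y x)\<^sup>2 \<partial>M"] by (intro small sq) simp
  ultimately have "(\<lambda>n. (\<integral>x. ?A n x * ?B n x \<partial>M) + (\<integral>x. ?A n x * Y' x \<partial>M) + (\<integral>x. Y x * ?B n x \<partial>M)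
      + (\<integral>x. Y x * Y' x \<partial>M)) \<longlonglongrightarrow> 0 + 0 + 0 + (\<integral>x. Y x * Y' x \<partial>M)"
    by (intro tendsto_add tendsto_const)
  moreover have "(\<integral>x. ?A n x * ?B n x \<partial>M) + (\<integral>x. ?A n x * Y' x \<partial>M) + (\<integral>x. Y x * ?B n x \<partial>M)
      + (\<integral>x. Y x * Y' x \<partial>M) = (\<integral>x. X n x * X' n x \<partial>M)" for n
  proof -
    have "(\<integral>x. ?A n x * ?B n x \<partial>M) + (\<integral>x. ?A n x * Y' x \<partial>M) + (\<integral>x. Y x * ?B n x \<partial>M)
      + (\<integral>x. Y x * Y' x \<partial>M) = (\<integral>x. ?A n x * ?B n x + ?A n x * Y' x + Y x * ?B n x + Y x * Y' x \<partial>M)"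
      by (simp add: sq sq_int_mult)
    also have "\<dots> = (\<integral>x. X n x * X' n x \<partial>M)" by (simp add: algebra_simps)
    finally show ?thesis .
  qed
  ultimately show ?thesis by simp
qed

lemma sq_int_nn:
  assumes "f \<in> borel_measurable M" "(\<integral>\<^sup>+x. ennreal ((f x)\<^sup>2) \<partial>M) < \<infinity>"
  shows "sq_int M f"
  using assms by (auto simp: sq_int_def integrable_iff_bounded)

text \<open>Bridge from limits stated with nonnegative integrals, as in \<open>ms_tendsto\<close>,
  to Bochner integrals. Square integrability of \<open>Y\<close> is a consequence: some
  \<open>X n\<close> has finite L^2 distance from it.\<close>

lemma sq_lim_nn:
  assumes X: "\<And>n. sq_int M (X n)" and Y: "Y \<in> borel_measurable M"
    and lim: "(\<lambda>n. \<integral>\<^sup>+x. ennreal ((X n x - Y x)\<^sup>2) \<partial>M) \<longlonglongrightarrow> 0"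
  shows "sq_lim M X Y"
proof -
  have "\<forall>\<^sub>F n in sequentially. (\<integral>\<^sup>+x. ennreal ((X n x - Y x)\<^sup>2) \<partial>M) < 1"
    using lim by (rule order_tendstoD) simp
  then obtain n where "(\<integral>\<^sup>+x. ennreal ((X n x - Y x)\<^sup>2) \<partial>M) < 1"
    by (meson eventually_sequentially order_refl)
  then have "(\<integral>\<^sup>+x. ennreal ((X n x - Y x)\<^sup>2) \<partial>M) < \<infinity>"
    using ennreal_one_less_top less_trans by (metis infinity_ennreal_def)
  then have "sq_int M (\<lambda>x. X n x - Y x)"
    using borel_measurable_diff[OF sq_int_measurable[OF X] Y] by (intro sq_int_nn) auto
  from sq_int_diff[OF X[of n] this] have Y': "sq_int M Y" by simp
  have "(\<integral>\<^sup>+x. ennreal ((X n x - Y x)\<^sup>2) \<partial>M) = ennreal (\<integral>x. (X n x - Y x)\<^sup>2 \<partial>M)" for n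
    using sq_int_diff[OF X[of n] Y'] by (intro nn_integral_eq_integral) (auto simp: sq_int_def)
  with lim have "(\<lambda>n. ennreal (\<integral>x. (X n x - Y x)\<^sup>2 \<partial>M)) \<longlonglongrightarrow> ennreal 0" by simp
  then have "(\<lambda>n. \<integral>x. (X n x - Y x)\<^sup>2 \<partial>M) \<longlonglongrightarrow> 0"
    by (subst (asm) tendsto_ennreal_iff) auto
  then show ?thesis using X Y' by (simp add: sq_lim_def)
qed

lemma ms_tendsto_sq_lim: "(\<And>n. sq_int M (X n)) \<Longrightarrow> ms_tendsto M X Y \<Longrightarrow> sq_lim M X Y"
  by (auto simp: ms_tendsto_def intro: sq_lim_nn)

section \<open>Positive definite kernels\<close>

text \<open>Positive definiteness speaks of sets of points, whereas sampling produces tuples with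
  possible repetitions. Adding up the weights of coinciding points gives the weight \<open>C\<close>
  on the image of \<open>x\<close>.\<close>

lemma positive_definite_on_indexed:
  assumes k: "positive_definite_on S k" and I: "finite I" "x ` I \<subseteq> S"
  shows "0 \<le> (\<Sum>i\<in>I. \<Sum>j\<in>I. c i * c j * k (x i) (x j))"
proof -
  define C where "C y = (\<Sum>i | i \<in> I \<and> x i = y. c i)" for y
  have "0 \<le> (\<Sum>y\<in>x ` I. \<Sum>z\<in>x ` I. C y * C z * k y z)"
  proof -
    have "finite (x ` I) \<and> x ` I \<subseteq> S" using I by simp
    then show ?thesis using k unfolding positive_definite_on_def by blast
  qed
  also have "\<dots> = (\<Sum>y\<in>x ` I. \<Sum>z\<in>x ` I. \<Sum>i | i \<in> I \<and> x i = y. \<Sum>j | j \<in> I \<and> x j = z. c i * c j * k (x i) (x j))"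
    unfolding C_def sum_product by (intro sum.cong refl) (auto simp: sum_distrib_right)
  also have "\<dots> = (\<Sum>y\<in>x ` I. \<Sum>i | i \<in> I \<and> x i = y. \<Sum>z\<in>x ` I. \<Sum>j | j \<in> I \<and> x j = z. c i * c j * k (x i) (x j))"
    by (intro sum.cong refl sum.swap)
  also have "\<dots> = (\<Sum>y\<in>x ` I. \<Sum>i | i \<in> I \<and> x i = y. \<Sum>j\<in>I. c i * c j * k (x i) (x j))"
    by (intro sum.cong refl sum.image_gen[symmetric] I)
  also have "\<dots> = (\<Sum>i\<in>I. \<Sum>j\<in>I. c i * c j * k (x i) (x j))"
    by (intro sum.image_gen[symmetric] I)
  finally show ?thesis .
qed

text \<open>The infimum of the right side over s is 2 sqrt(a b). It need not be attained when
  \<open>a\<close> or \<open>b\<close> vanishes, so s is chosen in terms of \<open>z\<close>: one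
  summand becomes \<open>z / 2\<close> and is absorbed on the left.\<close>

lemma weighted_mean_bound:
  fixes a b z :: real
  assumes "\<And>s. 0 < s \<Longrightarrow> z \<le> s * a + b / s" "0 \<le> a" "0 \<le> b" "0 \<le> z"
  shows "z\<^sup>2 \<le> 4 * a * b"
proof (cases "z = 0")
  case False
  then have z: "0 < z" using assms by simp
  show ?thesis
  proof (cases "a = 0")
    case True
    have "b = 0 \<Longrightarrow> z \<le> 0" using assms(1)[of 1] True by simp
    then have "0 < b" using z assms by fastforce
    then have "z \<le> z / 2" using assms(1)[of "2 * b / z"] True z by simp
    then show ?thesis using z by simp
  next
    case False
    then have "0 < a" using assms by simp
    then have "z \<le> z / 2 + 2 * a * b / z" using assms(1)[of "z / (2 * a)"] z by (simp add: field_simps)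
    then show ?thesis using z by (simp add: field_simps power2_eq_square)
  qed
qed (use assms in simp)

section \<open>Bilinear forms of measurable positive definite kernels\<close>

locale psd_kernel = finite_measure \<mu> for \<mu> :: "'a measure" +
  fixes k :: "'a \<Rightarrow> 'a \<Rightarrow> real"
  assumes k_measurable: "case_prod k \<in> borel_measurable (\<mu> \<Otimes>\<^sub>M \<mu>)"
    and k_nonneg: "\<And>x y. x \<in> space \<mu> \<Longrightarrow> y \<in> space \<mu> \<Longrightarrow> 0 \<le> k x y"
    and k_posdef: "positive_definite_on (space \<mu>) k"
begin

sublocale pair_sigma_finite \<mu> \<mu> ..

definition form :: "('a \<Rightarrow> real) \<Rightarrow> ('a \<Rightarrow> real) \<Rightarrow> real" where
  "form g h = (\<integral>(x, y). k x y * g x * h y \<partial>(\<mu> \<Otimes>\<^sub>M \<mu>))"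

text \<open>Continuity of the form on L^2, written with absolute values and as a nonnegative
  integral: one inequality then yields both integrability and a norm bound, and monotone convergence
  can establish it.\<close>

definition form_bdd :: "real \<Rightarrow> bool" where
  "form_bdd C \<longleftrightarrow> 0 \<le> C \<and> (\<forall>g. sq_int \<mu> g \<longrightarrow>
     (\<integral>\<^sup>+(x, y). ennreal (k x y * \<bar>g x\<bar> * \<bar>g y\<bar>) \<partial>(\<mu> \<Otimes>\<^sub>M \<mu>)) \<le> ennreal (C * (\<integral>x. (g x)\<^sup>2 \<partial>\<mu>)))"

lemma kernel_measurable [measurable]: "(\<lambda>z. k (fst z) (snd z)) \<in> borel_measurable (\<mu> \<Otimes>\<^sub>M \<mu>)"
  using k_measurable by (simp add: case_prod_beta')

lemma k_sym: "x \<in> space \<mu> \<Longrightarrow> y \<in> space \<mu> \<Longrightarrow> k x y = k y x"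
  using k_posdef by (simp add: positive_definite_on_def)

lemma weighted_measurable:
  assumes "sq_int \<mu> g" "sq_int \<mu> h"
  shows "(\<lambda>z. k (fst z) (snd z) * g (fst z) * h (snd z)) \<in> borel_measurable (\<mu> \<Otimes>\<^sub>M \<mu>)"
proof -
  note [measurable] = assms[THEN sq_int_measurable]
  show ?thesis by measurable
qed

text \<open>Polarisation by domination: \<open>u\<close>, which is sqrt(s) |g| + |h| / sqrt(s),
  satisfies |g(x)| |h(y)| <= u(x) u(y), and the kernel is nonnegative. The free weight s allows the
  bound to be optimised into a product of norms.\<close>

lemma form_bdd_nn:
  assumes C: "form_bdd C" and g: "sq_int \<mu> g" and h: "sq_int \<mu> h" and s: "0 < s"
  shows "(\<integral>\<^sup>+(x, y). ennreal (k x y * \<bar>g x\<bar> * \<bar>h y\<bar>) \<partial>(\<mu> \<Otimes>\<^sub>M \<mu>)) \<le>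
    ennreal (s * (2 * C * (\<integral>x. (g x)\<^sup>2 \<partial>\<mu>)) + 2 * C * (\<integral>x. (h x)\<^sup>2 \<partial>\<mu>) / s)"
proof -
  define u where "u x = sqrt s * \<bar>g x\<bar> + 1 / sqrt s * \<bar>h x\<bar>" for x
  have u: "sq_int \<mu> u" unfolding u_def by (intro sq_int_add sq_int_scale sq_int_abs g h)
  have u0: "0 \<le> u x" for x unfolding u_def using s by simp
  have le: "\<bar>g x\<bar> * \<bar>h y\<bar> \<le> \<bar>u x\<bar> * \<bar>u y\<bar>" for x y
  proof -
    have "\<bar>g x\<bar> * \<bar>h y\<bar> = (sqrt s * \<bar>g x\<bar>) * (1 / sqrt s * \<bar>h y\<bar>)" using s by simp
    also have "\<dots> \<le> u x * u y" using s by (intro mult_mono) (auto simp: u_def)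
    finally show ?thesis using u0 by simp
  qed
  have "(\<integral>\<^sup>+(x, y). ennreal (k x y * \<bar>g x\<bar> * \<bar>h y\<bar>) \<partial>(\<mu> \<Otimes>\<^sub>M \<mu>))
      \<le> (\<integral>\<^sup>+(x, y). ennreal (k x y * \<bar>u x\<bar> * \<bar>u y\<bar>) \<partial>(\<mu> \<Otimes>\<^sub>M \<mu>))"
    using le k_nonneg
    by (intro nn_integral_mono) (auto simp: space_pair_measure mult.assoc intro!: ennreal_leI mult_left_mono)
  also have "\<dots> \<le> ennreal (C * (\<integral>x. (u x)\<^sup>2 \<partial>\<mu>))"
    using C u by (simp add: form_bdd_def)
  also have "\<dots> \<le> ennreal (s * (2 * C * (\<integral>x. (g x)\<^sup>2 \<partial>\<mu>)) + 2 * C * (\<integral>x. (h x)\<^sup>2 \<partial>\<mu>) / s)"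
  proof (rule ennreal_leI)
    have "(\<integral>x. (u x)\<^sup>2 \<partial>\<mu>) \<le> 2 * (\<integral>x. (sqrt s * \<bar>g x\<bar>)\<^sup>2 \<partial>\<mu>) + 2 * (\<integral>x. (1 / sqrt s * \<bar>h x\<bar>)\<^sup>2 \<partial>\<mu>)"
      unfolding u_def by (intro integral_square_add_le sq_int_scale sq_int_abs g h)
    also have "\<dots> = 2 * s * (\<integral>x. (g x)\<^sup>2 \<partial>\<mu>) + 2 * (\<integral>x. (h x)\<^sup>2 \<partial>\<mu>) / s"
      using s by (simp add: power_mult_distrib power_divide)
    finally have "C * (\<integral>x. (u x)\<^sup>2 \<partial>\<mu>) \<le> C * (2 * s * (\<integral>x. (g x)\<^sup>2 \<partial>\<mu>) + 2 * (\<integral>x. (h x)\<^sup>2 \<partial>\<mu>) / s)"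
      using C by (intro mult_left_mono) (auto simp: form_bdd_def)
    then show "C * (\<integral>x. (u x)\<^sup>2 \<partial>\<mu>) \<le> s * (2 * C * (\<integral>x. (g x)\<^sup>2 \<partial>\<mu>)) + 2 * C * (\<integral>x. (h x)\<^sup>2 \<partial>\<mu>) / s"
      by (simp add: algebra_simps)
  qed
  finally show ?thesis .
qed

lemma form_bdd_integrable:
  assumes C: "form_bdd C" and g: "sq_int \<mu> g" and h: "sq_int \<mu> h"
  shows "integrable (\<mu> \<Otimes>\<^sub>M \<mu>) (\<lambda>(x, y). k x y * g x * h y)"
proof (rule integrableI_bounded)
  show "(\<lambda>(x, y). k x y * g x * h y) \<in> borel_measurable (\<mu> \<Otimes>\<^sub>M \<mu>)"
    using weighted_measurable[OF g h] by (simp add: case_prod_beta')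
  have "(\<integral>\<^sup>+z. ennreal (norm (case z of (x, y) \<Rightarrow> k x y * g x * h y)) \<partial>(\<mu> \<Otimes>\<^sub>M \<mu>)) =
     (\<integral>\<^sup>+(x, y). ennreal (k x y * \<bar>g x\<bar> * \<bar>h y\<bar>) \<partial>(\<mu> \<Otimes>\<^sub>M \<mu>))"
    using k_nonneg by (intro nn_integral_cong) (auto simp: space_pair_measure abs_mult)
  also have "\<dots> < \<infinity>"
    using form_bdd_nn[OF C g h, of 1] by (simp add: le_less_trans)
  finally show "(\<integral>\<^sup>+z. ennreal (norm (case z of (x, y) \<Rightarrow> k x y * g x * h y)) \<partial>(\<mu> \<Otimes>\<^sub>M \<mu>)) < \<infinity>" .
qed

text \<open>\<open>weighted_mean_bound\<close> optimises \<open>form_bdd_nn\<close> over s; the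
  factor 16 is its 4 times the two factors 2 there.\<close>

lemma form_square_bound:
  assumes C: "form_bdd C" and g: "sq_int \<mu> g" and h: "sq_int \<mu> h"
  shows "(form g h)\<^sup>2 \<le> 16 * C\<^sup>2 * (\<integral>x. (g x)\<^sup>2 \<partial>\<mu>) * (\<integral>x. (h x)\<^sup>2 \<partial>\<mu>)"
proof -
  have C0: "0 \<le> C" using C by (simp add: form_bdd_def)
  have "\<bar>form g h\<bar>\<^sup>2 \<le> 4 * (2 * C * (\<integral>x. (g x)\<^sup>2 \<partial>\<mu>)) * (2 * C * (\<integral>x. (h x)\<^sup>2 \<partial>\<mu>))"
  proof (rule weighted_mean_bound)
    fix s :: real assume s: "0 < s"
    have "ennreal (norm (form g h)) \<le> (\<integral>\<^sup>+z. ennreal (norm (case z of (x, y) \<Rightarrow> k x y * g x * h y)) \<partial>(\<mu> \<Otimes>\<^sub>M \<mu>))"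
      unfolding form_def by (rule integral_norm_bound_ennreal[OF form_bdd_integrable[OF C g h]])
    also have "\<dots> = (\<integral>\<^sup>+(x, y). ennreal (k x y * \<bar>g x\<bar> * \<bar>h y\<bar>) \<partial>(\<mu> \<Otimes>\<^sub>M \<mu>))"
      using k_nonneg by (intro nn_integral_cong) (auto simp: space_pair_measure abs_mult)
    also note form_bdd_nn[OF C g h s]
    finally show "\<bar>form g h\<bar> \<le> s * (2 * C * (\<integral>x. (g x)\<^sup>2 \<partial>\<mu>)) + 2 * C * (\<integral>x. (h x)\<^sup>2 \<partial>\<mu>) / s"
      using s C0 by (subst (asm) ennreal_le_iff) auto
  qed (use C0 in auto)
  then show ?thesis by (simp add: power2_eq_square algebra_simps)
qed

lemma form_add_left:
  assumes C: "form_bdd C" and g: "sq_int \<mu> g" "sq_int \<mu> g'" and h: "sq_int \<mu> h"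
  shows "form (\<lambda>x. g x + g' x) h = form g h + form g' h"
proof -
  have "form g h + form g' h = (\<integral>z. (case z of (x, y) \<Rightarrow> k x y * g x * h y) + (case z of (x, y) \<Rightarrow> k x y * g' x * h y) \<partial>(\<mu> \<Otimes>\<^sub>M \<mu>))"
    unfolding form_def using g h by (intro Bochner_Integration.integral_add[symmetric] form_bdd_integrable[OF C])
  then show ?thesis by (simp add: form_def case_prod_beta' algebra_simps)
qed

lemma form_scale_left: "form (\<lambda>x. c * g x) h = c * form g h"
proof -
  have "form (\<lambda>x. c * g x) h = (\<integral>z. c * (case z of (x, y) \<Rightarrow> k x y * g x * h y) \<partial>(\<mu> \<Otimes>\<^sub>M \<mu>))"
    by (simp add: form_def case_prod_beta' algebra_simps)
  then show ?thesis by (simp add: form_def)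
qed

lemma form_commute:
  assumes "sq_int \<mu> g" "sq_int \<mu> h"
  shows "form g h = form h g"
proof -
  have "form g h = (\<integral>(x, y). (\<lambda>z. k (fst z) (snd z) * g (fst z) * h (snd z)) (y, x) \<partial>(\<mu> \<Otimes>\<^sub>M \<mu>))"
    by (subst integral_product_swap[OF weighted_measurable[OF assms]]) (simp add: form_def case_prod_beta')
  also have "\<dots> = form h g"
    unfolding form_def using k_sym
    by (intro Bochner_Integration.integral_cong refl) (auto simp: space_pair_measure mult.commute)
  finally show ?thesis .
qed

lemma form_add_right:
  assumes "form_bdd C" "sq_int \<mu> g" "sq_int \<mu> g'" "sq_int \<mu> h"
  shows "form h (\<lambda>x. g x + g' x) = form h g + form h g'"
  using assms by (simp add: form_commute[of h] form_add_left sq_int_add)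

lemma form_scale_right: "form g (\<lambda>x. c * h x) = c * form g h"
proof -
  have "form g (\<lambda>x. c * h x) = (\<integral>z. c * (case z of (x, y) \<Rightarrow> k x y * g x * h y) \<partial>(\<mu> \<Otimes>\<^sub>M \<mu>))"
    by (simp add: form_def case_prod_beta' algebra_simps)
  then show ?thesis by (simp add: form_def)
qed

lemma form_zero_left: "form (\<lambda>x. 0) h = 0" and form_zero_right: "form h (\<lambda>x. 0) = 0"
  by (simp_all add: form_def case_prod_beta')

lemma form_sum_left:
  assumes "form_bdd C" "\<And>i. i \<in> I \<Longrightarrow> sq_int \<mu> (g i)" "sq_int \<mu> h"
  shows "form (\<lambda>x. \<Sum>i\<in>I. g i x) h = (\<Sum>i\<in>I. form (g i) h)"
  using assms(2)
  by (induction I rule: infinite_finite_induct)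
    (auto simp: form_zero_left form_add_left[OF assms(1) _ _ assms(3)] sq_int_sum)

lemma form_sum_right:
  assumes "form_bdd C" "\<And>i. i \<in> I \<Longrightarrow> sq_int \<mu> (g i)" "sq_int \<mu> h"
  shows "form h (\<lambda>x. \<Sum>i\<in>I. g i x) = (\<Sum>i\<in>I. form h (g i))"
  using assms(2)
  by (induction I rule: infinite_finite_induct)
    (auto simp: form_zero_right form_add_right[OF assms(1) _ _ assms(3)] sq_int_sum)

lemma form_combination:
  assumes "form_bdd C" "\<And>i. i \<in> I \<Longrightarrow> sq_int \<mu> (g i)" "\<And>j. j \<in> J \<Longrightarrow> sq_int \<mu> (h j)"
  shows "form (\<lambda>x. \<Sum>i\<in>I. c i * g i x) (\<lambda>x. \<Sum>j\<in>J. d j * h j x) = (\<Sum>i\<in>I. \<Sum>j\<in>J. c i * d j * form (g i) (h j))"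
  using assms
  by (simp add: form_sum_left form_sum_right sq_int_sum sq_int_scale form_scale_left form_scale_right
      sum_distrib_left mult.assoc)

text \<open>The difference of the two sides is the form of \<open>G n - g\<close> and
  \<open>H n\<close> plus the form of \<open>g\<close> and \<open>H n - h\<close>. The norms of
  \<open>H n\<close> converge, hence stay bounded, so both pieces vanish by
  \<open>form_square_bound\<close>.\<close>

lemma form_tendsto:
  assumes C: "form_bdd C" and G: "sq_lim \<mu> G g" and H: "sq_lim \<mu> H h"
  shows "(\<lambda>n. form (G n) (H n)) \<longlonglongrightarrow> form g h"
proof -
  have sq: "sq_int \<mu> (G n)" "sq_int \<mu> g" "sq_int \<mu> (H n)" "sq_int \<mu> h"
    "sq_int \<mu> (\<lambda>x. G n x - g x)" "sq_int \<mu> (\<lambda>x. H n x - h x)" for n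
    using G H by (auto simp: sq_lim_def intro: sq_int_diff)
  have small: "(\<lambda>n. form (u n) (v n)) \<longlonglongrightarrow> 0"
    if u: "\<And>n. sq_int \<mu> (u n)" and v: "\<And>n. sq_int \<mu> (v n)"
      and lim: "(\<lambda>n. (\<integral>x. (u n x)\<^sup>2 \<partial>\<mu>) * (\<integral>x. (v n x)\<^sup>2 \<partial>\<mu>)) \<longlonglongrightarrow> 0" for u v
  proof -
    have "(\<lambda>n. (form (u n) (v n))\<^sup>2) \<longlonglongrightarrow> 0"
    proof (rule tendsto_sandwich[OF _ _ tendsto_const])
      show "(\<lambda>n. 16 * C\<^sup>2 * (\<integral>x. (u n x)\<^sup>2 \<partial>\<mu>) * (\<integral>x. (v n x)\<^sup>2 \<partial>\<mu>)) \<longlonglongrightarrow> 0"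
        using tendsto_mult_left[OF lim, of "16 * C\<^sup>2"] by (simp add: mult.assoc)
    qed (auto intro!: always_eventually form_square_bound[OF C] u v)
    from tendsto_real_sqrt[OF this] show ?thesis
      by (simp add: tendsto_rabs_zero_iff)
  qed
  have G0: "(\<lambda>n. \<integral>x. (G n x - g x)\<^sup>2 \<partial>\<mu>) \<longlonglongrightarrow> 0" and H0: "(\<lambda>n. \<integral>x. (H n x - h x)\<^sup>2 \<partial>\<mu>) \<longlonglongrightarrow> 0"
    using G H by (auto simp: sq_lim_def)
  have H1: "(\<lambda>n. \<integral>x. (H n x)\<^sup>2 \<partial>\<mu>) \<longlonglongrightarrow> (\<integral>x. (h x)\<^sup>2 \<partial>\<mu>)"
    using sq_lim_integral_mult[OF H H] by (simp add: power2_eq_square)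
  have "(\<lambda>n. form (\<lambda>x. G n x - g x) (H n)) \<longlonglongrightarrow> 0"
    using tendsto_mult[OF G0 H1] by (intro small sq) simp
  moreover have "(\<lambda>n. form g (\<lambda>x. H n x - h x)) \<longlonglongrightarrow> 0"
    using tendsto_mult_left[OF H0, of "\<integral>x. (g x)\<^sup>2 \<partial>\<mu>"] by (intro small sq) simp
  ultimately have "(\<lambda>n. form (\<lambda>x. G n x - g x) (H n) + form g (\<lambda>x. H n x - h x) + form g h) \<longlonglongrightarrow> 0 + 0 + form g h"
    by (intro tendsto_add tendsto_const)
  moreover have "form (\<lambda>x. G n x - g x) (H n) + form g (\<lambda>x. H n x - h x) + form g h = form (G n) (H n)" for n
    using form_add_left[OF C sq(5) sq(2) sq(3), of n n] form_add_right[OF C sq(6) sq(4) sq(2), of n] by simp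
  ultimately show ?thesis by simp
qed

end

section \<open>Orthonormal bases\<close>

definition orthonormal_basis :: "'a measure \<Rightarrow> (nat \<Rightarrow> 'a \<Rightarrow> real) \<Rightarrow> bool" where
  "orthonormal_basis \<mu> e \<longleftrightarrow>
     (\<forall>l\<ge>1. sq_int \<mu> (e l)) \<and>
     (\<forall>j\<ge>1. \<forall>l\<ge>1. (\<integral>x. e j x * e l x \<partial>\<mu>) = (if j = l then 1 else 0)) \<and>
     (\<forall>g. sq_int \<mu> g \<longrightarrow> sq_lim \<mu> (\<lambda>n x. \<Sum>l=1..n. (\<integral>x. g x * e l x \<partial>\<mu>) * e l x) g)"

lemma orthonormal_combination_norm:
  assumes e: "orthonormal_basis \<mu> e" and I: "finite I" "I \<subseteq> {1..}"
  shows "(\<integral>x. (\<Sum>l\<in>I. c l * e l x)\<^sup>2 \<partial>\<mu>) = (\<Sum>l\<in>I. (c l)\<^sup>2)"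
proof -
  have sq: "sq_int \<mu> (e l)" if "l \<in> I" for l using e I that by (auto simp: orthonormal_basis_def)
  have "(\<integral>x. (\<Sum>l\<in>I. c l * e l x)\<^sup>2 \<partial>\<mu>) = (\<integral>x. (\<Sum>l\<in>I. \<Sum>j\<in>I. c l * c j * (e l x * e j x)) \<partial>\<mu>)"
    by (simp add: power2_eq_square sum_product algebra_simps)
  also have "\<dots> = (\<Sum>l\<in>I. \<Sum>j\<in>I. c l * c j * (\<integral>x. e l x * e j x \<partial>\<mu>))"
    by (simp add: sq sq_int_mult integrable_mult_right)
  also have "\<dots> = (\<Sum>l\<in>I. \<Sum>j\<in>I. if l = j then c l * c j else 0)"
  proof (intro sum.cong refl)
    fix l j assume "l \<in> I" "j \<in> I"
    then have "(\<integral>x. e l x * e j x \<partial>\<mu>) = (if l = j then 1 else 0)"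
      using e I unfolding orthonormal_basis_def by blast
    then show "c l * c j * (\<integral>x. e l x * e j x \<partial>\<mu>) = (if l = j then c l * c j else 0)" by simp
  qed
  also have "\<dots> = (\<Sum>l\<in>I. (c l)\<^sup>2)"
    using I by (simp add: power2_eq_square)
  finally show ?thesis .
qed

text \<open>The squared distance from \<open>g\<close> to its projection \<open>p\<close> is
  nonnegative. It serves twice: in the trace estimate, to pass from coefficients to the norm, and at
  the end, to bound the projected initial values independently of N.\<close>

lemma Bessel_inequality:
  assumes e: "orthonormal_basis \<mu> e" and g: "sq_int \<mu> g" and I: "finite I" "I \<subseteq> {1..}"
  shows "(\<Sum>l\<in>I. (\<integral>x. g x * e l x \<partial>\<mu>)\<^sup>2) \<le> (\<integral>x. (g x)\<^sup>2 \<partial>\<mu>)"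
proof -
  define c where "c l = (\<integral>x. g x * e l x \<partial>\<mu>)" for l
  define p where "p x = (\<Sum>l\<in>I. c l * e l x)" for x
  have sq: "sq_int \<mu> (e l)" if "l \<in> I" for l using e I that by (auto simp: orthonormal_basis_def)
  have p: "sq_int \<mu> p" unfolding p_def by (intro sq_int_sum sq_int_scale sq)
  have "(\<integral>x. g x * p x \<partial>\<mu>) = (\<integral>x. (\<Sum>l\<in>I. c l * (g x * e l x)) \<partial>\<mu>)"
    by (simp add: p_def sum_distrib_left algebra_simps)
  also have "\<dots> = (\<Sum>l\<in>I. (c l)\<^sup>2)"
    using sq_int_mult[OF g sq] by (simp add: c_def power2_eq_square)
  finally have gp: "(\<integral>x. g x * p x \<partial>\<mu>) = (\<Sum>l\<in>I. (c l)\<^sup>2)" .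
  have pp: "(\<integral>x. (p x)\<^sup>2 \<partial>\<mu>) = (\<Sum>l\<in>I. (c l)\<^sup>2)"
    unfolding p_def by (rule orthonormal_combination_norm[OF e I])
  have "0 \<le> (\<integral>x. (g x - p x)\<^sup>2 \<partial>\<mu>)" by simp
  also have "\<dots> = (\<integral>x. (g x)\<^sup>2 - 2 * (g x * p x) + (p x)\<^sup>2 \<partial>\<mu>)"
    by (simp add: power2_diff algebra_simps)
  also have "\<dots> = (\<integral>x. (g x)\<^sup>2 \<partial>\<mu>) - (\<Sum>l\<in>I. (c l)\<^sup>2)"
    using sq_int_square[OF g] sq_int_square[OF p] sq_int_mult[OF g p] by (simp add: gp pp)
  finally show ?thesis by (simp add: c_def)
qed

section \<open>Bounded kernels: nonnegativity of the form and the trace bound\<close>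

locale bounded_psd_kernel = psd_kernel +
  fixes K :: real
  assumes k_le: "\<And>x y. x \<in> space \<mu> \<Longrightarrow> y \<in> space \<mu> \<Longrightarrow> k x y \<le> K"
begin

lemma k_le_abs: "x \<in> space \<mu> \<Longrightarrow> y \<in> space \<mu> \<Longrightarrow> k x y \<le> \<bar>K\<bar>"
  using k_le[of x y] by linarith

text \<open>Cauchy-Schwarz against the constant 1: the squared L^1 norm of \<open>g\<close> is at
  most the total mass times its squared L^2 norm. This bound grows with \<open>K\<close>;
  \<open>form_le_trace\<close> supplies one that does not.\<close>

lemma form_bdd: "form_bdd (\<bar>K\<bar> * measure \<mu> (space \<mu>))"
  unfolding form_bdd_def
proof (intro conjI allI impI)
  fix g assume g: "sq_int \<mu> g"
  have sf: "sigma_finite_measure \<mu>" by unfold_locales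
  have int: "integrable \<mu> (\<lambda>x. \<bar>g x\<bar>)" using sq_int_integrable[OF g] by simp
  have [measurable]: "g \<in> borel_measurable \<mu>" using g by (rule sq_int_measurable)
  have "(\<integral>\<^sup>+(x, y). ennreal (k x y * \<bar>g x\<bar> * \<bar>g y\<bar>) \<partial>(\<mu> \<Otimes>\<^sub>M \<mu>))
      \<le> (\<integral>\<^sup>+z. ennreal \<bar>K\<bar> * ennreal \<bar>g (fst z)\<bar> * ennreal \<bar>g (snd z)\<bar> \<partial>(\<mu> \<Otimes>\<^sub>M \<mu>))"
    using k_le_abs k_nonneg
    by (intro nn_integral_mono)
      (auto simp: space_pair_measure ennreal_mult[symmetric] intro!: ennreal_leI mult_right_mono intro: order_trans)
  also have "\<dots> = (\<integral>\<^sup>+x. (\<integral>\<^sup>+y. ennreal \<bar>K\<bar> * ennreal \<bar>g x\<bar> * ennreal \<bar>g y\<bar> \<partial>\<mu>) \<partial>\<mu>)"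
    using sigma_finite_measure.nn_integral_fst[OF sf, of "\<lambda>z. ennreal \<bar>K\<bar> * ennreal \<bar>g (fst z)\<bar> * ennreal \<bar>g (snd z)\<bar>" \<mu>] by simp
  also have "\<dots> = ennreal \<bar>K\<bar> * ennreal (\<integral>x. \<bar>g x\<bar> \<partial>\<mu>) * ennreal (\<integral>x. \<bar>g x\<bar> \<partial>\<mu>)"
    using int by (simp add: nn_integral_cmult nn_integral_multc nn_integral_eq_integral)
  also have "\<dots> = ennreal (\<bar>K\<bar> * (\<integral>x. \<bar>g x\<bar> * 1 \<partial>\<mu>)\<^sup>2)"
    by (simp add: ennreal_mult power2_eq_square mult.assoc)
  also have "\<dots> \<le> ennreal (\<bar>K\<bar> * ((\<integral>x. \<bar>g x\<bar>\<^sup>2 \<partial>\<mu>) * (\<integral>x. 1\<^sup>2 \<partial>\<mu>)))"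
    by (intro ennreal_leI mult_left_mono sq_int_Cauchy_Schwarz sq_int_abs g sq_int_const) simp
  finally show "(\<integral>\<^sup>+(x, y). ennreal (k x y * \<bar>g x\<bar> * \<bar>g y\<bar>) \<partial>(\<mu> \<Otimes>\<^sub>M \<mu>)) \<le>
      ennreal (\<bar>K\<bar> * measure \<mu> (space \<mu>) * (\<integral>x. (g x)\<^sup>2 \<partial>\<mu>))"
    by (simp add: mult_ac)
qed simp

lemma kernel_section_measurable:
  assumes "x \<in> space \<mu>"
  shows "k x \<in> borel_measurable \<mu>"
  using measurable_Pair2[OF k_measurable assms] by simp

text \<open>Integrating the positive definiteness inequality for \<open>m + n\<close> points over the last \<open>n\<close> of
  them with weights \<open>g\<close>: the diagonal enters only linearly in \<open>n\<close>, so that the double integral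
  of the kernel must be nonnegative.\<close>

lemma sampled_inequality:
  fixes m n :: nat
  assumes g: "sq_int \<mu> g" and m0: "0 < measure \<mu> (space \<mu>)" and x: "\<And>i. i < m \<Longrightarrow> x i \<in> space \<mu>"
  shows "0 \<le> (\<Sum>i<m. \<Sum>j<m. c i * c j * k (x i) (x j)) + 2 * real n * (\<Sum>i<m. c i * (\<integral>y. k (x i) y * g y \<partial>\<mu>))
     + real n * measure \<mu> (space \<mu>) * (\<integral>y. k y y * (g y)\<^sup>2 \<partial>\<mu>) + real n * (real n - 1) * form g g"
  using x
proof (induction n arbitrary: m x c)
  case 0
  then show ?case
    using positive_definite_on_indexed[OF k_posdef, of "{..<m}" x c] by auto
next
  case (Suc n)
  define w where "w = measure \<mu> (space \<mu>)"
  define h where "h y = (\<integral>z. k y z * g z \<partial>\<mu>)" for y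
  define d where "d = (\<integral>y. k y y * (g y)\<^sup>2 \<partial>\<mu>)"
  define S where "S = (\<Sum>i<m. \<Sum>j<m. c i * c j * k (x i) (x j))"
  define R where "R = (\<Sum>i<m. c i * h (x i))"
  define J where "J z = S + 2 * w * (\<Sum>i<m. c i * (k (x i) z * g z)) + w\<^sup>2 * (k z z * (g z)\<^sup>2)
     + 2 * real n * R + 2 * real n * w * (g z * h z) + real n * w * d + real n * (real n - 1) * form g g" for z
  have gm[measurable]: "g \<in> borel_measurable \<mu>" using g by (rule sq_int_measurable)
  have pos: "0 \<le> J z" if z: "z \<in> space \<mu>" for z
  proof -
    have symm: "k z (x i) = k (x i) z" if "i < m" for i using k_sym[OF z Suc.prems[OF that]] .
    \<comment> \<open>The new point z is to be averaged over \<mu> divided by its mass w. Its weight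
      \<open>w * g z\<close> makes the average of each cross term an integral of \<open>g\<close>
      against \<mu>. The induction hypothesis treats z as one more fixed point, which is why
      \<open>m\<close>, \<open>x\<close> and \<open>c\<close> are generalised.\<close>
    have "0 \<le> (\<Sum>i<Suc m. \<Sum>j<Suc m. (c(m := w * g z)) i * (c(m := w * g z)) j * k ((x(m := z)) i) ((x(m := z)) j))
      + 2 * real n * (\<Sum>i<Suc m. (c(m := w * g z)) i * (\<integral>y. k ((x(m := z)) i) y * g y \<partial>\<mu>))
     + real n * measure \<mu> (space \<mu>) * (\<integral>y. k y y * (g y)\<^sup>2 \<partial>\<mu>) + real n * (real n - 1) * form g g"
      by (rule Suc.IH) (use Suc.prems z in \<open>auto simp: less_Suc_eq\<close>)
    also have "\<dots> = J z"
      unfolding J_def S_def R_def h_def[symmetric] w_def[symmetric] d_def[symmetric]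
      by (simp add: symm sum.distrib sum_distrib_left power2_eq_square algebra_simps)
    finally show ?thesis .
  qed
  have int_kg: "integrable \<mu> (\<lambda>z. k y z * g z)" if "y \<in> space \<mu>" for y
  proof (rule Bochner_Integration.integrable_bound)
    show "integrable \<mu> (\<lambda>z. \<bar>K\<bar> * \<bar>g z\<bar>)" using sq_int_integrable[OF g] by simp
    show "(\<lambda>z. k y z * g z) \<in> borel_measurable \<mu>" using kernel_section_measurable[OF that] by simp
    show "AE z in \<mu>. norm (k y z * g z) \<le> norm (\<bar>K\<bar> * \<bar>g z\<bar>)"
      using k_le_abs[OF that] k_nonneg[OF that]
      by (intro AE_I2) (auto simp: abs_mult intro!: mult_right_mono intro: order_trans)
  qed
  have int_d: "integrable \<mu> (\<lambda>z. k z z * (g z)\<^sup>2)"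
  proof (rule Bochner_Integration.integrable_bound)
    show "integrable \<mu> (\<lambda>z. \<bar>K\<bar> * (g z)\<^sup>2)" using sq_int_square[OF g] by simp
    have "(\<lambda>z. (\<lambda>p. k (fst p) (snd p)) (z, z)) \<in> borel_measurable \<mu>" by measurable
    then have "(\<lambda>z. k z z) \<in> borel_measurable \<mu>" by simp
    then show "(\<lambda>z. k z z * (g z)\<^sup>2) \<in> borel_measurable \<mu>" by simp
    show "AE z in \<mu>. norm (k z z * (g z)\<^sup>2) \<le> norm (\<bar>K\<bar> * (g z)\<^sup>2)"
      using k_le_abs k_nonneg
      by (intro AE_I2) (auto simp: abs_mult intro!: mult_right_mono intro: order_trans)
  qed
  have int2: "integrable (\<mu> \<Otimes>\<^sub>M \<mu>) (\<lambda>(y, z). k y z * g y * g z)"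
    by (rule form_bdd_integrable[OF form_bdd g g])
  have gh: "(\<lambda>y. \<integral>z. k y z * g y * g z \<partial>\<mu>) = (\<lambda>y. g y * h y)"
  proof
    fix y
    have "(\<integral>z. k y z * g y * g z \<partial>\<mu>) = (\<integral>z. g y * (k y z * g z) \<partial>\<mu>)" by (simp add: mult_ac)
    then show "(\<integral>z. k y z * g y * g z \<partial>\<mu>) = g y * h y" by (simp add: h_def)
  qed
  have int_gh: "integrable \<mu> (\<lambda>y. g y * h y)" and eq_gh: "(\<integral>y. g y * h y \<partial>\<mu>) = form g g"
    using integrable_fst[OF int2] integral_fst[OF int2] by (simp_all add: gh form_def)
  have "0 \<le> (\<integral>z. J z \<partial>\<mu>)" using pos by (intro Bochner_Integration.integral_nonneg_AE AE_I2)
  also have "(\<integral>z. J z \<partial>\<mu>) = w * S + 2 * w * R + w\<^sup>2 * d + w * (2 * real n * R) + 2 * real n * w * form g g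
      + w * (real n * w * d) + w * (real n * (real n - 1) * form g g)"
  proof -
    define a where "a = S + 2 * real n * R + real n * w * d + real n * (real n - 1) * form g g"
    have sum: "has_bochner_integral \<mu> (\<lambda>z. \<Sum>i<m. c i * (k (x i) z * g z)) R"
      unfolding R_def h_def
      by (intro has_bochner_integral_sum has_bochner_integral_mult_right has_bochner_integral_integrable int_kg Suc.prems) simp
    have diag: "has_bochner_integral \<mu> (\<lambda>z. k z z * (g z)\<^sup>2) d"
      unfolding d_def by (rule has_bochner_integral_integrable[OF int_d])
    have dbl: "has_bochner_integral \<mu> (\<lambda>z. g z * h z) (form g g)"
      using has_bochner_integral_integrable[OF int_gh] by (simp add: eq_gh)
    have const: "has_bochner_integral \<mu> (\<lambda>z. a) (w * a)"
      using has_bochner_integral_integrable[of \<mu> "\<lambda>z. a"] by (simp add: w_def)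
    have J: "J = (\<lambda>z. a + 2 * w * (\<Sum>i<m. c i * (k (x i) z * g z)) + w\<^sup>2 * (k z z * (g z)\<^sup>2) + 2 * real n * w * (g z * h z))"
      by (simp add: J_def a_def fun_eq_iff)
    have "has_bochner_integral \<mu> J (w * a + 2 * w * R + w\<^sup>2 * d + 2 * real n * w * form g g)"
      unfolding J
      by (intro has_bochner_integral_add has_bochner_integral_mult_right const sum diag dbl)
    then have "(\<integral>z. J z \<partial>\<mu>) = w * a + 2 * w * R + w\<^sup>2 * d + 2 * real n * w * form g g"
      by (rule has_bochner_integral_integral_eq)
    then show ?thesis by (simp add: a_def algebra_simps)
  qed
  \<comment> \<open>The integration over z was not normalised, hence the common factor w, which is
    then cancelled.\<close>
  also have "\<dots> = w * (S + 2 * real (Suc n) * R + real (Suc n) * w * d + real (Suc n) * (real (Suc n) - 1) * form g g)"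
    by (simp add: algebra_simps power2_eq_square)
  finally have "0 \<le> S + 2 * real (Suc n) * R + real (Suc n) * w * d + real (Suc n) * (real (Suc n) - 1) * form g g"
    using m0 by (simp add: zero_le_mult_iff w_def)
  then show ?case by (simp add: S_def R_def w_def d_def h_def)
qed

text \<open>Sampling n points, with no fixed ones, gives 0 <= n d + n (n - 1)
  \<open>form g g\<close>, whose quadratic term dominates for large n. The null measure is treated
  apart because sampling divides by the total mass.\<close>

lemma form_nonneg:
  assumes g: "sq_int \<mu> g"
  shows "0 \<le> form g g"
proof (cases "measure \<mu> (space \<mu>) = 0")
  case True
  then have "emeasure \<mu> (space \<mu>) = 0" by (simp add: emeasure_eq_measure)
  then have null: "AE x in \<mu>. False" by (intro AE_I[where N="space \<mu>"]) auto
  have int2: "integrable (\<mu> \<Otimes>\<^sub>M \<mu>) (\<lambda>(y, z). k y z * g y * g z)"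
    by (rule form_bdd_integrable[OF form_bdd g g])
  have "form g g = (\<integral>y. (\<integral>z. k y z * g y * g z \<partial>\<mu>) \<partial>\<mu>)"
    using integral_fst[OF int2] by (simp add: form_def)
  also have "\<dots> = 0" using null by (intro integral_eq_zero_AE) auto
  finally show ?thesis by simp
next
  case False
  define d where "d = measure \<mu> (space \<mu>) * (\<integral>y. k y y * (g y)\<^sup>2 \<partial>\<mu>)"
  have w: "0 < measure \<mu> (space \<mu>)" using False by (simp add: zero_less_measure_iff)
  have main: "0 \<le> real n * d + real n * (real n - 1) * form g g" for n
    using sampled_inequality[OF g w, of 0 undefined undefined n] by (simp add: d_def)
  show ?thesis
  proof (rule ccontr)
    assume "\<not> 0 \<le> form g g"
    then have neg: "0 < - form g g" by simp
    \<comment> \<open>This n makes \<open>d + real n * form g g\<close> negative, while n + 1 sample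
      points force it to be nonnegative.\<close>
    then obtain n where "d / (- form g g) < real n" using reals_Archimedean2 by blast
    then have "d < real n * (- form g g)" by (simp only: pos_divide_less_eq[OF neg])
    then have "d + real n * form g g < 0" by simp
    moreover have "0 \<le> real (Suc n) * (d + real n * form g g)"
      using main[of "Suc n"] by (simp add: algebra_simps)
    ultimately show False by (simp add: zero_le_mult_iff)
  qed
qed

text \<open>For a positive form the trace dominates the operator norm: nonnegativity at
  \<open>c j * g l - c l * g j\<close> bounds twice the mixed term, and the double sum of these
  bounds factorises.\<close>

lemma form_combination_le_trace:
  assumes g: "\<And>l. l \<in> I \<Longrightarrow> sq_int \<mu> (g l)" and I: "finite I"
  shows "form (\<lambda>x. \<Sum>l\<in>I. c l * g l x) (\<lambda>x. \<Sum>l\<in>I. c l * g l x) \<le> (\<Sum>l\<in>I. (c l)\<^sup>2) * (\<Sum>l\<in>I. form (g l) (g l))"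
proof -
  have two: "2 * (c l * c j * form (g l) (g j)) \<le> (c j)\<^sup>2 * form (g l) (g l) + (c l)\<^sup>2 * form (g j) (g j)"
    if l: "l \<in> I" and j: "j \<in> I" for l j
  proof -
    let ?u = "\<lambda>x. c j * g l x + (- c l) * g j x"
    have sq: "sq_int \<mu> (\<lambda>x. c j * g l x)" "sq_int \<mu> (\<lambda>x. (- c l) * g j x)"
      using g l j by (blast intro: sq_int_scale)+
    have "0 \<le> form ?u ?u" by (intro form_nonneg sq_int_add sq)
    also have "\<dots> = form (\<lambda>x. c j * g l x) (\<lambda>x. c j * g l x) + form (\<lambda>x. c j * g l x) (\<lambda>x. (- c l) * g j x)
       + (form (\<lambda>x. (- c l) * g j x) (\<lambda>x. c j * g l x) + form (\<lambda>x. (- c l) * g j x) (\<lambda>x. (- c l) * g j x))"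
      by (simp only: form_add_left[OF form_bdd] form_add_right[OF form_bdd] sq sq_int_add)
    also have "\<dots> = (c j)\<^sup>2 * form (g l) (g l) - 2 * (c l * c j * form (g l) (g j)) + (c l)\<^sup>2 * form (g j) (g j)"
      using form_commute[OF g[OF j] g[OF l]]
      by (simp only: form_scale_left form_scale_right) (simp add: power2_eq_square algebra_simps)
    finally show ?thesis by simp
  qed
  have "2 * form (\<lambda>x. \<Sum>l\<in>I. c l * g l x) (\<lambda>x. \<Sum>l\<in>I. c l * g l x)
      = (\<Sum>l\<in>I. \<Sum>j\<in>I. 2 * (c l * c j * form (g l) (g j)))"
    by (simp add: form_combination[OF form_bdd g g] sum_distrib_left)
  also have "\<dots> \<le> (\<Sum>l\<in>I. \<Sum>j\<in>I. (c j)\<^sup>2 * form (g l) (g l) + (c l)\<^sup>2 * form (g j) (g j))"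
    by (intro sum_mono two)
  also have "\<dots> = 2 * ((\<Sum>l\<in>I. (c l)\<^sup>2) * (\<Sum>l\<in>I. form (g l) (g l)))"
  proof -
    have "(\<Sum>l\<in>I. \<Sum>j\<in>I. (c j)\<^sup>2 * form (g l) (g l)) = (\<Sum>j\<in>I. \<Sum>l\<in>I. (c j)\<^sup>2 * form (g l) (g l))"
      by (rule sum.swap)
    then show ?thesis by (simp add: sum.distrib sum_product)
  qed
  finally show ?thesis by simp
qed

text \<open>The finite trace bound applies to the partial sums of the expansion of \<open>g\<close>,
  with Bessel's inequality for the coefficients; continuity of the form carries it over to
  \<open>g\<close>.\<close>

lemma form_le_trace:
  assumes e: "orthonormal_basis \<mu> e" and tr: "\<And>n. (\<Sum>l=1..n. form (e l) (e l)) \<le> \<tau>" and g: "sq_int \<mu> g"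
  shows "form g g \<le> \<tau> * (\<integral>x. (g x)\<^sup>2 \<partial>\<mu>)"
proof -
  define P where "P n x = (\<Sum>l=1..n. (\<integral>x. g x * e l x \<partial>\<mu>) * e l x)" for n :: nat and x
  have e1: "sq_int \<mu> (e l)" if "1 \<le> l" for l using e that by (simp add: orthonormal_basis_def)
  have P: "sq_lim \<mu> P g" using e g unfolding orthonormal_basis_def P_def by blast
  have "form (P n) (P n) \<le> \<tau> * (\<integral>x. (g x)\<^sup>2 \<partial>\<mu>)" for n
  proof -
    have "form (P n) (P n) \<le> (\<Sum>l=1..n. (\<integral>x. g x * e l x \<partial>\<mu>)\<^sup>2) * (\<Sum>l=1..n. form (e l) (e l))"
      unfolding P_def by (rule form_combination_le_trace) (auto intro: e1)
    also have "\<dots> \<le> (\<integral>x. (g x)\<^sup>2 \<partial>\<mu>) * \<tau>"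
      by (intro mult_mono tr Bessel_inequality[OF e g] sum_nonneg form_nonneg e1) auto
    finally show ?thesis by (simp add: mult.commute)
  qed
  then show ?thesis
    using form_tendsto[OF form_bdd P P] by (intro LIMSEQ_le_const2) auto
qed

end

section \<open>Removing the truncation\<close>

context psd_kernel
begin

lemma form_bdd_if_trace_bounded:
  assumes e: "orthonormal_basis \<mu> e" and \<kappa>: "0 \<le> \<kappa>"
    and tr: "\<And>n f. 1 \<le> n \<Longrightarrow> sq_int \<mu> f \<Longrightarrow>
      (\<integral>(x, y). (\<Sum>l=1..n. k x y * e l x * e l y) * f x * f y \<partial>(\<mu> \<Otimes>\<^sub>M \<mu>)) \<le> \<kappa> * (\<integral>x. (f x)\<^sup>2 \<partial>\<mu>)"
  shows "form_bdd (\<kappa> * measure \<mu> (space \<mu>))"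
  unfolding form_bdd_def
proof (intro conjI allI impI)
  fix g assume g: "sq_int \<mu> g"
  define D where "D n = {x \<in> space \<mu>. k x x \<le> real n}" for n
  define kD where "kD n x y = indicator (D n) x * indicator (D n) y * k x y" for n x y
  have "(\<lambda>z. (\<lambda>p. k (fst p) (snd p)) (z, z)) \<in> borel_measurable \<mu>" by measurable
  then have diag[measurable]: "(\<lambda>z. k z z) \<in> borel_measurable \<mu>" by simp
  have [measurable]: "D n \<in> sets \<mu>" for n unfolding D_def by measurable
  have e1: "sq_int \<mu> (e l)" if "1 \<le> l" for l using e that by (simp add: orthonormal_basis_def)
  have [measurable]: "g \<in> borel_measurable \<mu>" using g by (rule sq_int_measurable)
  have bdd: "bounded_psd_kernel \<mu> (kD n) (real n)" for n
  proof
    have "(\<lambda>p. indicator (D n) (fst p) * indicator (D n) (snd p) * k (fst p) (snd p)) \<in> borel_measurable (\<mu> \<Otimes>\<^sub>M \<mu>)"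
      by measurable
    then show "case_prod (kD n) \<in> borel_measurable (\<mu> \<Otimes>\<^sub>M \<mu>)" by (simp add: kD_def case_prod_beta')
    show "0 \<le> kD n x y" if "x \<in> space \<mu>" "y \<in> space \<mu>" for x y
      using k_nonneg[OF that] by (simp add: kD_def)
    show "positive_definite_on (space \<mu>) (kD n)"
      unfolding positive_definite_on_def
    proof (intro conjI ballI allI impI)
      show "kD n x y = kD n y x" if "x \<in> space \<mu>" "y \<in> space \<mu>" for x y
        using k_sym[OF that] by (simp add: kD_def mult_ac)
      fix X c assume X: "finite X \<and> X \<subseteq> space \<mu>"
      have pd: "0 \<le> (\<Sum>x\<in>X. \<Sum>y\<in>X. b x * b y * k x y)" for b
        using k_posdef X unfolding positive_definite_on_def by blast
      have "(\<Sum>x\<in>X. \<Sum>y\<in>X. c x * c y * kD n x y) =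
          (\<Sum>x\<in>X. \<Sum>y\<in>X. (c x * indicator (D n) x) * (c y * indicator (D n) y) * k x y)"
        unfolding kD_def by (intro sum.cong refl) (simp only: mult_ac)
      then show "0 \<le> (\<Sum>x\<in>X. \<Sum>y\<in>X. c x * c y * kD n x y)"
        using pd[of "\<lambda>x. c x * indicator (D n) x"] by simp
    qed
    show "kD n x y \<le> real n" if xy: "x \<in> space \<mu>" "y \<in> space \<mu>" for x y
    proof (cases "x \<in> D n \<and> y \<in> D n")
      case True
      \<comment> \<open>Weights 1 and -1 at x and y: the diagonal values control the off-diagonal
        ones, so a truncation by the diagonal bounds the kernel on the whole square. The indexed
        form of positive definiteness also covers x = y.\<close>
      have "0 \<le> (\<Sum>i\<in>{0, 1::nat}. \<Sum>j\<in>{0, 1::nat}. (if i = 0 then 1 else -1) * (if j = 0 then 1 else -1)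
          * k (if i = 0 then x else y) (if j = 0 then x else y))"
        using xy by (intro positive_definite_on_indexed[OF k_posdef]) auto
      then have "2 * k x y \<le> k x x + k y y" using k_sym[OF xy] by simp
      also have "\<dots> \<le> 2 * real n" using True by (simp add: D_def)
      finally show ?thesis using True by (simp add: kD_def)
    qed (auto simp: kD_def)
  qed
  have le: "(\<integral>\<^sup>+(x, y). ennreal (kD n x y * \<bar>g x\<bar> * \<bar>g y\<bar>) \<partial>(\<mu> \<Otimes>\<^sub>M \<mu>)) \<le>
      ennreal (\<kappa> * measure \<mu> (space \<mu>) * (\<integral>x. (g x)\<^sup>2 \<partial>\<mu>))" for n
  proof -
    interpret D: bounded_psd_kernel \<mu> "kD n" "real n" by (rule bdd)
    have "(\<Sum>l=1..m. D.form (e l) (e l)) \<le> \<kappa> * measure \<mu> (space \<mu>)" for m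
    \<comment> \<open>The hypothesis \<open>tr\<close> starts at one term; the empty sum is covered
      by nonnegativity of \<kappa>.\<close>
    proof (cases "m = 0")
      case False
      have "(\<Sum>l=1..m. D.form (e l) (e l)) =
          (\<integral>z. (\<Sum>l=1..m. case z of (x, y) \<Rightarrow> kD n x y * e l x * e l y) \<partial>(\<mu> \<Otimes>\<^sub>M \<mu>))"
        unfolding D.form_def
        by (intro Bochner_Integration.integral_sum[symmetric] D.form_bdd_integrable[OF D.form_bdd]) (auto intro: e1)
      \<comment> \<open>The truncating indicators pass from the kernel to the test function, so that
        the hypothesis on the untruncated kernel applies.\<close>
      also have "\<dots> = (\<integral>(x, y). (\<Sum>l=1..m. k x y * e l x * e l y) * indicator (D n) x * indicator (D n) y \<partial>(\<mu> \<Otimes>\<^sub>M \<mu>))"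
        by (intro Bochner_Integration.integral_cong refl)
          (auto simp: kD_def sum_distrib_left sum_distrib_right mult_ac)
      also have "\<dots> \<le> \<kappa> * (\<integral>x. (indicator (D n) x)\<^sup>2 \<partial>\<mu>)"
        using False
        by (intro tr)
          (auto simp: sq_int_def power2_eq_square indicator_inter_arith[symmetric] less_top[symmetric]
            intro!: integrable_real_indicator)
      also have "(\<integral>x. (indicator (D n) x :: real)\<^sup>2 \<partial>\<mu>) = measure \<mu> (D n)"
        by (simp add: power2_eq_square indicator_inter_arith[symmetric])
      also have "\<kappa> * measure \<mu> (D n) \<le> \<kappa> * measure \<mu> (space \<mu>)"
        using \<kappa> by (intro mult_left_mono bounded_measure)
      finally show ?thesis .
    qed (use \<kappa> in simp)
    \<comment> \<open>The form is evaluated at |g|, since \<open>form_bdd\<close> asks for absolute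
      convergence.\<close>
    then have "D.form (\<lambda>x. \<bar>g x\<bar>) (\<lambda>x. \<bar>g x\<bar>) \<le> \<kappa> * measure \<mu> (space \<mu>) * (\<integral>x. \<bar>g x\<bar>\<^sup>2 \<partial>\<mu>)"
      by (intro D.form_le_trace[OF e] sq_int_abs g)
    moreover have "(\<integral>\<^sup>+(x, y). ennreal (kD n x y * \<bar>g x\<bar> * \<bar>g y\<bar>) \<partial>(\<mu> \<Otimes>\<^sub>M \<mu>)) = ennreal (D.form (\<lambda>x. \<bar>g x\<bar>) (\<lambda>x. \<bar>g x\<bar>))"
      unfolding D.form_def
      using D.form_bdd_integrable[OF D.form_bdd sq_int_abs[OF g] sq_int_abs[OF g]] D.k_nonneg
      by (subst nn_integral_eq_integral[symmetric]) (auto simp: space_pair_measure case_prod_beta' intro!: AE_I2)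
    ultimately show ?thesis by (auto intro: ennreal_leI)
  qed
  have mono: "kD n x y \<le> kD (Suc n) x y" if "x \<in> space \<mu>" "y \<in> space \<mu>" for n x y
    using k_nonneg[OF that] by (auto simp: kD_def D_def indicator_def)
  have sup: "(SUP n. ennreal (kD n x y * \<bar>g x\<bar> * \<bar>g y\<bar>)) = ennreal (k x y * \<bar>g x\<bar> * \<bar>g y\<bar>)"
    if xy: "x \<in> space \<mu>" "y \<in> space \<mu>" for x y
  proof (rule antisym)
    show "(SUP n. ennreal (kD n x y * \<bar>g x\<bar> * \<bar>g y\<bar>)) \<le> ennreal (k x y * \<bar>g x\<bar> * \<bar>g y\<bar>)"
      using k_nonneg[OF xy] by (intro SUP_least ennreal_leI mult_right_mono) (auto simp: kD_def indicator_def)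
    \<comment> \<open>A pair lies in the truncation square as soon as n reaches both of its diagonal
      values.\<close>
    obtain n where "max (k x x) (k y y) \<le> real n" using real_arch_simple by blast
    then have "kD n x y = k x y" using xy by (simp add: kD_def D_def)
    then show "ennreal (k x y * \<bar>g x\<bar> * \<bar>g y\<bar>) \<le> (SUP n. ennreal (kD n x y * \<bar>g x\<bar> * \<bar>g y\<bar>))"
      by (intro SUP_upper2[of n]) auto
  qed
  have "(\<integral>\<^sup>+(x, y). ennreal (k x y * \<bar>g x\<bar> * \<bar>g y\<bar>) \<partial>(\<mu> \<Otimes>\<^sub>M \<mu>))
     = (\<integral>\<^sup>+z. (SUP n. case z of (x, y) \<Rightarrow> ennreal (kD n x y * \<bar>g x\<bar> * \<bar>g y\<bar>)) \<partial>(\<mu> \<Otimes>\<^sub>M \<mu>))"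
    by (intro nn_integral_cong) (auto simp: space_pair_measure sup)
  also have "\<dots> = (SUP n. \<integral>\<^sup>+(x, y). ennreal (kD n x y * \<bar>g x\<bar> * \<bar>g y\<bar>) \<partial>(\<mu> \<Otimes>\<^sub>M \<mu>))"
  proof (rule nn_integral_monotone_convergence_SUP_AE)
    show "AE z in \<mu> \<Otimes>\<^sub>M \<mu>. (case z of (x, y) \<Rightarrow> ennreal (kD n x y * \<bar>g x\<bar> * \<bar>g y\<bar>)) \<le>
        (case z of (x, y) \<Rightarrow> ennreal (kD (Suc n) x y * \<bar>g x\<bar> * \<bar>g y\<bar>))" for n
      using mono by (intro AE_I2) (auto simp: space_pair_measure intro!: ennreal_leI mult_right_mono)
    show "(\<lambda>(x, y). ennreal (kD n x y * \<bar>g x\<bar> * \<bar>g y\<bar>)) \<in> borel_measurable (\<mu> \<Otimes>\<^sub>M \<mu>)" for n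
      by (simp add: kD_def case_prod_beta')
  qed
  also have "\<dots> \<le> ennreal (\<kappa> * measure \<mu> (space \<mu>) * (\<integral>x. (g x)\<^sup>2 \<partial>\<mu>))"
    by (intro SUP_least le)
  finally show "(\<integral>\<^sup>+(x, y). ennreal (k x y * \<bar>g x\<bar> * \<bar>g y\<bar>) \<partial>(\<mu> \<Otimes>\<^sub>M \<mu>)) \<le>
      ennreal (\<kappa> * measure \<mu> (space \<mu>) * (\<integral>x. (g x)\<^sup>2 \<partial>\<mu>))" .
qed (use \<kappa> in simp)

text \<open>With \<open>form (e i) (e j) = \<alpha>\<^sub>i\<^sub>j\<close> this evaluates the double series of the noise term.\<close>

lemma form_double_series:
  assumes C: "form_bdd C" and e: "orthonormal_basis \<mu> e" and g: "sq_int \<mu> g" and h: "sq_int \<mu> h"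
  shows "(\<lambda>n. \<Sum>i=1..n. \<Sum>j=1..n. form (e i) (e j) * (\<integral>x. g x * e i x \<partial>\<mu>) * (\<integral>x. h x * e j x \<partial>\<mu>)) \<longlonglongrightarrow> form g h"
proof -
  have e1: "sq_int \<mu> (e l)" if "1 \<le> l" for l using e that by (simp add: orthonormal_basis_def)
  have lim: "sq_lim \<mu> (\<lambda>n x. \<Sum>l=1..n. (\<integral>x. f x * e l x \<partial>\<mu>) * e l x) f" if "sq_int \<mu> f" for f
    using e that unfolding orthonormal_basis_def by blast
  from form_tendsto[OF C lim[OF g] lim[OF h]] show ?thesis
    by (subst (asm) form_combination[OF C]) (auto intro: e1 simp: mult_ac)
qed

end

section \<open>Ito integrals\<close>

lemma (in prob_space) centred_gaussian_moments:
  assumes "centred_gaussian M X"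
  shows "sq_int M X" "expectation X = 0"
proof -
  have X[measurable]: "X \<in> borel_measurable M" using assms by (simp add: centred_gaussian_def)
  consider "AE \<omega> in M. X \<omega> = 0" |
    \<sigma> where "0 < \<sigma>" "distributed M lborel X (\<lambda>x. ennreal (normal_density 0 \<sigma> x))"
    using assms by (auto simp: centred_gaussian_def)
  then show "sq_int M X"
  proof cases
    case 1
    then show ?thesis by (intro sq_int_cong_AE[OF sq_int_zero]) auto
  next
    case 2
    have "integrable lborel (\<lambda>x. normal_density 0 \<sigma> x * x\<^sup>2)"
      using integrable_normal_moment[OF 2(1), of 0 2] by simp
    then have "integrable M (\<lambda>\<omega>. (X \<omega>)\<^sup>2)"
      using distributed_integrable[OF 2(2), of "\<lambda>x. x\<^sup>2"] by simp
    then show ?thesis by (simp add: sq_int_def)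
  qed
  consider "AE \<omega> in M. X \<omega> = 0" |
    \<sigma> where "0 < \<sigma>" "distributed M lborel X (\<lambda>x. ennreal (normal_density 0 \<sigma> x))"
    using assms by (auto simp: centred_gaussian_def)
  then show "expectation X = 0"
  proof cases
    case 1
    then show ?thesis by (rule integral_eq_zero_AE)
  next
    case 2
    show ?thesis
      using distributed_integral[OF 2(2), of "\<lambda>x. x"] integral_normal_moment_nz_1[OF 2(1), of 0] by simp
  qed
qed

text \<open>A process is read as one function on time times the sample space: energy becomes a
  squared L^2 norm, the isometry compares two inner products, and Fubini applies. The second factor
  carries the full sigma-algebra of \<open>M\<close>; adaptedness is tracked separately.\<close>

definition time_prod :: "'w measure \<Rightarrow> real \<Rightarrow> (real \<times> 'w) measure" where
  "time_prod M T = restrict_space lborel {0..T} \<Otimes>\<^sub>M M"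

lemma finite_measure_restrict_Icc: "finite_measure (restrict_space lborel {0..T::real})"
  by (intro finite_measureI) (auto simp: emeasure_restrict_space emeasure_lborel_Icc_eq)

section \<open>Brownian increments and their independence of the past\<close>

locale brownian_motions = prob_space M for M :: "'w measure" +
  fixes F :: "real \<Rightarrow> 'w measure" and \<alpha> :: "nat \<Rightarrow> nat \<Rightarrow> real" and B :: "nat \<Rightarrow> real \<Rightarrow> 'w \<Rightarrow> real"
  assumes filtr: "is_filtration M F" and brownian: "brownian_family M F \<alpha> B"
begin

lemma space_F: "space (F t) = space M"
  using filtr by (simp add: is_filtration_def filtration_def)

lemma sets_F_mono: "s \<le> t \<Longrightarrow> sets (F s) \<subseteq> sets (F t)"
  using filtr by (simp add: is_filtration_def filtration_def)

lemma sets_F_subset: "sets (F t) \<subseteq> sets M"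
  using filtr by (simp add: is_filtration_def)

lemma F_measurable: "X \<in> borel_measurable (F s) \<Longrightarrow> X \<in> borel_measurable M"
  by (rule measurable_from_subalg[of M "F s"]) (auto simp: subalgebra_def space_F sets_F_subset)

lemma F_measurable_mono: "X \<in> borel_measurable (F s) \<Longrightarrow> s \<le> t \<Longrightarrow> X \<in> borel_measurable (F t)"
  by (rule measurable_from_subalg[of "F t" "F s"]) (auto simp: subalgebra_def space_F sets_F_mono)

lemma B_adapted: "1 \<le> j \<Longrightarrow> 0 \<le> t \<Longrightarrow> B j t \<in> borel_measurable (F t)"
  using brownian by (simp add: brownian_family_def)

lemma B_moments:
  assumes "1 \<le> j" "0 \<le> t"
  shows "sq_int M (B j t)" "expectation (B j t) = 0"
proof -
  have "\<forall>I c. finite I \<and> I \<subseteq> {1..} \<times> {0..} \<longrightarrow> centred_gaussian M (\<lambda>\<omega>. \<Sum>(j, t)\<in>I. c j t * B j t \<omega>)"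
    using brownian unfolding brownian_family_def by (elim conjE)
  from this[rule_format, of "{(j, t)}" "\<lambda>_ _. 1"]
  have "centred_gaussian M (\<lambda>\<omega>. \<Sum>(j, t)\<in>{(j, t)}. (\<lambda>_ _. 1) j t * B j t \<omega>)"
    using assms by simp
  then have "centred_gaussian M (B j t)" by simp
  from centred_gaussian_moments[OF this] show "sq_int M (B j t)" "expectation (B j t) = 0" .
qed

lemma B_cov:
  "1 \<le> i \<Longrightarrow> 1 \<le> j \<Longrightarrow> 0 \<le> t \<Longrightarrow> 0 \<le> s \<Longrightarrow> expectation (\<lambda>\<omega>. B i t \<omega> * B j s \<omega>) = \<alpha> i j * min t s"
  using brownian unfolding brownian_family_def by blast

lemma \<alpha>_sym: "1 \<le> i \<Longrightarrow> 1 \<le> j \<Longrightarrow> \<alpha> i j = \<alpha> j i"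
  using B_cov[of i j 1 1] B_cov[of j i 1 1] by (simp add: mult.commute)

definition incr :: "nat \<Rightarrow> real \<Rightarrow> real \<Rightarrow> 'w \<Rightarrow> real" where
  "incr j s t \<omega> = B j t \<omega> - B j s \<omega>"

text \<open>Generated by the increments of the whole family, so that a product of increments of two
  different Brownian motions falls under the same independence statement.\<close>

definition incr_algebra :: "real \<Rightarrow> real \<Rightarrow> 'w measure" where
  "incr_algebra s t = vimage_algebra (space M) (\<lambda>\<omega>. \<lambda>j\<in>{1..}. B j t \<omega> - B j s \<omega>) (Pi\<^sub>M {1..} (\<lambda>_. borel))"

lemma incr_sq_int: "1 \<le> j \<Longrightarrow> 0 \<le> s \<Longrightarrow> 0 \<le> t \<Longrightarrow> sq_int M (incr j s t)"
  unfolding incr_def by (intro sq_int_diff B_moments)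

lemma incr_mean: "1 \<le> j \<Longrightarrow> 0 \<le> s \<Longrightarrow> 0 \<le> t \<Longrightarrow> expectation (incr j s t) = 0"
  unfolding incr_def by (simp add: B_moments sq_int_integrable)

lemma incr_cov:
  assumes "1 \<le> i" "1 \<le> j" "0 \<le> s" "s \<le> t"
  shows "expectation (\<lambda>\<omega>. incr i s t \<omega> * incr j s t \<omega>) = \<alpha> i j * (t - s)"
proof -
  have "expectation (\<lambda>\<omega>. incr i s t \<omega> * incr j s t \<omega>) =
     expectation (\<lambda>\<omega>. B i t \<omega> * B j t \<omega> - B i t \<omega> * B j s \<omega> - B i s \<omega> * B j t \<omega> + B i s \<omega> * B j s \<omega>)"
    by (simp add: incr_def algebra_simps)
  also have "\<dots> = \<alpha> i j * t - \<alpha> i j * s - \<alpha> i j * s + \<alpha> i j * s"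
    using assms by (simp add: B_moments sq_int_mult B_cov)
  finally show ?thesis by (simp add: algebra_simps)
qed

lemma incr_measurable: "1 \<le> j \<Longrightarrow> incr j s t \<in> borel_measurable (incr_algebra s t)"
proof -
  assume j: "1 \<le> j"
  have "(\<lambda>\<omega>. \<lambda>j\<in>{1..}. B j t \<omega> - B j s \<omega>) \<in> measurable (incr_algebra s t) (Pi\<^sub>M {1..} (\<lambda>_. borel))"
    unfolding incr_algebra_def by (rule measurable_vimage_algebra1) (auto simp: space_PiM)
  from measurable_compose[OF this measurable_component_singleton[of j]] j
  show ?thesis by (simp add: incr_def[abs_def])
qed

lemma indep_past_incr:
  fixes X Y :: "'w \<Rightarrow> real"
  assumes s: "0 \<le> s" "s \<le> t" and X: "X \<in> borel_measurable (F s)" "integrable M X"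
    and Y: "Y \<in> borel_measurable (incr_algebra s t)" "integrable M Y"
  shows "integrable M (\<lambda>\<omega>. X \<omega> * Y \<omega>)" "expectation (\<lambda>\<omega>. X \<omega> * Y \<omega>) = expectation X * expectation Y"
proof -
  have ind: "indep_set (sets (F s)) (sets (incr_algebra s t))"
    using brownian s unfolding brownian_family_def incr_algebra_def by blast
  have A: "sigma_sets (space M) {X -` A \<inter> space M |A. A \<in> sets borel} \<subseteq> sets (F s)"
    using measurable_sets[OF X(1)] by (subst space_F[of s, symmetric], intro sets.sigma_sets_subset) (auto simp: space_F)
  have sp: "space (incr_algebra s t) = space M" by (simp add: incr_algebra_def)
  have B: "sigma_sets (space M) {Y -` A \<inter> space M |A. A \<in> sets borel} \<subseteq> sets (incr_algebra s t)"
    using measurable_sets[OF Y(1)] by (subst sp[symmetric], intro sets.sigma_sets_subset) (auto simp: sp)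
  have "indep_var borel X borel Y"
    unfolding indep_var_eq
  proof (intro conjI)
    show "X \<in> borel_measurable M" "Y \<in> borel_measurable M" using X(2) Y(2) by auto
    show "indep_set (sigma_sets (space M) {X -` A \<inter> space M |A. A \<in> sets borel})
        (sigma_sets (space M) {Y -` A \<inter> space M |A. A \<in> sets borel})"
      using ind A B unfolding indep_sets2_eq by (meson order_trans subsetD)
  qed
  from indep_var_integrable[OF this X(2) Y(2)] indep_var_lebesgue_integral[OF this X(2) Y(2)]
  show "integrable M (\<lambda>\<omega>. X \<omega> * Y \<omega>)" "expectation (\<lambda>\<omega>. X \<omega> * Y \<omega>) = expectation X * expectation Y" .
qed

lemma past_incr_orthogonal:
  assumes "1 \<le> j" "0 \<le> s" "s \<le> t" "X \<in> borel_measurable (F s)" "sq_int M X"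
  shows "expectation (\<lambda>\<omega>. X \<omega> * incr j s t \<omega>) = 0"
  using assms indep_past_incr(2)[of s t X "incr j s t"]
  by (simp add: incr_measurable incr_sq_int sq_int_integrable incr_mean)

text \<open>The covariation of two correlated Brownian motions, tested against the past: the product
  of increments is itself measurable for \<open>incr_algebra s t\<close>, so its expectation factors
  out.\<close>

lemma past_incr_incr:
  assumes "1 \<le> i" "1 \<le> j" "0 \<le> s" "s \<le> t" "X \<in> borel_measurable (F s)" "integrable M X"
  shows "expectation (\<lambda>\<omega>. X \<omega> * (incr i s t \<omega> * incr j s t \<omega>)) = expectation X * (\<alpha> i j * (t - s))"
  using assms indep_past_incr(2)[of s t X "\<lambda>\<omega>. incr i s t \<omega> * incr j s t \<omega>"]
  by (simp add: borel_measurable_times incr_measurable incr_sq_int sq_int_mult incr_cov)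

section \<open>The isometry for elementary integrands\<close>

definition bdd_at :: "real \<Rightarrow> ('w \<Rightarrow> real) \<Rightarrow> bool" where
  "bdd_at a \<xi> \<longleftrightarrow> \<xi> \<in> borel_measurable (F a) \<and> (\<exists>c. \<forall>\<omega>\<in>space M. \<bar>\<xi> \<omega>\<bar> \<le> c)"

lemma bdd_at_mono: "bdd_at a \<xi> \<Longrightarrow> a \<le> b \<Longrightarrow> bdd_at b \<xi>"
  by (auto simp: bdd_at_def intro: F_measurable_mono)

lemma bdd_at_mult:
  assumes "bdd_at a \<xi>" "bdd_at a \<xi>'"
  shows "bdd_at a (\<lambda>\<omega>. \<xi> \<omega> * \<xi>' \<omega>)"
proof -
  obtain c c' where "\<forall>\<omega>\<in>space M. \<bar>\<xi> \<omega>\<bar> \<le> c" "\<forall>\<omega>\<in>space M. \<bar>\<xi>' \<omega>\<bar> \<le> c'"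
    using assms by (auto simp: bdd_at_def)
  then have "\<forall>\<omega>\<in>space M. \<bar>\<xi> \<omega> * \<xi>' \<omega>\<bar> \<le> c * c'"
    by (auto simp: abs_mult intro!: mult_mono intro: order_trans[OF abs_ge_zero])
  then show ?thesis using assms by (auto simp: bdd_at_def)
qed

lemma bdd_at_sq_int_mult: "bdd_at a \<xi> \<Longrightarrow> sq_int M X \<Longrightarrow> sq_int M (\<lambda>\<omega>. \<xi> \<omega> * X \<omega>)"
  by (auto simp: bdd_at_def intro: sq_int_bounded_mult F_measurable)

lemma bdd_at_sq_int: "bdd_at a \<xi> \<Longrightarrow> sq_int M \<xi>"
  using bdd_at_sq_int_mult[OF _ sq_int_const[of 1]] by simp

lemma incr_F_measurable:
  assumes "1 \<le> j" "0 \<le> s" "s \<le> u" "0 \<le> t" "t \<le> u"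
  shows "incr j s t \<in> borel_measurable (F u)"
  unfolding incr_def using assms by (intro borel_measurable_diff F_measurable_mono[OF B_adapted]) auto

text \<open>Cutting at a' and at the earlier right end m leaves four products. Only the increments
  over the common interval from a' to m contribute; in each other product the last increment
  vanishes or starts at a time when all remaining factors are known.\<close>

lemma elementary_isometry_aux:
  assumes ij: "1 \<le> i" "1 \<le> j" and a: "0 \<le> a" "a \<le> b" "a \<le> a'" "a' \<le> b'"
    and \<xi>: "bdd_at a \<xi>" and \<xi>': "bdd_at a' \<xi>'"
  shows "expectation (\<lambda>\<omega>. (\<xi> \<omega> * incr i a b \<omega>) * (\<xi>' \<omega> * incr j a' b' \<omega>)) =
    \<alpha> i j * (expectation (\<lambda>\<omega>. \<xi> \<omega> * \<xi>' \<omega>) * max 0 (min b b' - a'))"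
proof -
  have \<zeta>: "bdd_at a' (\<lambda>\<omega>. \<xi> \<omega> * \<xi>' \<omega>)" using bdd_at_mult[OF bdd_at_mono[OF \<xi> a(3)] \<xi>'] .
  have \<zeta>m: "(\<lambda>\<omega>. \<xi> \<omega> * \<xi>' \<omega>) \<in> borel_measurable (F u)" if "a' \<le> u" for u
    using bdd_at_mono[OF \<zeta> that] by (simp add: bdd_at_def)
  have sq: "sq_int M (\<lambda>\<omega>. (\<xi> \<omega> * \<xi>' \<omega>) * incr l s t \<omega>)" if "1 \<le> l" "0 \<le> s" "0 \<le> t" for l s t
    using bdd_at_sq_int_mult[OF \<zeta> incr_sq_int[OF that]] .
  have later: "expectation (\<lambda>\<omega>. ((\<xi> \<omega> * \<xi>' \<omega>) * incr l s t \<omega>) * incr m u v \<omega>) = 0"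
    if "1 \<le> l" "1 \<le> m" "0 \<le> s" "s \<le> t" "t \<le> u" "u \<le> v" "a' \<le> u" for l m s t u v
    using that by (intro past_incr_orthogonal sq borel_measurable_times \<zeta>m incr_F_measurable) auto
  have int: "integrable M (\<lambda>\<omega>. ((\<xi> \<omega> * \<xi>' \<omega>) * incr l s t \<omega>) * incr m u v \<omega>)"
    if "1 \<le> l" "1 \<le> m" "0 \<le> s" "0 \<le> t" "0 \<le> u" "0 \<le> v" for l m s t u v
    using that by (intro sq_int_mult sq incr_sq_int)
  have lhs: "(\<lambda>\<omega>. (\<xi> \<omega> * incr i a b \<omega>) * (\<xi>' \<omega> * incr j a' b' \<omega>)) = (\<lambda>\<omega>. ((\<xi> \<omega> * \<xi>' \<omega>) * incr i a b \<omega>) * incr j a' b' \<omega>)"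
    by (simp add: mult_ac)
  show ?thesis
  proof (cases "b \<le> a'")
    case True
    then show ?thesis unfolding lhs using a ij by (subst later) auto
  next
    case False
    define m where "m = min b b'"
    have m: "a' \<le> m" "m \<le> b" "m \<le> b'" "m = b \<or> m = b'" using False a by (auto simp: m_def min_def)
    have split: "((\<xi> \<omega> * \<xi>' \<omega>) * incr i a b \<omega>) * incr j a' b' \<omega> =
        ((\<xi> \<omega> * \<xi>' \<omega>) * incr i a a' \<omega>) * incr j a' b' \<omega>
        + (\<xi> \<omega> * \<xi>' \<omega>) * (incr i a' m \<omega> * incr j a' m \<omega>)
        + ((\<xi> \<omega> * \<xi>' \<omega>) * incr j a' m \<omega>) * incr i m b \<omega>
        + ((\<xi> \<omega> * \<xi>' \<omega>) * incr i a' b \<omega>) * incr j m b' \<omega>" for \<omega>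
      by (simp add: incr_def algebra_simps)
    \<comment> \<open>For m = b the increment from m to b' follows all other factors; for m = b' it
      is zero.\<close>
    have last: "expectation (\<lambda>\<omega>. ((\<xi> \<omega> * \<xi>' \<omega>) * incr i a' b \<omega>) * incr j m b' \<omega>) = 0"
    proof (cases "m = b")
      case True then show ?thesis using m a ij by (intro later) auto
    next
      case False
      then show ?thesis using m(4) by (simp add: incr_def)
    qed
    have mid: "integrable M (\<lambda>\<omega>. (\<xi> \<omega> * \<xi>' \<omega>) * (incr i a' m \<omega> * incr j a' m \<omega>))"
      using int[of i j a' m a' m] m a ij by (simp add: mult.assoc)
    have "expectation (\<lambda>\<omega>. ((\<xi> \<omega> * \<xi>' \<omega>) * incr i a b \<omega>) * incr j a' b' \<omega>) =
        expectation (\<lambda>\<omega>. ((\<xi> \<omega> * \<xi>' \<omega>) * incr i a a' \<omega>) * incr j a' b' \<omega>)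
        + expectation (\<lambda>\<omega>. (\<xi> \<omega> * \<xi>' \<omega>) * (incr i a' m \<omega> * incr j a' m \<omega>))
        + expectation (\<lambda>\<omega>. ((\<xi> \<omega> * \<xi>' \<omega>) * incr j a' m \<omega>) * incr i m b \<omega>)
        + expectation (\<lambda>\<omega>. ((\<xi> \<omega> * \<xi>' \<omega>) * incr i a' b \<omega>) * incr j m b' \<omega>)"
    proof -
      have "integrable M (\<lambda>\<omega>. ((\<xi> \<omega> * \<xi>' \<omega>) * incr i a a' \<omega>) * incr j a' b' \<omega>)"
        "integrable M (\<lambda>\<omega>. ((\<xi> \<omega> * \<xi>' \<omega>) * incr j a' m \<omega>) * incr i m b \<omega>)"
        "integrable M (\<lambda>\<omega>. ((\<xi> \<omega> * \<xi>' \<omega>) * incr i a' b \<omega>) * incr j m b' \<omega>)"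
        using m a ij by (intro int; simp)+
      then show ?thesis unfolding split using mid
        by (simp only: Bochner_Integration.integral_add Bochner_Integration.integrable_add)
    qed
    also have "expectation (\<lambda>\<omega>. ((\<xi> \<omega> * \<xi>' \<omega>) * incr i a a' \<omega>) * incr j a' b' \<omega>) = 0"
      using m a ij by (intro later) auto
    also have "expectation (\<lambda>\<omega>. (\<xi> \<omega> * \<xi>' \<omega>) * (incr i a' m \<omega> * incr j a' m \<omega>)) =
        expectation (\<lambda>\<omega>. \<xi> \<omega> * \<xi>' \<omega>) * (\<alpha> i j * (m - a'))"
      using m a ij by (intro past_incr_incr \<zeta>m sq_int_integrable bdd_at_sq_int[OF \<zeta>]) auto
    also have "expectation (\<lambda>\<omega>. ((\<xi> \<omega> * \<xi>' \<omega>) * incr j a' m \<omega>) * incr i m b \<omega>) = 0"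
      using m a ij by (intro later) auto
    finally show ?thesis unfolding lhs using last m by (simp add: m_def)
  qed
qed

text \<open>Stopping at \<open>T\<close> only shortens the intervals; once \<open>T\<close> is at
  most a', both the second increment and the length of the overlap vanish.\<close>

lemma elementary_isometry_ordered:
  assumes ij: "1 \<le> i" "1 \<le> j" and a: "0 \<le> a" "a \<le> b" "a \<le> a'" "a' \<le> b'" and T: "0 \<le> T"
    and \<xi>: "bdd_at a \<xi>" and \<xi>': "bdd_at a' \<xi>'"
  shows "expectation (\<lambda>\<omega>. (\<xi> \<omega> * incr i (min T a) (min T b) \<omega>) * (\<xi>' \<omega> * incr j (min T a') (min T b') \<omega>)) =
    \<alpha> i j * (expectation (\<lambda>\<omega>. \<xi> \<omega> * \<xi>' \<omega>) * max 0 (min T (min b b') - max a a'))"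
proof (cases "T \<le> a'")
  case True
  then have "min T a' = T" "min T b' = T" "max 0 (min T (min b b') - max a a') = 0" using a by auto
  then show ?thesis by (simp add: incr_def)
next
  case False
  then have eqs: "min T a = a" "min T a' = a'" "max a a' = a'" "min (min T b) (min T b') = min T (min b b')"
    and le: "a \<le> min T b" "a' \<le> min T b'"
    using a by auto
  show ?thesis
    using elementary_isometry_aux[OF ij a(1) le(1) a(3) le(2) \<xi> \<xi>'] by (simp only: eqs)
qed

lemma elementary_isometry:
  assumes ij: "1 \<le> i" "1 \<le> j" and a: "0 \<le> a" "a \<le> b" "0 \<le> a'" "a' \<le> b'" and T: "0 \<le> T"
    and \<xi>: "bdd_at a \<xi>" and \<xi>': "bdd_at a' \<xi>'"
  shows "expectation (\<lambda>\<omega>. (\<xi> \<omega> * incr i (min T a) (min T b) \<omega>) * (\<xi>' \<omega> * incr j (min T a') (min T b') \<omega>)) =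
    \<alpha> i j * (expectation (\<lambda>\<omega>. \<xi> \<omega> * \<xi>' \<omega>) * max 0 (min T (min b b') - max a a'))"
proof (cases "a \<le> a'")
  case True
  then show ?thesis using assms by (intro elementary_isometry_ordered)
next
  case False
  then show ?thesis
    using elementary_isometry_ordered[OF ij(2,1) a(3,4) _ a(2) T \<xi>' \<xi>]
    by (simp add: \<alpha>_sym[OF ij] mult.commute min.commute max.commute)
qed

section \<open>Processes as functions on time times the sample space\<close>

abbreviation "P T \<equiv> time_prod M T"

lemma pair_time: "pair_sigma_finite (restrict_space lborel {0..T::real}) M"
proof -
  interpret R: finite_measure "restrict_space lborel {0..T::real}" by (rule finite_measure_restrict_Icc)
  show ?thesis ..
qed

lemma finite_P: "finite_measure (P T)"
  unfolding time_prod_def by (intro finite_measure_pair_measure finite_measure_restrict_Icc finite_measure_axioms)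

lemma space_P: "space (P T) = {0..T} \<times> space M"
  by (simp add: time_prod_def space_pair_measure space_restrict_space)

lemma fst_P [measurable]: "fst \<in> borel_measurable (P T)"
proof -
  have 1: "fst \<in> measurable (P T) (restrict_space lborel {0..T})" by (simp add: time_prod_def)
  have 2: "(\<lambda>x. x) \<in> borel_measurable (restrict_space lborel {0..T})"
    by (intro measurable_restrict_space1) simp
  show ?thesis using measurable_compose[OF 1 2] by simp
qed

lemma snd_P [measurable]: "snd \<in> measurable (P T) M"
  by (simp add: time_prod_def)

lemma progressive_P: "progressive F H \<Longrightarrow> 0 \<le> T \<Longrightarrow> (\<lambda>z. H (fst z) (snd z)) \<in> borel_measurable (P T)"
proof -
  assume H: "progressive F H" and T: "0 \<le> T"
  have [measurable]: "(\<lambda>x. x) \<in> measurable M (F T)"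
    using sets_F_subset[of T] by (auto simp: measurable_def space_F sets.Int_space_eq2)
  have 1: "fst \<in> measurable (P T) (restrict_space borel {0..T})"
    by (intro measurable_restrict_space2 fst_P) (auto simp: space_P)
  have 2: "snd \<in> measurable (P T) (F T)"
    using measurable_compose[OF snd_P[of T], of "\<lambda>x. x" "F T"] by simp
  have "(\<lambda>z. (fst z, snd z)) \<in> measurable (P T) (restrict_space borel {0..T} \<Otimes>\<^sub>M F T)"
    using 1 2 by (rule measurable_Pair)
  from measurable_compose[OF this] H T show ?thesis
    by (auto simp: progressive_def case_prod_beta')
qed

text \<open>Joint measurability on \<open>{0..t}\<close> is used at its last section, time t
  itself.\<close>

lemma progressive_adapted:
  assumes "progressive F H" "0 \<le> t"
  shows "H t \<in> borel_measurable (F t)"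
proof -
  have "(\<lambda>z. H (fst z) (snd z)) \<in> borel_measurable (restrict_space borel {0..t} \<Otimes>\<^sub>M F t)"
    using assms by (simp add: progressive_def case_prod_beta')
  from measurable_Pair2[OF this, of t] assms show ?thesis by (simp add: space_restrict_space)
qed

lemma energy_P:
  assumes "(\<lambda>z. H (fst z) (snd z)) \<in> borel_measurable (P T)"
  shows "energy M T H = (\<integral>\<^sup>+z. ennreal ((H (fst z) (snd z))\<^sup>2) \<partial>P T)"
proof -
  interpret pair_sigma_finite "restrict_space lborel {0..T}" M by (rule pair_time)
  have "(\<lambda>z. ennreal ((H (fst z) (snd z))\<^sup>2)) \<in> borel_measurable (P T)" using assms by simp
  from nn_integral_snd[OF this[unfolded time_prod_def]] show ?thesis
    by (simp add: energy_def nn_integral_restrict_space time_prod_def)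
qed

lemma energy_sq_int:
  assumes "progressive F H" "energy M T H < \<infinity>" "0 \<le> T"
  shows "sq_int (P T) (\<lambda>z. H (fst z) (snd z))"
  using energy_P[OF progressive_P[OF assms(1,3)]] assms progressive_P[OF assms(1,3)] by (intro sq_int_nn) auto

section \<open>Simple processes and the isometry for their limits\<close>

lemma simple_process_bdd_at:
  assumes "simple_process M F (n, \<tau>, \<xi>)" "i < n"
  shows "bdd_at (\<tau> i) (\<xi> i)" "0 \<le> \<tau> i" "\<tau> i \<le> \<tau> (Suc i)"
proof -
  have "i < n \<Longrightarrow> 0 \<le> \<tau> i" for i
    using assms(1) by (induction i) (auto simp: simple_process_def intro: order_trans)
  then show "bdd_at (\<tau> i) (\<xi> i)" "0 \<le> \<tau> i" "\<tau> i \<le> \<tau> (Suc i)"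
    using assms by (auto simp: simple_process_def bdd_at_def)
qed

lemma simple_integral_incr:
  "simple_integral (n, \<tau>, \<xi>) (B j) T \<omega> = (\<Sum>i<n. \<xi> i \<omega> * incr j (min T (\<tau> i)) (min T (\<tau> (Suc i))) \<omega>)"
  by (simp add: simple_integral_def incr_def)

lemma simple_integral_sq_int:
  assumes S: "simple_process M F S" and "1 \<le> j" "0 \<le> T"
  shows "sq_int M (simple_integral S (B j) T)"
proof (cases S)
  case (fields n \<tau> \<xi>)
  have *: "simple_process M F (n, \<tau>, \<xi>)" using S by (simp add: fields)
  show ?thesis
    unfolding fields simple_integral_incr[abs_def] using assms simple_process_bdd_at[OF *]
    by (intro sq_int_sum bdd_at_sq_int_mult incr_sq_int) (auto intro: order_trans)
qed

lemma simple_value_sq_int: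
  assumes S: "simple_process M F S"
  shows "sq_int (P T) (\<lambda>z. simple_value S (fst z) (snd z))"
proof (cases S)
  case (fields n \<tau> \<xi>)
  have *: "simple_process M F (n, \<tau>, \<xi>)" using S by (simp add: fields)
  interpret P: finite_measure "P T" by (rule finite_P)
  have "sq_int (P T) (\<lambda>z. \<xi> i (snd z) * indicator {\<tau> i<..\<tau> (Suc i)} (fst z))" if "i < n" for i
  proof -
    have b: "bdd_at (\<tau> i) (\<xi> i)" using simple_process_bdd_at[OF * that] by simp
    then have [measurable]: "\<xi> i \<in> borel_measurable M" by (auto simp: bdd_at_def intro: F_measurable)
    obtain c where c: "\<forall>\<omega>\<in>space M. \<bar>\<xi> i \<omega>\<bar> \<le> c" using b by (auto simp: bdd_at_def)
    have 1: "sq_int (P T) (\<lambda>z. \<xi> i (snd z) * 1)"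
      by (intro sq_int_bounded_mult[where c=c] P.sq_int_const) (use c in \<open>auto simp: space_P\<close>)
    have "sq_int (P T) (\<lambda>z. indicator {\<tau> i<..\<tau> (Suc i)} (fst z) * (\<xi> i (snd z) * 1))"
      by (rule sq_int_bounded_mult[OF 1, where c=1]) auto
    then show ?thesis by (simp add: mult.commute)
  qed
  then show ?thesis
    unfolding fields simple_value_def prod.case by (intro sq_int_sum) simp
qed

text \<open>For a fixed path the time integral of two indicators is the length of their overlap
  inside \<open>{0..T}\<close>; this is the integrand side of
  \<open>elementary_isometry\<close>.\<close>

lemma elementary_product_integral:
  assumes a: "0 \<le> a" "0 \<le> a'" and \<xi>: "bdd_at a \<xi>" and \<xi>': "bdd_at a' \<xi>'"
  shows "integrable (P T) (\<lambda>z. (\<xi> (snd z) * indicator {a<..b} (fst z)) * (\<xi>' (snd z) * indicator {a'<..b'} (fst z)))"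
    and "(\<integral>z. (\<xi> (snd z) * indicator {a<..b} (fst z)) * (\<xi>' (snd z) * indicator {a'<..b'} (fst z)) \<partial>P T) =
      expectation (\<lambda>\<omega>. \<xi> \<omega> * \<xi>' \<omega>) * max 0 (min T (min b b') - max a a')"
proof -
  interpret P: finite_measure "P T" by (rule finite_P)
  interpret R: pair_sigma_finite "restrict_space lborel {0..T}" M by (rule pair_time)
  have [measurable]: "\<xi> \<in> borel_measurable M" "\<xi>' \<in> borel_measurable M"
    using \<xi> \<xi>' by (auto simp: bdd_at_def intro: F_measurable)
  obtain c c' where "\<forall>\<omega>\<in>space M. \<bar>\<xi> \<omega>\<bar> \<le> c" "\<forall>\<omega>\<in>space M. \<bar>\<xi>' \<omega>\<bar> \<le> c'"
    using \<xi> \<xi>' by (auto simp: bdd_at_def)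
  then have "\<bar>\<xi> \<omega> * \<xi>' \<omega>\<bar> \<le> c * c'" if "\<omega> \<in> space M" for \<omega>
    using that by (auto simp: abs_mult intro!: mult_mono intro: order_trans[OF abs_ge_zero])
  then have bound: "AE z in P T. norm ((\<xi> (snd z) * indicator {a<..b} (fst z)) * (\<xi>' (snd z) * indicator {a'<..b'} (fst z))) \<le> \<bar>c * c'\<bar>"
    by (intro AE_I2) (auto simp: space_P indicator_def intro: order_trans[OF _ abs_ge_self])
  show int: "integrable (P T) (\<lambda>z. (\<xi> (snd z) * indicator {a<..b} (fst z)) * (\<xi>' (snd z) * indicator {a'<..b'} (fst z)))"
    by (rule P.integrable_const_bound[OF bound]) measurable
  \<comment> \<open>As a and a' are nonnegative, \<open>{0..T}\<close> cuts only the right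
    end.\<close>
  have Ioc: "{a<..b} \<inter> {a'<..b'} \<inter> {0..T} = {max a a'<..min T (min b b')}" using a by auto
  have len: "measure lborel {u<..v} = max 0 (v - u)" for u v :: real by (cases "u \<le> v") auto
  have meas: "measure (restrict_space lborel {0..T}) (({a<..b} \<inter> {a'<..b'}) \<inter> {0..T}) = max 0 (min T (min b b') - max a a')"
  proof (subst measure_restrict_space)
    show "{a<..b} \<inter> {a'<..b'} \<inter> {0..T} \<subseteq> {0..T}" by blast
    show "measure lborel ({a<..b} \<inter> {a'<..b'} \<inter> {0..T}) = max 0 (min T (min b b') - max a a')"
      unfolding Ioc by (rule len)
  qed simp
  have set: "{a<..b} \<inter> {a'<..b'} \<inter> {0..T} \<in> sets (restrict_space lborel {0..T})"
    by (simp add: sets_restrict_space_iff)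
  have inner: "(\<integral>t. (\<xi> \<omega> * indicator {a<..b} t) * (\<xi>' \<omega> * indicator {a'<..b'} t) \<partial>restrict_space lborel {0..T})
      = (\<xi> \<omega> * \<xi>' \<omega>) * max 0 (min T (min b b') - max a a')" for \<omega>
  proof -
    have "(\<integral>t. (\<xi> \<omega> * indicator {a<..b} t) * (\<xi>' \<omega> * indicator {a'<..b'} t) \<partial>restrict_space lborel {0..T})
      = (\<integral>t. (\<xi> \<omega> * \<xi>' \<omega>) * indicator ({a<..b} \<inter> {a'<..b'} \<inter> {0..T}) t \<partial>restrict_space lborel {0..T})"
      by (intro Bochner_Integration.integral_cong refl) (auto simp: space_restrict_space indicator_def)
    also have "\<dots> = (\<xi> \<omega> * \<xi>' \<omega>) * max 0 (min T (min b b') - max a a')"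
      using meas set by (simp add: sets.Int_space_eq2)
    finally show ?thesis .
  qed
  have "(\<integral>z. (\<xi> (snd z) * indicator {a<..b} (fst z)) * (\<xi>' (snd z) * indicator {a'<..b'} (fst z)) \<partial>P T) =
      expectation (\<lambda>\<omega>. \<integral>t. (\<xi> \<omega> * indicator {a<..b} t) * (\<xi>' \<omega> * indicator {a'<..b'} t) \<partial>restrict_space lborel {0..T})"
    using R.integral_snd[of "\<lambda>t \<omega>. (\<xi> \<omega> * indicator {a<..b} t) * (\<xi>' \<omega> * indicator {a'<..b'} t)"] int
    by (simp add: time_prod_def case_prod_beta')
  then show "(\<integral>z. (\<xi> (snd z) * indicator {a<..b} (fst z)) * (\<xi>' (snd z) * indicator {a'<..b'} (fst z)) \<partial>P T) =
      expectation (\<lambda>\<omega>. \<xi> \<omega> * \<xi>' \<omega>) * max 0 (min T (min b b') - max a a')"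
    by (simp add: inner)
qed

lemma simple_isometry:
  assumes S: "simple_process M F S" and S': "simple_process M F S'" and ij: "1 \<le> i" "1 \<le> j" and T: "0 \<le> T"
  shows "expectation (\<lambda>\<omega>. simple_integral S (B i) T \<omega> * simple_integral S' (B j) T \<omega>) =
    \<alpha> i j * (\<integral>z. simple_value S (fst z) (snd z) * simple_value S' (fst z) (snd z) \<partial>P T)"
proof -
  obtain n \<tau> \<xi> where 1: "S = (n, \<tau>, \<xi>)" by (cases S)
  obtain n' \<tau>' \<xi>' where 2: "S' = (n', \<tau>', \<xi>')" by (cases S')
  note b = simple_process_bdd_at[OF S[unfolded 1]] and b' = simple_process_bdd_at[OF S'[unfolded 2]]
  let ?u = "\<lambda>k \<omega>. \<xi> k \<omega> * incr i (min T (\<tau> k)) (min T (\<tau> (Suc k))) \<omega>"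
  let ?v = "\<lambda>l \<omega>. \<xi>' l \<omega> * incr j (min T (\<tau>' l)) (min T (\<tau>' (Suc l))) \<omega>"
  let ?f = "\<lambda>k z. \<xi> k (snd z) * indicator {\<tau> k<..\<tau> (Suc k)} (fst z)"
  let ?g = "\<lambda>l z. \<xi>' l (snd z) * indicator {\<tau>' l<..\<tau>' (Suc l)} (fst z)"
  have u: "sq_int M (?u k)" if "k < n" for k
    using b[OF that] ij T by (intro bdd_at_sq_int_mult incr_sq_int) auto
  have v: "sq_int M (?v l)" if "l < n'" for l
    using b'[OF that] ij T by (intro bdd_at_sq_int_mult incr_sq_int) auto
  have "expectation (\<lambda>\<omega>. simple_integral S (B i) T \<omega> * simple_integral S' (B j) T \<omega>) =
      expectation (\<lambda>\<omega>. \<Sum>k<n. \<Sum>l<n'. ?u k \<omega> * ?v l \<omega>)"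
    by (simp add: 1 2 simple_integral_incr sum_product)
  also have "\<dots> = (\<Sum>k<n. \<Sum>l<n'. expectation (\<lambda>\<omega>. ?u k \<omega> * ?v l \<omega>))"
    by (subst Bochner_Integration.integral_sum, (auto intro!: Bochner_Integration.integrable_sum sq_int_mult[OF u v])[1])
      (intro sum.cong refl Bochner_Integration.integral_sum sq_int_mult[OF u v]; simp)
  also have "\<dots> = (\<Sum>k<n. \<Sum>l<n'. \<alpha> i j * (\<integral>z. ?f k z * ?g l z \<partial>P T))"
  proof (intro sum.cong refl)
    fix k l assume "k \<in> {..<n}" "l \<in> {..<n'}"
    then show "expectation (\<lambda>\<omega>. ?u k \<omega> * ?v l \<omega>) = \<alpha> i j * (\<integral>z. ?f k z * ?g l z \<partial>P T)"
      using b[of k] b'[of l] ij T by (subst elementary_isometry) (auto simp: elementary_product_integral(2))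
  qed
  also have "\<dots> = \<alpha> i j * (\<Sum>k<n. \<Sum>l<n'. \<integral>z. ?f k z * ?g l z \<partial>P T)"
    by (simp add: sum_distrib_left)
  also have "(\<Sum>k<n. \<Sum>l<n'. \<integral>z. ?f k z * ?g l z \<partial>P T) = (\<integral>z. (\<Sum>k<n. \<Sum>l<n'. ?f k z * ?g l z) \<partial>P T)"
    using b b' by (subst Bochner_Integration.integral_sum, (auto intro!: Bochner_Integration.integrable_sum elementary_product_integral(1))[1])
      (intro sum.cong refl Bochner_Integration.integral_sum[symmetric] elementary_product_integral(1); simp)
  also have "\<dots> = (\<integral>z. simple_value S (fst z) (snd z) * simple_value S' (fst z) (snd z) \<partial>P T)"
    by (simp only: 1 2 simple_value_def sum_product prod.case)
  finally show ?thesis .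
qed

text \<open>Energy over a shorter horizon is smaller, so one approximating sequence serves all times
  up to \<open>T\<close>; the martingale property needs it at two times at once.\<close>

lemma has_ito_integral_approx:
  assumes I: "has_ito_integral M F (B j) T H I" and j: "1 \<le> j" and T: "0 \<le> T"
  shows "\<exists>S. (\<forall>m. simple_process M F (S m)) \<and>
    (\<forall>t. 0 \<le> t \<longrightarrow> t \<le> T \<longrightarrow>
      sq_lim (P t) (\<lambda>m z. simple_value (S m) (fst z) (snd z)) (\<lambda>z. H (fst z) (snd z))) \<and>
    sq_lim M (\<lambda>m. simple_integral (S m) (B j) T) I"
proof -
  obtain S where S: "\<And>m. simple_process M F (S m)"
    and lim: "(\<lambda>m. energy M T (\<lambda>t \<omega>. simple_value (S m) t \<omega> - H t \<omega>)) \<longlonglongrightarrow> 0"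
    and ms: "ms_tendsto M (\<lambda>m. simple_integral (S m) (B j) T) I" and H: "progressive F H"
    using I by (auto simp: has_ito_integral_def)
  show ?thesis
  proof (intro exI[of _ S] conjI allI impI)
    show "simple_process M F (S m)" for m by (rule S)
    show "sq_lim M (\<lambda>m. simple_integral (S m) (B j) T) I"
      using ms by (intro ms_tendsto_sq_lim simple_integral_sq_int S j T)
    fix t assume t: "0 \<le> t" "t \<le> T"
    have meas: "(\<lambda>z. simple_value (S m) (fst z) (snd z) - H (fst z) (snd z)) \<in> borel_measurable (P t)" for m
      by (intro borel_measurable_diff sq_int_measurable[OF simple_value_sq_int[OF S]] progressive_P H t)
    show "sq_lim (P t) (\<lambda>m z. simple_value (S m) (fst z) (snd z)) (\<lambda>z. H (fst z) (snd z))"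
    proof (rule sq_lim_nn)
      show "sq_int (P t) (\<lambda>z. simple_value (S m) (fst z) (snd z))" for m by (rule simple_value_sq_int[OF S])
      show "(\<lambda>z. H (fst z) (snd z)) \<in> borel_measurable (P t)" by (intro progressive_P H t)
      have "energy M t (\<lambda>t \<omega>. simple_value (S m) t \<omega> - H t \<omega>) \<le> energy M T (\<lambda>t \<omega>. simple_value (S m) t \<omega> - H t \<omega>)" for m
        unfolding energy_def using t by (intro nn_integral_mono mult_left_mono) (auto simp: indicator_def)
      then have "(\<lambda>m. energy M t (\<lambda>t \<omega>. simple_value (S m) t \<omega> - H t \<omega>)) \<longlonglongrightarrow> 0"
        by (intro tendsto_sandwich[OF _ _ tendsto_const lim]) auto
      then show "(\<lambda>m. \<integral>\<^sup>+z. ennreal ((simple_value (S m) (fst z) (snd z) - H (fst z) (snd z))\<^sup>2) \<partial>P t) \<longlonglongrightarrow> 0"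
        by (simp add: energy_P[OF meas])
    qed
  qed
qed

lemma ito_sq_int: "has_ito_integral M F (B j) T H I \<Longrightarrow> 1 \<le> j \<Longrightarrow> 0 \<le> T \<Longrightarrow> sq_int M I"
  by (drule (2) has_ito_integral_approx) (auto simp: sq_lim_def)

lemma ito_isometry:
  assumes I: "has_ito_integral M F (B i) T H I" and I': "has_ito_integral M F (B j) T H' I'"
    and ij: "1 \<le> i" "1 \<le> j" and T: "0 \<le> T"
  shows "expectation (\<lambda>\<omega>. I \<omega> * I' \<omega>) = \<alpha> i j * (\<integral>z. H (fst z) (snd z) * H' (fst z) (snd z) \<partial>P T)"
proof -
  obtain S where S: "\<forall>m. simple_process M F (S m)"
    "\<forall>t. 0 \<le> t \<longrightarrow> t \<le> T \<longrightarrow> sq_lim (P t) (\<lambda>m z. simple_value (S m) (fst z) (snd z)) (\<lambda>z. H (fst z) (snd z))"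
    "sq_lim M (\<lambda>m. simple_integral (S m) (B i) T) I"
    using has_ito_integral_approx[OF I ij(1) T] by blast
  note S = S[rule_format]
  obtain S' where S': "\<forall>m. simple_process M F (S' m)"
    "\<forall>t. 0 \<le> t \<longrightarrow> t \<le> T \<longrightarrow> sq_lim (P t) (\<lambda>m z. simple_value (S' m) (fst z) (snd z)) (\<lambda>z. H' (fst z) (snd z))"
    "sq_lim M (\<lambda>m. simple_integral (S' m) (B j) T) I'"
    using has_ito_integral_approx[OF I' ij(2) T] by blast
  note S' = S'[rule_format]
  have "(\<lambda>m. expectation (\<lambda>\<omega>. simple_integral (S m) (B i) T \<omega> * simple_integral (S' m) (B j) T \<omega>))
      \<longlonglongrightarrow> expectation (\<lambda>\<omega>. I \<omega> * I' \<omega>)"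
    by (rule sq_lim_integral_mult[OF S(3) S'(3)])
  moreover have "(\<lambda>m. expectation (\<lambda>\<omega>. simple_integral (S m) (B i) T \<omega> * simple_integral (S' m) (B j) T \<omega>))
      \<longlonglongrightarrow> \<alpha> i j * (\<integral>z. H (fst z) (snd z) * H' (fst z) (snd z) \<partial>P T)"
    unfolding simple_isometry[OF S(1) S'(1) ij T]
    by (intro tendsto_mult_left sq_lim_integral_mult[OF S(2) S'(2)] T order_refl)
  ultimately show ?thesis by (rule LIMSEQ_unique)
qed

text \<open>Stopping at t instead of r changes each summand by \<open>\<xi> k\<close> times an
  increment over the part of its interval between r and t. Both \<open>X\<close> and
  \<open>\<xi> k\<close> are known when this increment starts, so it is orthogonal to their
  product.\<close>

lemma simple_martingale:
  assumes S: "simple_process M F S" and j: "1 \<le> j" and r: "0 \<le> r" "r \<le> t"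
    and X: "X \<in> borel_measurable (F r)" "sq_int M X"
  shows "expectation (\<lambda>\<omega>. X \<omega> * simple_integral S (B j) t \<omega>) = expectation (\<lambda>\<omega>. X \<omega> * simple_integral S (B j) r \<omega>)"
proof -
  obtain n \<tau> \<xi> where 1: "S = (n, \<tau>, \<xi>)" by (cases S)
  note b = simple_process_bdd_at[OF S[unfolded 1]]
  let ?u = "\<lambda>t k \<omega>. \<xi> k \<omega> * incr j (min t (\<tau> k)) (min t (\<tau> (Suc k))) \<omega>"
  have u: "sq_int M (?u t k)" if "k < n" "0 \<le> t" for k t
    using b[OF that(1)] j that(2) by (intro bdd_at_sq_int_mult incr_sq_int) auto
  have exp: "expectation (\<lambda>\<omega>. X \<omega> * simple_integral S (B j) t \<omega>) = (\<Sum>k<n. expectation (\<lambda>\<omega>. X \<omega> * ?u t k \<omega>))" if "0 \<le> t" for t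
  proof -
    have "expectation (\<lambda>\<omega>. X \<omega> * simple_integral S (B j) t \<omega>) = expectation (\<lambda>\<omega>. \<Sum>k<n. X \<omega> * ?u t k \<omega>)"
      by (simp add: 1 simple_integral_incr sum_distrib_left)
    also have "\<dots> = (\<Sum>k<n. expectation (\<lambda>\<omega>. X \<omega> * ?u t k \<omega>))"
      using that by (intro Bochner_Integration.integral_sum sq_int_mult[OF X(2) u]) auto
    finally show ?thesis .
  qed
  have "expectation (\<lambda>\<omega>. X \<omega> * ?u t k \<omega>) = expectation (\<lambda>\<omega>. X \<omega> * ?u r k \<omega>)" if k: "k < n" for k
  proof -
    \<comment> \<open>From v to w runs the k-th interval with everything before r removed.\<close>
    define v where "v = max r (\<tau> k)"
    define w where "w = max r (\<tau> (Suc k))"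
    have v: "0 \<le> v" "r \<le> v" "\<tau> k \<le> v" and vw: "v \<le> w" using r b[OF k] by (auto simp: v_def w_def)
    have "expectation (\<lambda>\<omega>. X \<omega> * ?u t k \<omega> - X \<omega> * ?u r k \<omega>) = 0"
    \<comment> \<open>If t <= v, then t = r or the interval starts no earlier than t; in both cases
      the two summands agree.\<close>
    proof (cases "t \<le> v")
      case True
      have *: "X \<omega> * ?u t k \<omega> - X \<omega> * ?u r k \<omega> = 0" for \<omega>
        using True r b[OF k] by (auto simp: v_def incr_def min_def max_def split: if_splits)
      show ?thesis by (simp only: *) simp
    next
      case False
      have *: "X \<omega> * ?u t k \<omega> - X \<omega> * ?u r k \<omega> = (\<xi> k \<omega> * X \<omega>) * incr j v (min t w) \<omega>" for \<omega>
        using False r b[OF k] by (auto simp: v_def w_def incr_def min_def max_def algebra_simps split: if_splits)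
      have "expectation (\<lambda>\<omega>. (\<xi> k \<omega> * X \<omega>) * incr j v (min t w) \<omega>) = 0"
      proof (rule past_incr_orthogonal[OF j v(1)])
        show "v \<le> min t w" using False vw by simp
        show "(\<lambda>\<omega>. \<xi> k \<omega> * X \<omega>) \<in> borel_measurable (F v)"
          using b(1)[OF k] X(1) v by (intro borel_measurable_times) (auto simp: bdd_at_def intro: F_measurable_mono)
        show "sq_int M (\<lambda>\<omega>. \<xi> k \<omega> * X \<omega>)" by (rule bdd_at_sq_int_mult[OF b(1)[OF k] X(2)])
      qed
      then show ?thesis by (simp only: *)
    qed
    then show ?thesis
      using r k by (subst (asm) Bochner_Integration.integral_diff) (auto intro!: sq_int_mult[OF X(2)] u)
  qed
  then show ?thesis using r by (simp add: exp)
qed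

lemma ito_mean:
  assumes I: "has_ito_integral M F (B j) T H I" and j: "1 \<le> j" and T: "0 \<le> T"
  shows "expectation I = 0"
proof -
  obtain S where S: "\<forall>m. simple_process M F (S m)"
    "sq_lim M (\<lambda>m. simple_integral (S m) (B j) T) I"
    using has_ito_integral_approx[OF I j T] by blast
  note S = S[rule_format]
  have "expectation (\<lambda>\<omega>. 1 * simple_integral (S m) (B j) T \<omega>) = 0" for m
  proof -
    \<comment> \<open>A simple process starts at a nonnegative time, so its integral up to time 0
      vanishes; the martingale property with X = 1 carries this to time T.\<close>
    have "simple_integral (S m) (B j) 0 \<omega> = 0" for \<omega>
    proof (cases "S m")
      case (fields n \<tau> \<xi>)
      note b = simple_process_bdd_at[OF S(1)[of m, unfolded fields]]
      have "min 0 (\<tau> i) = 0" "min 0 (\<tau> (Suc i)) = 0" if "i < n" for i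
        using b(2)[OF that] b(3)[OF that] by auto
      then show ?thesis by (simp add: fields simple_integral_def)
    qed
    then show ?thesis
      using simple_martingale[OF S(1) j _ T, of "\<lambda>_. 1" m] by (simp add: sq_int_const)
  qed
  moreover have "(\<lambda>m. expectation (\<lambda>\<omega>. 1 * simple_integral (S m) (B j) T \<omega>)) \<longlonglongrightarrow> expectation (\<lambda>\<omega>. 1 * I \<omega>)"
    by (rule sq_lim_integral_mult[OF sq_lim_const[OF sq_int_const] S(2)])
  ultimately show ?thesis using LIMSEQ_unique[OF tendsto_const] by fastforce
qed

text \<open>\<open>I\<close> and \<open>J\<close> come with unrelated approximating sequences. The
  sequence for \<open>I\<close>, stopped at r, also converges to \<open>J\<close>: by the isometry
  its squared distance from the sequence for \<open>J\<close> tends to \<open>\<alpha> j j\<close>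
  times h - 2 h + h. The martingale property of simple integrals then passes to the limit.\<close>

lemma ito_martingale:
  assumes I: "has_ito_integral M F (B j) t H I" and J: "has_ito_integral M F (B j) r H J"
    and j: "1 \<le> j" and r: "0 \<le> r" "r \<le> t"
    and X: "X \<in> borel_measurable (F r)" "sq_int M X"
  shows "expectation (\<lambda>\<omega>. X \<omega> * I \<omega>) = expectation (\<lambda>\<omega>. X \<omega> * J \<omega>)"
proof -
  have t: "0 \<le> t" using r by simp
  obtain S where S: "\<forall>m. simple_process M F (S m)"
    "\<forall>u. 0 \<le> u \<longrightarrow> u \<le> t \<longrightarrow> sq_lim (P u) (\<lambda>m z. simple_value (S m) (fst z) (snd z)) (\<lambda>z. H (fst z) (snd z))"
    "sq_lim M (\<lambda>m. simple_integral (S m) (B j) t) I"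
    using has_ito_integral_approx[OF I j t] by blast
  note S = S[rule_format]
  obtain S' where S': "\<forall>m. simple_process M F (S' m)"
    "\<forall>u. 0 \<le> u \<longrightarrow> u \<le> r \<longrightarrow> sq_lim (P u) (\<lambda>m z. simple_value (S' m) (fst z) (snd z)) (\<lambda>z. H (fst z) (snd z))"
    "sq_lim M (\<lambda>m. simple_integral (S' m) (B j) r) J"
    using has_ito_integral_approx[OF J j r(1)] by blast
  note S' = S'[rule_format]
  let ?K = "\<lambda>m. simple_integral (S m) (B j) r" and ?K' = "\<lambda>m. simple_integral (S' m) (B j) r"
  let ?h = "\<integral>z. H (fst z) (snd z) * H (fst z) (snd z) \<partial>P r"
  have K: "sq_int M (?K m)" "sq_int M (?K' m)" for m
    by (intro simple_integral_sq_int S(1) S'(1) j r)+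
  have "(\<lambda>m. \<alpha> j j * (\<integral>z. simple_value (S m) (fst z) (snd z) * simple_value (S m) (fst z) (snd z) \<partial>P r)
      - 2 * (\<alpha> j j * (\<integral>z. simple_value (S m) (fst z) (snd z) * simple_value (S' m) (fst z) (snd z) \<partial>P r))
      + \<alpha> j j * (\<integral>z. simple_value (S' m) (fst z) (snd z) * simple_value (S' m) (fst z) (snd z) \<partial>P r))
     \<longlonglongrightarrow> \<alpha> j j * ?h - 2 * (\<alpha> j j * ?h) + \<alpha> j j * ?h"
    by (intro tendsto_intros sq_lim_integral_mult S(2) S'(2) r order_refl)
  moreover have "expectation (\<lambda>\<omega>. (?K m \<omega> - ?K' m \<omega> - 0)\<^sup>2) =
      \<alpha> j j * (\<integral>z. simple_value (S m) (fst z) (snd z) * simple_value (S m) (fst z) (snd z) \<partial>P r)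
      - 2 * (\<alpha> j j * (\<integral>z. simple_value (S m) (fst z) (snd z) * simple_value (S' m) (fst z) (snd z) \<partial>P r))
      + \<alpha> j j * (\<integral>z. simple_value (S' m) (fst z) (snd z) * simple_value (S' m) (fst z) (snd z) \<partial>P r)" for m
  proof -
    have "expectation (\<lambda>\<omega>. (?K m \<omega> - ?K' m \<omega> - 0)\<^sup>2) =
        expectation (\<lambda>\<omega>. ?K m \<omega> * ?K m \<omega> - 2 * (?K m \<omega> * ?K' m \<omega>) + ?K' m \<omega> * ?K' m \<omega>)"
      by (simp add: power2_diff power2_eq_square algebra_simps)
    also have "\<dots> = expectation (\<lambda>\<omega>. ?K m \<omega> * ?K m \<omega>) - 2 * expectation (\<lambda>\<omega>. ?K m \<omega> * ?K' m \<omega>)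
        + expectation (\<lambda>\<omega>. ?K' m \<omega> * ?K' m \<omega>)"
      using sq_int_mult[OF K(1)[of m] K(1)[of m]] sq_int_mult[OF K(1)[of m] K(2)[of m]] sq_int_mult[OF K(2)[of m] K(2)[of m]]
      by simp
    finally show ?thesis
      by (simp only: simple_isometry[OF S(1) S(1) j j r(1)] simple_isometry[OF S(1) S'(1) j j r(1)]
          simple_isometry[OF S'(1) S'(1) j j r(1)])
  qed
  ultimately have "sq_lim M (\<lambda>m \<omega>. ?K m \<omega> - ?K' m \<omega>) (\<lambda>\<omega>. 0)"
    by (simp add: sq_lim_def sq_int_zero sq_int_diff K)
  from sq_lim_add[OF this S'(3)] have lim: "sq_lim M ?K J" by simp
  have "(\<lambda>m. expectation (\<lambda>\<omega>. X \<omega> * ?K m \<omega>)) \<longlonglongrightarrow> expectation (\<lambda>\<omega>. X \<omega> * J \<omega>)"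
    by (rule sq_lim_integral_mult[OF sq_lim_const[OF X(2)] lim])
  moreover have "(\<lambda>m. expectation (\<lambda>\<omega>. X \<omega> * ?K m \<omega>)) \<longlonglongrightarrow> expectation (\<lambda>\<omega>. X \<omega> * I \<omega>)"
    unfolding simple_martingale[OF S(1) j r X, symmetric]
    by (rule sq_lim_integral_mult[OF sq_lim_const[OF X(2)] S(3)])
  ultimately show ?thesis by (rule LIMSEQ_unique[symmetric])
qed

end

section \<open>Second moments of linear Ito systems\<close>

text \<open>Continuity of \<open>f\<close> makes its primitive \<Phi> differentiable, and
  \<open>f r * \<Phi> r\<close> is the derivative of half the square of \<Phi>.\<close>

lemma integral_times_primitive:
  fixes f :: "real \<Rightarrow> real"
  assumes t: "0 \<le> t" and f: "continuous_on {0..t} f"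
  shows "(LINT r:{0..t}|lborel. f r * (LINT s:{0..r}|lborel. f s)) = (LINT s:{0..t}|lborel. f s)\<^sup>2 / 2"
proof -
  define \<Phi> where "\<Phi> r = integral {0..r} f" for r
  have \<Phi>: "(LINT s:{0..r}|lborel. f s) = \<Phi> r" if "r \<in> {0..t}" for r
    unfolding \<Phi>_def using that
    by (intro set_borel_integral_eq_integral borel_integrable_atLeastAtMost' continuous_on_subset[OF f]) auto
  have deriv: "(\<Phi> has_real_derivative f r) (at r within {0..t})" if "r \<in> {0..t}" for r
    unfolding \<Phi>_def by (rule integral_has_real_derivative[OF f that])
  have "continuous_on {0..t} \<Phi>"
    using deriv by (intro DERIV_continuous_on) auto
  then have cont: "continuous_on {0..t} (\<lambda>r. f r * \<Phi> r)" by (intro continuous_intros f)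
  have "((\<lambda>r. f r * \<Phi> r) has_integral (\<Phi> t)\<^sup>2 / 2 - (\<Phi> 0)\<^sup>2 / 2) {0..t}"
  proof (rule fundamental_theorem_of_calculus[OF t])
    fix r assume "r \<in> {0..t}"
    from deriv[OF this] have "((\<lambda>r. (\<Phi> r)\<^sup>2 / 2) has_real_derivative f r * \<Phi> r) (at r within {0..t})"
      by (auto intro!: derivative_eq_intros)
    then show "((\<lambda>r. (\<Phi> r)\<^sup>2 / 2) has_vector_derivative f r * \<Phi> r) (at r within {0..t})"
      by (simp add: has_real_derivative_iff_has_vector_derivative)
  qed
  then have "integral {0..t} (\<lambda>r. f r * \<Phi> r) = (\<Phi> t)\<^sup>2 / 2"
    by (auto simp: \<Phi>_def dest: integral_unique)
  moreover have "(LINT r:{0..t}|lborel. f r * \<Phi> r) = integral {0..t} (\<lambda>r. f r * \<Phi> r)"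
    by (intro set_borel_integral_eq_integral borel_integrable_atLeastAtMost' cont)
  moreover have "(LINT r:{0..t}|lborel. f r * (LINT s:{0..r}|lborel. f s)) = (LINT r:{0..t}|lborel. f r * \<Phi> r)"
    by (intro set_lebesgue_integral_cong) (auto simp: \<Phi>)
  ultimately show ?thesis using \<Phi>[of t] t by simp
qed

section \<open>Time integrals of square integrable processes\<close>

context brownian_motions
begin

abbreviation "R T \<equiv> restrict_space lborel {0..T::real}"

lemma set_integral_R: "(LINT s:{0..T}|lborel. f s) = (\<integral>s. f s \<partial>R T)" for f :: "real \<Rightarrow> real"
  by (simp add: integral_restrict_space set_lebesgue_integral_def)

lemma Fubini_P:
  fixes f :: "real \<times> 'w \<Rightarrow> real"
  assumes "integrable (P T) f"
  shows "integrable (R T) (\<lambda>s. expectation (\<lambda>\<omega>. f (s, \<omega>)))" "(\<integral>s. expectation (\<lambda>\<omega>. f (s, \<omega>)) \<partial>R T) = integral\<^sup>L (P T) f"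
    "integrable M (\<lambda>\<omega>. \<integral>s. f (s, \<omega>) \<partial>R T)" "expectation (\<lambda>\<omega>. \<integral>s. f (s, \<omega>) \<partial>R T) = integral\<^sup>L (P T) f"
    "AE \<omega> in M. integrable (R T) (\<lambda>s. f (s, \<omega>))"
proof -
  interpret pair_sigma_finite "R T" M by (rule pair_time)
  have f: "integrable (R T \<Otimes>\<^sub>M M) (case_prod (\<lambda>s \<omega>. f (s, \<omega>)))" using assms by (simp add: time_prod_def)
  show "integrable (R T) (\<lambda>s. expectation (\<lambda>\<omega>. f (s, \<omega>)))" "(\<integral>s. expectation (\<lambda>\<omega>. f (s, \<omega>)) \<partial>R T) = integral\<^sup>L (P T) f"
    "integrable M (\<lambda>\<omega>. \<integral>s. f (s, \<omega>) \<partial>R T)" "expectation (\<lambda>\<omega>. \<integral>s. f (s, \<omega>) \<partial>R T) = integral\<^sup>L (P T) f"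
    "AE \<omega> in M. integrable (R T) (\<lambda>s. f (s, \<omega>))"
    using integrable_fst[OF f] integral_fst[OF f] integrable_snd[OF f] integral_snd[OF f] AE_integrable_snd[OF f]
    by (simp_all add: time_prod_def)
qed

lemma P_section_measurable:
  assumes "f \<in> borel_measurable (P T)" "\<omega> \<in> space M"
  shows "(\<lambda>s. f (s, \<omega>)) \<in> borel_measurable (R T)"
  using measurable_Pair1[of f "R T" M borel \<omega>] assms by (simp add: time_prod_def)

lemma sq_int_snd_P:
  assumes "sq_int M f"
  shows "sq_int (P T) (\<lambda>z. f (snd z))"
proof -
  interpret R: finite_measure "R T" by (rule finite_measure_restrict_Icc)
  have [measurable]: "f \<in> borel_measurable M" using assms by (rule sq_int_measurable)
  have m: "(\<lambda>z. f (snd z)) \<in> borel_measurable (P T)" by measurable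
  have "(\<integral>\<^sup>+z. ennreal ((f (snd z))\<^sup>2) \<partial>P T) = (\<integral>\<^sup>+s. (\<integral>\<^sup>+\<omega>. ennreal ((f \<omega>)\<^sup>2) \<partial>M) \<partial>R T)"
    unfolding time_prod_def by (subst nn_integral_fst[symmetric]) auto
  also have "\<dots> < \<infinity>"
    using sq_int_square[OF assms] R.emeasure_finite[of "{0..T}"]
    by (simp add: nn_integral_eq_integral ennreal_mult_eq_top_iff less_top[symmetric])
  finally show ?thesis using m by (intro sq_int_nn)
qed

text \<open>Cauchy-Schwarz in time against the constant 1, path by path.\<close>

lemma sq_int_time_integral:
  assumes "sq_int (P T) f"
  shows "sq_int M (\<lambda>\<omega>. \<integral>s. f (s, \<omega>) \<partial>R T)"
proof -
  interpret P: finite_measure "P T" by (rule finite_P)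
  interpret R: finite_measure "R T" by (rule finite_measure_restrict_Icc)
  have m: "(\<lambda>\<omega>. \<integral>s. f (s, \<omega>) \<partial>R T) \<in> borel_measurable M"
    using Fubini_P(3)[OF P.sq_int_integrable[OF assms]] by auto
  have "integrable M (\<lambda>\<omega>. (\<integral>s. f (s, \<omega>) \<partial>R T)\<^sup>2)"
  proof (rule Bochner_Integration.integrable_bound)
    show "integrable M (\<lambda>\<omega>. (\<integral>s. (f (s, \<omega>))\<^sup>2 \<partial>R T) * measure (R T) (space (R T)))"
      using Fubini_P(3)[OF sq_int_square[OF assms]] by simp
    show "(\<lambda>\<omega>. (\<integral>s. f (s, \<omega>) \<partial>R T)\<^sup>2) \<in> borel_measurable M" using m by simp
    show "AE \<omega> in M. norm ((\<integral>s. f (s, \<omega>) \<partial>R T)\<^sup>2) \<le> norm ((\<integral>s. (f (s, \<omega>))\<^sup>2 \<partial>R T) * measure (R T) (space (R T)))"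
      using Fubini_P(5)[OF sq_int_square[OF assms]] AE_space
    proof eventually_elim
      fix \<omega> assume "integrable (R T) (\<lambda>s. (f (s, \<omega>))\<^sup>2)" "\<omega> \<in> space M"
      then have "sq_int (R T) (\<lambda>s. f (s, \<omega>))"
        using P_section_measurable[OF sq_int_measurable[OF assms]] by (simp add: sq_int_def)
      from sq_int_Cauchy_Schwarz[OF this R.sq_int_const[of 1]]
      have "(\<integral>s. f (s, \<omega>) \<partial>R T)\<^sup>2 \<le> (\<integral>s. (f (s, \<omega>))\<^sup>2 \<partial>R T) * measure (R T) (space (R T))" by simp
      also have "\<dots> = norm ((\<integral>s. (f (s, \<omega>))\<^sup>2 \<partial>R T) * measure (R T) (space (R T)))" by simp
      finally show "norm ((\<integral>s. f (s, \<omega>) \<partial>R T)\<^sup>2) \<le> norm ((\<integral>s. (f (s, \<omega>))\<^sup>2 \<partial>R T) * measure (R T) (space (R T)))"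
        by simp
    qed
  qed
  then show ?thesis using m by (simp add: sq_int_def)
qed

text \<open>An indicator over a fixed interval replaces the variable upper limit, which gives access
  to joint measurability of the primitive in time and path.\<close>

lemma primitive_R:
  fixes f :: "real \<Rightarrow> real"
  assumes "r \<in> {0..T}"
  shows "(\<integral>s. indicator {..r} s * f s \<partial>R T) = (\<integral>s. f s \<partial>R r)"
proof -
  have "(\<integral>s. indicator {..r} s * f s \<partial>R T) = (\<integral>s. indicator {0..T} s *\<^sub>R (indicator {..r} s * f s) \<partial>lborel)"
    by (simp add: integral_restrict_space)
  also have "\<dots> = (\<integral>s. indicator {0..r} s *\<^sub>R f s \<partial>lborel)"
    using assms by (intro Bochner_Integration.integral_cong refl) (auto simp: indicator_def)
  finally show ?thesis by (simp add: integral_restrict_space)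
qed

text \<open>The primitive is dominated by the integral of |f| over the full time interval, which no
  longer depends on the upper limit.\<close>

lemma primitive_sq_int:
  assumes f: "sq_int (P T) f"
  shows "sq_int (P T) (\<lambda>z. \<integral>s. indicator {..fst z} s * f (s, snd z) \<partial>R T)"
proof -
  interpret R: finite_measure "R T" by (rule finite_measure_restrict_Icc)
  interpret P: finite_measure "P T" by (rule finite_P)
  have [measurable]: "f \<in> borel_measurable (R T \<Otimes>\<^sub>M M)" using sq_int_measurable[OF f] by (simp add: time_prod_def)
  have [measurable]: "snd \<in> measurable (P T) M" by (rule snd_P)
  have [measurable]: "(\<lambda>s. s) \<in> borel_measurable (R T)" by (intro measurable_restrict_space1) simp
  have "Measurable.pred (P T \<Otimes>\<^sub>M R T) (\<lambda>p. snd p \<le> fst (fst p))" by measurable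
  then have ind: "(\<lambda>p. indicator {..fst (fst p)} (snd p) :: real) \<in> borel_measurable (P T \<Otimes>\<^sub>M R T)"
    by (simp add: indicator_def of_bool_def)
  have sw: "(\<lambda>p. (snd p, snd (fst p))) \<in> measurable (P T \<Otimes>\<^sub>M R T) (R T \<Otimes>\<^sub>M M)" by measurable
  have "(\<lambda>p. f (snd p, snd (fst p))) \<in> borel_measurable (P T \<Otimes>\<^sub>M R T)"
    by (rule measurable_compose[OF sw]) measurable
  then have "(\<lambda>(z, s). indicator {..fst z} s * f (s, snd z)) \<in> borel_measurable (P T \<Otimes>\<^sub>M R T)"
    using ind by (simp add: case_prod_beta')
  then have m: "(\<lambda>z. \<integral>s. indicator {..fst z} s * f (s, snd z) \<partial>R T) \<in> borel_measurable (P T)"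
    by (rule R.borel_measurable_lebesgue_integral)
  have Y: "sq_int (P T) (\<lambda>z. \<integral>s. \<bar>f (s, snd z)\<bar> \<partial>R T)"
    by (intro sq_int_snd_P sq_int_time_integral sq_int_abs f)
  have "integrable (P T) (\<lambda>z. (\<integral>s. indicator {..fst z} s * f (s, snd z) \<partial>R T)\<^sup>2)"
  proof (rule Bochner_Integration.integrable_bound[OF sq_int_square[OF Y]])
    show "(\<lambda>z. (\<integral>s. indicator {..fst z} s * f (s, snd z) \<partial>R T)\<^sup>2) \<in> borel_measurable (P T)" using m by simp
    have "AE \<omega> in M. integrable (R T) (\<lambda>s. f (s, \<omega>))"
      by (rule Fubini_P(5)[OF P.sq_int_integrable[OF f]])
    then have "AE z in P T. integrable (R T) (\<lambda>s. f (s, snd z))"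
    proof -
      assume "AE \<omega> in M. integrable (R T) (\<lambda>s. f (s, \<omega>))"
      then obtain N where N: "{\<omega>\<in>space M. \<not> integrable (R T) (\<lambda>s. f (s, \<omega>))} \<subseteq> N" "N \<in> null_sets M"
        by (auto simp: eventually_ae_filter)
      \<comment> \<open>An exceptional set of paths stays null after multiplication with the time
        interval.\<close>
      have "space (R T) \<times> N \<in> null_sets (R T \<Otimes>\<^sub>M M)"
        using N(2) emeasure_pair_measure_Times[OF sets.top, of N "R T"]
        unfolding null_sets_def by (auto intro!: pair_measureI simp: sets_restrict_space_iff)
      then show ?thesis
        using N(1) unfolding time_prod_def eventually_ae_filter
        by (intro bexI[of _ "space (R T) \<times> N"]) (auto simp: space_pair_measure)
    qed
    then show "AE z in P T. norm ((\<integral>s. indicator {..fst z} s * f (s, snd z) \<partial>R T)\<^sup>2) \<le> norm ((\<integral>s. \<bar>f (s, snd z)\<bar> \<partial>R T)\<^sup>2)"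
    proof eventually_elim
      fix z :: "real \<times> 'w" assume int: "integrable (R T) (\<lambda>s. f (s, snd z))"
      have "norm (\<integral>s. indicator {..fst z} s * f (s, snd z) \<partial>R T) \<le> (\<integral>s. norm (indicator {..fst z} s * f (s, snd z)) \<partial>R T)"
        by (rule integral_norm_bound)
      also have "\<dots> \<le> (\<integral>s. \<bar>f (s, snd z)\<bar> \<partial>R T)"
        using int by (intro integral_mono') (auto simp: indicator_def)
      finally show "norm ((\<integral>s. indicator {..fst z} s * f (s, snd z) \<partial>R T)\<^sup>2) \<le> norm ((\<integral>s. \<bar>f (s, snd z)\<bar> \<partial>R T)\<^sup>2)"
        by (simp add: abs_le_square_iff[symmetric])
    qed
  qed
  then show ?thesis using m by (simp add: sq_int_def)
qed

text \<open>Ito's formula for the second moment, obtained without stochastic calculus: with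
  \<open>V\<close> the primitive of \<open>X\<close> one has \<open>X = x - g V + W\<close>, the covariance of \<open>V\<close> and \<open>W\<close> at time \<open>t\<close> is
  computed by Fubini and the martingale property, and \<open>\<integral> X V = V\<^sup>2/2\<close> pathwise.\<close>

lemma second_moment_identity:
  assumes t: "0 \<le> t"
    and X: "\<And>r. 0 \<le> r \<Longrightarrow> r \<le> t \<Longrightarrow> sq_int (P r) (\<lambda>z. X (fst z) (snd z))"
      "\<And>r. 0 \<le> r \<Longrightarrow> r \<le> t \<Longrightarrow> X r \<in> borel_measurable M"
    and cont: "AE \<omega> in M. continuous_on {0..t} (\<lambda>s. X s \<omega>)"
    and W: "\<And>r. 0 \<le> r \<Longrightarrow> r \<le> t \<Longrightarrow> sq_int M (W r)" "expectation (W t) = 0"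
    and orth: "\<And>r. 0 \<le> r \<Longrightarrow> r \<le> t \<Longrightarrow> sq_int M (X r) \<Longrightarrow>
      expectation (\<lambda>\<omega>. X r \<omega> * W t \<omega>) = expectation (\<lambda>\<omega>. X r \<omega> * W r \<omega>)"
    and eq: "\<And>r. 0 \<le> r \<Longrightarrow> r \<le> t \<Longrightarrow> AE \<omega> in M. X r \<omega> = x - g * (LINT s:{0..r}|lborel. X s \<omega>) + W r \<omega>"
  shows "sq_int M (X t)"
    and "expectation (\<lambda>\<omega>. (X t \<omega>)\<^sup>2) =
      x\<^sup>2 - 2 * g * (\<integral>z. (X (fst z) (snd z))\<^sup>2 \<partial>P t) + expectation (\<lambda>\<omega>. (W t \<omega>)\<^sup>2)"
proof -
  interpret Pt: finite_measure "P t" by (rule finite_P)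
  define V where "V r \<omega> = (\<integral>s. X s \<omega> \<partial>R r)" for r \<omega>
  have V: "sq_int M (V r)" if "0 \<le> r" "r \<le> t" for r
    unfolding V_def using sq_int_time_integral[OF X(1)[OF that]] by simp
  have eqV: "AE \<omega> in M. X r \<omega> = x - g * V r \<omega> + W r \<omega>" if "0 \<le> r" "r \<le> t" for r
    using eq[OF that] by (simp add: V_def set_integral_R)
  \<comment> \<open>Finite energy gives square integrability at almost every time only; the equation
    gives it at every time.\<close>
  have Xr: "sq_int M (X r)" if "0 \<le> r" "r \<le> t" for r
  proof (rule sq_int_cong_AE)
    show "sq_int M (\<lambda>\<omega>. x - g * V r \<omega> + W r \<omega>)"
      by (intro sq_int_add sq_int_diff sq_int_scale sq_int_const V W that)
    show "X r \<in> borel_measurable M" by (rule X(2)[OF that])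
    show "AE \<omega> in M. x - g * V r \<omega> + W r \<omega> = X r \<omega>" using eqV[OF that] by (auto simp: eq_commute)
  qed
  then show "sq_int M (X t)" using t by simp
  let ?X = "\<lambda>z. X (fst z) (snd z)"
  \<comment> \<open>The jointly measurable form of \<open>V\<close>, to which Fubini can be
    applied.\<close>
  define V' where "V' z = (\<integral>s. indicator {..fst z} s * X s (snd z) \<partial>R t)" for z
  have Xt: "sq_int (P t) ?X" using X(1) t by simp
  have V'sq: "sq_int (P t) V'"
    unfolding V'_def using primitive_sq_int[OF Xt] by simp
  have V'V: "V' (r, \<omega>) = V r \<omega>" if "r \<in> {0..t}" for r \<omega>
    unfolding V'_def V_def fst_conv snd_conv by (rule primitive_R[OF that])
  have Wt: "sq_int M (W t)" using W t by simp
  have Vt: "sq_int M (V t)" using V t by simp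
  define a p w where "a = (\<integral>z. (?X z)\<^sup>2 \<partial>P t)" and "p = expectation (V t)" and "w = expectation (\<lambda>\<omega>. (V t \<omega>)\<^sup>2)"
  have XV': "(\<integral>z. ?X z * V' z \<partial>P t) = w / 2"
  proof -
    have "(\<integral>z. ?X z * V' z \<partial>P t) = expectation (\<lambda>\<omega>. \<integral>r. X r \<omega> * V' (r, \<omega>) \<partial>R t)"
      using Fubini_P(4)[OF sq_int_mult[OF Xt V'sq]] by simp
    also have "\<dots> = expectation (\<lambda>\<omega>. \<integral>r. X r \<omega> * V r \<omega> \<partial>R t)"
      by (intro Bochner_Integration.integral_cong refl) (simp add: space_restrict_space V'V)
    also have "\<dots> = expectation (\<lambda>\<omega>. (V t \<omega>)\<^sup>2 / 2)"
    proof (rule integral_cong_AE)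
      have "(\<lambda>\<omega>. \<integral>r. X r \<omega> * V' (r, \<omega>) \<partial>R t) \<in> borel_measurable M"
        using Fubini_P(3)[OF sq_int_mult[OF Xt V'sq]] by simp
      moreover have "(\<integral>r. X r \<omega> * V' (r, \<omega>) \<partial>R t) = (\<integral>r. X r \<omega> * V r \<omega> \<partial>R t)" for \<omega>
        by (intro Bochner_Integration.integral_cong refl) (simp add: space_restrict_space V'V)
      ultimately show "(\<lambda>\<omega>. \<integral>r. X r \<omega> * V r \<omega> \<partial>R t) \<in> borel_measurable M" by simp
      show "(\<lambda>\<omega>. (V t \<omega>)\<^sup>2 / 2) \<in> borel_measurable M" using sq_int_measurable[OF Vt] by simp
      show "AE \<omega> in M. (\<integral>r. X r \<omega> * V r \<omega> \<partial>R t) = (V t \<omega>)\<^sup>2 / 2"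
        using cont
      proof eventually_elim
        fix \<omega> assume "continuous_on {0..t} (\<lambda>s. X s \<omega>)"
        from integral_times_primitive[OF t this] show "(\<integral>r. X r \<omega> * V r \<omega> \<partial>R t) = (V t \<omega>)\<^sup>2 / 2"
          by (simp add: set_integral_R V_def)
      qed
    qed
    finally show ?thesis by (simp add: w_def)
  qed
  have p: "(\<integral>z. ?X z \<partial>P t) = p"
    using Fubini_P(4)[OF Pt.sq_int_integrable[OF Xt]] by (simp add: p_def V_def[abs_def])
  \<comment> \<open>\<open>V t\<close> is a time integral of \<open>X r\<close>; under it the
    orthogonality hypothesis replaces \<open>W t\<close> by \<open>W r\<close>, which the equation
    expresses as \<open>X r - x + g * V r\<close>.\<close>
  have VW: "expectation (\<lambda>\<omega>. V t \<omega> * W t \<omega>) = a - x * p + g * (w / 2)"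
  proof -
    have sqW: "sq_int (P t) (\<lambda>z. W t (snd z))" by (rule sq_int_snd_P[OF Wt])
    have "expectation (\<lambda>\<omega>. V t \<omega> * W t \<omega>) = expectation (\<lambda>\<omega>. \<integral>r. X r \<omega> * W t \<omega> \<partial>R t)"
      by (simp add: V_def)
    also have "\<dots> = (\<integral>z. ?X z * W t (snd z) \<partial>P t)"
      using Fubini_P(4)[OF sq_int_mult[OF Xt sqW]] by simp
    also have "\<dots> = (\<integral>r. expectation (\<lambda>\<omega>. X r \<omega> * W t \<omega>) \<partial>R t)"
      using Fubini_P(2)[OF sq_int_mult[OF Xt sqW]] by simp
    also have "\<dots> = (\<integral>r. expectation (\<lambda>\<omega>. (X r \<omega>)\<^sup>2 - x * X r \<omega> + g * (X r \<omega> * V' (r, \<omega>))) \<partial>R t)"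
    proof (rule Bochner_Integration.integral_cong[OF refl])
      fix r assume "r \<in> space (R t)"
      then have r: "0 \<le> r" "r \<le> t" by (auto simp: space_restrict_space)
      have "expectation (\<lambda>\<omega>. X r \<omega> * W t \<omega>) = expectation (\<lambda>\<omega>. X r \<omega> * W r \<omega>)"
        by (rule orth[OF r Xr[OF r]])
      also have "\<dots> = expectation (\<lambda>\<omega>. (X r \<omega>)\<^sup>2 - x * X r \<omega> + g * (X r \<omega> * V r \<omega>))"
      proof (rule integral_cong_AE)
        show "(\<lambda>\<omega>. X r \<omega> * W r \<omega>) \<in> borel_measurable M"
          "(\<lambda>\<omega>. (X r \<omega>)\<^sup>2 - x * X r \<omega> + g * (X r \<omega> * V r \<omega>)) \<in> borel_measurable M"
          using sq_int_measurable[OF Xr[OF r]] sq_int_measurable[OF W(1)[OF r]] sq_int_measurable[OF V[OF r]] by simp_all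
        show "AE \<omega> in M. X r \<omega> * W r \<omega> = (X r \<omega>)\<^sup>2 - x * X r \<omega> + g * (X r \<omega> * V r \<omega>)"
          using eqV[OF r]
        proof eventually_elim
          fix \<omega> assume "X r \<omega> = x - g * V r \<omega> + W r \<omega>"
          then have "W r \<omega> = X r \<omega> - x + g * V r \<omega>" by simp
          then show "X r \<omega> * W r \<omega> = (X r \<omega>)\<^sup>2 - x * X r \<omega> + g * (X r \<omega> * V r \<omega>)"
            by (simp only:) (simp add: power2_eq_square algebra_simps)
        qed
      qed
      finally show "expectation (\<lambda>\<omega>. X r \<omega> * W t \<omega>) = expectation (\<lambda>\<omega>. (X r \<omega>)\<^sup>2 - x * X r \<omega> + g * (X r \<omega> * V' (r, \<omega>)))"
        using r by (simp add: V'V)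
    qed
    also have "\<dots> = (\<integral>z. (?X z)\<^sup>2 - x * ?X z + g * (?X z * V' z) \<partial>P t)"
    proof -
      have "integrable (P t) (\<lambda>z. (?X z)\<^sup>2 - x * ?X z + g * (?X z * V' z))"
        using sq_int_square[OF Xt] Pt.sq_int_integrable[OF Xt] sq_int_mult[OF Xt V'sq] by simp
      from Fubini_P(2)[OF this] show ?thesis by simp
    qed
    also have "\<dots> = a - x * p + g * (w / 2)"
      using sq_int_square[OF Xt] Pt.sq_int_integrable[OF Xt] sq_int_mult[OF Xt V'sq]
      by (simp add: a_def p XV')
    finally show ?thesis .
  qed
  have "expectation (\<lambda>\<omega>. (X t \<omega>)\<^sup>2) = expectation (\<lambda>\<omega>. (x - g * V t \<omega> + W t \<omega>)\<^sup>2)"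
  proof (rule integral_cong_AE)
    show "(\<lambda>\<omega>. (X t \<omega>)\<^sup>2) \<in> borel_measurable M" "(\<lambda>\<omega>. (x - g * V t \<omega> + W t \<omega>)\<^sup>2) \<in> borel_measurable M"
      using X(2)[of t] t sq_int_measurable[OF Wt] sq_int_measurable[OF Vt] by simp_all
    show "AE \<omega> in M. (X t \<omega>)\<^sup>2 = (x - g * V t \<omega> + W t \<omega>)\<^sup>2"
      using eqV[of t] t by auto
  qed
  also have "\<dots> = expectation (\<lambda>\<omega>. x\<^sup>2 - 2 * g * x * V t \<omega> + g\<^sup>2 * (V t \<omega>)\<^sup>2 + 2 * x * W t \<omega>
      - 2 * g * (V t \<omega> * W t \<omega>) + (W t \<omega>)\<^sup>2)"
    by (intro Bochner_Integration.integral_cong refl) (simp add: power2_eq_square algebra_simps)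
  also have "\<dots> = x\<^sup>2 - 2 * g * x * p + g\<^sup>2 * w - 2 * g * (a - x * p + g * (w / 2)) + expectation (\<lambda>\<omega>. (W t \<omega>)\<^sup>2)"
    using sq_int_square[OF Vt] sq_int_square[OF Wt] sq_int_integrable[OF Vt] sq_int_integrable[OF Wt] sq_int_mult[OF Vt Wt] W(2)
    by (simp add: p_def[symmetric] w_def[symmetric] VW prob_space)
  \<comment> \<open>All terms with \<open>p\<close> and \<open>w\<close> cancel: the covariance of
    \<open>V\<close> and \<open>W\<close> compensates the quadratic drift term.\<close>
  also have "\<dots> = x\<^sup>2 - 2 * g * a + expectation (\<lambda>\<omega>. (W t \<omega>)\<^sup>2)"
    by (simp add: power2_eq_square algebra_simps)
  finally show "expectation (\<lambda>\<omega>. (X t \<omega>)\<^sup>2) = x\<^sup>2 - 2 * g * (\<integral>z. (X (fst z) (snd z))\<^sup>2 \<partial>P t) + expectation (\<lambda>\<omega>. (W t \<omega>)\<^sup>2)"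
    by (simp add: a_def)
qed

lemma ito_solution_sq_int:
  assumes "linear_ito_solution M F B N G b A x0 U" "i \<in> {1..N}" "0 \<le> T"
  shows "sq_int (P T) (\<lambda>z. U (fst z) (snd z) i)"
  using assms by (intro energy_sq_int) (auto simp: linear_ito_solution_def)

text \<open>A row of the drift that acts as a scalar decouples the component \<open>i\<close>, so
  that \<open>second_moment_identity\<close> applies with \<open>b * Z t \<omega> i\<close> as the
  martingale part. The hypothesis \<open>lim\<close> has square partial sums because the variance of
  a partial sum of the noise produces them.\<close>

lemma ito_solution_second_moment:
  assumes U: "linear_ito_solution M F B N G b A x0 U" and i: "i \<in> {1..N}"
    and diag: "\<And>v. mat_vec N G v i = \<gamma> * v i" and t: "0 \<le> t"
    and lim: "\<And>k l. k \<in> {1..N} \<Longrightarrow> l \<in> {1..N} \<Longrightarrow>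
      (\<lambda>n. \<Sum>j=1..n. \<Sum>j'=1..n. \<alpha> j j' * A j i k * A j' i l) \<longlonglongrightarrow> q k l"
  shows "sq_int M (\<lambda>\<omega>. U t \<omega> i)"
    and "expectation (\<lambda>\<omega>. (U t \<omega> i)\<^sup>2) = (x0 i)\<^sup>2 - 2 * \<gamma> * (\<integral>z. (U (fst z) (snd z) i)\<^sup>2 \<partial>P t)
      + b\<^sup>2 * (\<Sum>k=1..N. \<Sum>l=1..N. q k l * (\<integral>z. U (fst z) (snd z) k * U (fst z) (snd z) l \<partial>P t))"
proof -
  have prog: "progressive F (\<lambda>t \<omega>. U t \<omega> k)"
    and cont: "AE \<omega> in M. continuous_on {0..} (\<lambda>t. U t \<omega> k)" if "k \<in> {1..N}" for k
    using U that by (auto simp: linear_ito_solution_def)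
  \<comment> \<open>Naming the body allows \<open>J\<close> and \<open>Z\<close> to be chosen as
    functions of time.\<close>
  define sol where "sol t J Z \<longleftrightarrow>
        (\<forall>j\<ge>1. \<forall>i\<in>{1..N}.
           has_ito_integral M F (B j) t (\<lambda>s \<omega>. mat_vec N (A j) (U s \<omega>) i) (\<lambda>\<omega>. J j \<omega> i)) \<and>
        (\<forall>i\<in>{1..N}. ms_tendsto M (\<lambda>n \<omega>. \<Sum>j=1..n. J j \<omega> i) (\<lambda>\<omega>. Z \<omega> i)) \<and>
        (AE \<omega> in M. \<forall>i\<in>{1..N}.
           U t \<omega> i = x0 i - (LINT s:{0..t}|lborel. mat_vec N G (U s \<omega>) i) + b * Z \<omega> i)"
    for t J Z
  have "\<forall>t\<ge>0. \<exists>J Z. sol t J Z"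
    using U unfolding linear_ito_solution_def sol_def by (rule conjunct2)
  then obtain J Z where JZ: "\<And>t. 0 \<le> t \<Longrightarrow> sol t (J t) (Z t)"
    by metis
  note JZ = JZ[unfolded sol_def]
  define H where "H j s \<omega> = mat_vec N (A j) (U s \<omega>) i" for j s \<omega>
  have J: "has_ito_integral M F (B j) r (H j) (\<lambda>\<omega>. J r j \<omega> i)" if "1 \<le> j" "0 \<le> r" for j r
    using JZ[OF that(2)] that(1) i unfolding H_def by blast
  have Jsq: "sq_int M (\<lambda>\<omega>. J r j \<omega> i)" if "1 \<le> j" "0 \<le> r" for j r
    by (rule ito_sq_int[OF J[OF that] that])
  have Z: "sq_lim M (\<lambda>n \<omega>. \<Sum>j=1..n. J r j \<omega> i) (\<lambda>\<omega>. Z r \<omega> i)" if "0 \<le> r" for r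
    using JZ[OF that] i that by (intro ms_tendsto_sq_lim sq_int_sum Jsq) auto
  have Zsq: "sq_int M (\<lambda>\<omega>. Z r \<omega> i)" if "0 \<le> r" for r
    using Z[OF that] by (simp add: sq_lim_def)
  have EZ: "(\<lambda>n. \<Sum>j=1..n. expectation (\<lambda>\<omega>. X \<omega> * J r j \<omega> i)) \<longlonglongrightarrow> expectation (\<lambda>\<omega>. X \<omega> * Z r \<omega> i)"
    if "0 \<le> r" "sq_int M X" for r X
  proof -
    have "(\<Sum>j=1..n. expectation (\<lambda>\<omega>. X \<omega> * J r j \<omega> i)) = expectation (\<lambda>\<omega>. X \<omega> * (\<Sum>j=1..n. J r j \<omega> i))" for n
      unfolding sum_distrib_left using that
      by (intro Bochner_Integration.integral_sum[symmetric] sq_int_mult Jsq) auto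
    then show ?thesis
      using sq_lim_integral_mult[OF sq_lim_const[OF that(2)] Z[OF that(1)]] by simp
  qed
  \<comment> \<open>The martingale property holds for each j and survives the mean square limit of
    the partial sums.\<close>
  have orth: "expectation (\<lambda>\<omega>. X \<omega> * Z t \<omega> i) = expectation (\<lambda>\<omega>. X \<omega> * Z r \<omega> i)"
    if r: "0 \<le> r" "r \<le> t" and X: "X \<in> borel_measurable (F r)" "sq_int M X" for r X
  proof -
    have "(\<Sum>j=1..n. expectation (\<lambda>\<omega>. X \<omega> * J t j \<omega> i)) = (\<Sum>j=1..n. expectation (\<lambda>\<omega>. X \<omega> * J r j \<omega> i))" for n
      using r t by (intro sum.cong refl ito_martingale[OF J J] X) auto
    with EZ[OF t X(2)] have "(\<lambda>n. \<Sum>j=1..n. expectation (\<lambda>\<omega>. X \<omega> * J r j \<omega> i)) \<longlonglongrightarrow> expectation (\<lambda>\<omega>. X \<omega> * Z t \<omega> i)"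
      by simp
    then show ?thesis using EZ[OF r(1) X(2)] by (rule LIMSEQ_unique)
  qed
  have mean: "expectation (\<lambda>\<omega>. Z t \<omega> i) = 0"
  proof -
    have "(\<Sum>j=1..n. expectation (\<lambda>\<omega>. 1 * J t j \<omega> i)) = 0" for n
      using ito_mean[OF J _ t] t by (intro sum.neutral) auto
    then show ?thesis using EZ[OF t sq_int_const[of 1]] LIMSEQ_unique[OF tendsto_const] by fastforce
  qed
  have Xsq: "sq_int (P r) (\<lambda>z. U (fst z) (snd z) k)" if "k \<in> {1..N}" "0 \<le> r" for k r
    by (rule ito_solution_sq_int[OF U that])
  have var: "expectation (\<lambda>\<omega>. (Z t \<omega> i)\<^sup>2) =
      (\<Sum>k=1..N. \<Sum>l=1..N. q k l * (\<integral>z. U (fst z) (snd z) k * U (fst z) (snd z) l \<partial>P t))"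
  proof -
    have HH: "(\<integral>z. H j (fst z) (snd z) * H j' (fst z) (snd z) \<partial>P t) =
        (\<Sum>k=1..N. \<Sum>l=1..N. A j i k * A j' i l * (\<integral>z. U (fst z) (snd z) k * U (fst z) (snd z) l \<partial>P t))" for j j'
    proof -
      have "(\<integral>z. H j (fst z) (snd z) * H j' (fst z) (snd z) \<partial>P t) =
          (\<integral>z. (\<Sum>k=1..N. \<Sum>l=1..N. A j i k * A j' i l * (U (fst z) (snd z) k * U (fst z) (snd z) l)) \<partial>P t)"
        by (intro Bochner_Integration.integral_cong refl)
          (unfold H_def mat_vec_def sum_product, intro sum.cong refl, simp add: mult_ac)
      also have "\<dots> = (\<Sum>k=1..N. \<Sum>l=1..N. A j i k * A j' i l * (\<integral>z. U (fst z) (snd z) k * U (fst z) (snd z) l \<partial>P t))"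
        by (intro has_bochner_integral_integral_eq has_bochner_integral_sum has_bochner_integral_mult_right
            has_bochner_integral_integrable sq_int_mult Xsq t)
      finally show ?thesis .
    qed
    have "(\<lambda>n. expectation (\<lambda>\<omega>. (\<Sum>j=1..n. J t j \<omega> i) * (\<Sum>j=1..n. J t j \<omega> i))) \<longlonglongrightarrow> expectation (\<lambda>\<omega>. Z t \<omega> i * Z t \<omega> i)"
      by (rule sq_lim_integral_mult[OF Z[OF t] Z[OF t]])
    moreover have "expectation (\<lambda>\<omega>. (\<Sum>j=1..n. J t j \<omega> i) * (\<Sum>j=1..n. J t j \<omega> i)) =
        (\<Sum>k=1..N. \<Sum>l=1..N. (\<Sum>j=1..n. \<Sum>j'=1..n. \<alpha> j j' * A j i k * A j' i l) *
          (\<integral>z. U (fst z) (snd z) k * U (fst z) (snd z) l \<partial>P t))" (is "?l n = ?r n") for n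
    proof -
      have "?l n = (\<Sum>j=1..n. \<Sum>j'=1..n. expectation (\<lambda>\<omega>. J t j \<omega> i * J t j' \<omega> i))"
        unfolding sum_product
        by (intro has_bochner_integral_integral_eq has_bochner_integral_sum
            has_bochner_integral_integrable sq_int_mult Jsq t) auto
      also have "\<dots> = (\<Sum>j=1..n. \<Sum>j'=1..n. \<alpha> j j' * (\<Sum>k=1..N. \<Sum>l=1..N. A j i k * A j' i l *
          (\<integral>z. U (fst z) (snd z) k * U (fst z) (snd z) l \<partial>P t)))"
        using t by (intro sum.cong refl) (simp add: ito_isometry[OF J J] HH)
      also have "\<dots> = ?r n"
      proof -
        \<comment> \<open>The sums over matrix indices are moved outside, so that the limit in n
          meets only the double series of \<open>lim\<close>.\<close>
        define C where "C k l = (\<integral>z. U (fst z) (snd z) k * U (fst z) (snd z) l \<partial>P t)" for k l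
        have "(\<Sum>j=1..n. \<Sum>j'=1..n. \<alpha> j j' * (\<Sum>k=1..N. \<Sum>l=1..N. A j i k * A j' i l * C k l)) =
            (\<Sum>j=1..n. \<Sum>j'=1..n. \<Sum>k=1..N. \<Sum>l=1..N. \<alpha> j j' * A j i k * A j' i l * C k l)"
          by (simp add: sum_distrib_left mult.assoc)
        also have "\<dots> = (\<Sum>j=1..n. \<Sum>k=1..N. \<Sum>j'=1..n. \<Sum>l=1..N. \<alpha> j j' * A j i k * A j' i l * C k l)"
          by (intro sum.cong refl sum.swap)
        also have "\<dots> = (\<Sum>k=1..N. \<Sum>j=1..n. \<Sum>j'=1..n. \<Sum>l=1..N. \<alpha> j j' * A j i k * A j' i l * C k l)"
          by (rule sum.swap)
        also have "\<dots> = (\<Sum>k=1..N. \<Sum>j=1..n. \<Sum>l=1..N. \<Sum>j'=1..n. \<alpha> j j' * A j i k * A j' i l * C k l)"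
          by (intro sum.cong refl sum.swap)
        also have "\<dots> = (\<Sum>k=1..N. \<Sum>l=1..N. \<Sum>j=1..n. \<Sum>j'=1..n. \<alpha> j j' * A j i k * A j' i l * C k l)"
          by (intro sum.cong refl sum.swap)
        finally show ?thesis by (simp add: C_def sum_distrib_right)
      qed
      finally show ?thesis .
    qed
    moreover have "?r \<longlonglongrightarrow> (\<Sum>k=1..N. \<Sum>l=1..N. q k l * (\<integral>z. U (fst z) (snd z) k * U (fst z) (snd z) l \<partial>P t))"
      by (intro tendsto_sum tendsto_mult_right lim)
    ultimately show ?thesis
      by (simp add: power2_eq_square LIMSEQ_unique)
  qed
  have W: "sq_int M (\<lambda>\<omega>. b * Z r \<omega> i)" if "0 \<le> r" for r by (intro sq_int_scale Zsq that)
  note ident = second_moment_identity[where X="\<lambda>t \<omega>. U t \<omega> i" and W="\<lambda>t \<omega>. b * Z t \<omega> i" and x="x0 i" and g=\<gamma>, OF t Xsq[OF i]]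
  have meas: "(\<lambda>\<omega>. U r \<omega> i) \<in> borel_measurable (F r)" if "0 \<le> r" for r
    using progressive_adapted[OF prog[OF i] that] by simp
  have cont': "AE \<omega> in M. continuous_on {0..t} (\<lambda>s. U s \<omega> i)"
    using cont[OF i] by eventually_elim (auto intro: continuous_on_subset)
  have mean': "expectation (\<lambda>\<omega>. b * Z t \<omega> i) = 0" using mean by simp
  have orth': "expectation (\<lambda>\<omega>. U r \<omega> i * (b * Z t \<omega> i)) = expectation (\<lambda>\<omega>. U r \<omega> i * (b * Z r \<omega> i))"
    if "0 \<le> r" "r \<le> t" "sq_int M (\<lambda>\<omega>. U r \<omega> i)" for r
    using orth[OF that(1,2) meas[OF that(1)] that(3)] by (simp add: mult.left_commute[of _ b])
  have eq: "AE \<omega> in M. U r \<omega> i = x0 i - \<gamma> * (LINT s:{0..r}|lborel. U s \<omega> i) + b * Z r \<omega> i"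
    if "0 \<le> r" "r \<le> t" for r
    using JZ[OF that(1)] i by (auto simp: diag elim: eventually_mono)
  show "sq_int M (\<lambda>\<omega>. U t \<omega> i)"
    by (rule ident(1)[OF _ F_measurable[OF meas] cont' W mean' orth' eq]) auto
  have "expectation (\<lambda>\<omega>. (U t \<omega> i)\<^sup>2) = (x0 i)\<^sup>2 - 2 * \<gamma> * (\<integral>z. (U (fst z) (snd z) i)\<^sup>2 \<partial>P t) + expectation (\<lambda>\<omega>. (b * Z t \<omega> i)\<^sup>2)"
    by (rule ident(2)[OF _ F_measurable[OF meas] cont' W mean' orth' eq]) auto
  then show "expectation (\<lambda>\<omega>. (U t \<omega> i)\<^sup>2) = (x0 i)\<^sup>2 - 2 * \<gamma> * (\<integral>z. (U (fst z) (snd z) i)\<^sup>2 \<partial>P t)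
      + b\<^sup>2 * (\<Sum>k=1..N. \<Sum>l=1..N. q k l * (\<integral>z. U (fst z) (snd z) k * U (fst z) (snd z) l \<partial>P t))"
    by (simp add: power_mult_distrib var)
qed

section \<open>Decay from the integrated energy identity\<close>

lemma P_integral_mono:
  fixes h :: "real \<times> 'w \<Rightarrow> real"
  assumes h: "integrable (P t) h" "integrable (P s) h" "\<And>z. 0 \<le> h z" and s: "s \<le> t"
  shows "(\<integral>z. h z \<partial>P s) \<le> (\<integral>z. h z \<partial>P t)"
proof -
  have eq: "(\<integral>\<^sup>+z. ennreal (h z) \<partial>P u) = (\<integral>\<^sup>+\<omega>. (\<integral>\<^sup>+r\<in>{0..u}. ennreal (h (r, \<omega>)) \<partial>lborel) \<partial>M)" if "integrable (P u) h" for u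
  proof -
    interpret pair_sigma_finite "R u" M by (rule pair_time)
    have "(\<lambda>z. ennreal (h z)) \<in> borel_measurable (R u \<Otimes>\<^sub>M M)" using that by (auto simp: time_prod_def)
    from nn_integral_snd[OF this] show ?thesis
      by (simp add: nn_integral_restrict_space time_prod_def)
  qed
  have "ennreal (\<integral>z. h z \<partial>P s) = (\<integral>\<^sup>+z. ennreal (h z) \<partial>P s)"
    using h by (intro nn_integral_eq_integral[symmetric]) auto
  also have "\<dots> \<le> (\<integral>\<^sup>+z. ennreal (h z) \<partial>P t)"
    unfolding eq[OF h(1)] eq[OF h(2)] using s by (intro nn_integral_mono mult_left_mono) (auto simp: indicator_def)
  also have "\<dots> = ennreal (\<integral>z. h z \<partial>P t)"
    using h by (intro nn_integral_eq_integral) auto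
  finally show ?thesis using h by (subst (asm) ennreal_le_iff) auto
qed

text \<open>\<psi> is nonpositive, so the mean square is nonincreasing and t times its value at t is
  at most its integral over \<open>{0..t}\<close>. Inserted into the bound for the integral of
  \<psi>, this gives the factor 1 + c t without differentiating the mean square.\<close>

lemma mean_square_decay:
  assumes c: "0 \<le> c" and t: "0 \<le> t"
    and X: "\<And>r k. 0 \<le> r \<Longrightarrow> k \<in> K \<Longrightarrow> sq_int (P r) (\<lambda>z. X (fst z) (snd z) k)"
    and \<psi>: "\<And>r. 0 \<le> r \<Longrightarrow> integrable (P r) \<psi>" "\<And>z. \<psi> z \<le> - c * (\<Sum>k\<in>K. (X (fst z) (snd z) k)\<^sup>2)"
    and \<phi>: "\<And>r. 0 \<le> r \<Longrightarrow> expectation (\<lambda>\<omega>. \<Sum>k\<in>K. (X r \<omega> k)\<^sup>2) = x + (\<integral>z. \<psi> z \<partial>P r)"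
  shows "(1 + c * t) * expectation (\<lambda>\<omega>. \<Sum>k\<in>K. (X t \<omega> k)\<^sup>2) \<le> x"
proof -
  define \<phi> where "\<phi> r = expectation (\<lambda>\<omega>. \<Sum>k\<in>K. (X r \<omega> k)\<^sup>2)" for r
  have \<psi>0: "0 \<le> - \<psi> z" for z
    using \<psi>(2)[of z] c by (smt (verit) mult_minus_left mult_nonneg_nonneg sum_nonneg zero_le_power2)
  have mono: "\<phi> t \<le> \<phi> r" if r: "0 \<le> r" "r \<le> t" for r
    using P_integral_mono[of t "\<lambda>z. - \<psi> z" r] \<psi>(1)[OF t] \<psi>(1)[OF r(1)] \<psi>0 r
    by (simp add: \<phi>_def \<phi>[OF t] \<phi>[OF r(1)])
  have int: "integrable (P t) (\<lambda>z. \<Sum>k\<in>K. (X (fst z) (snd z) k)\<^sup>2)"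
    using X[OF t] by (intro Bochner_Integration.integrable_sum sq_int_square)
  have "t * \<phi> t = (\<integral>r. \<phi> t \<partial>R t)"
    using t by (simp add: measure_restrict_space space_restrict_space)
  also have "\<dots> \<le> (\<integral>r. \<phi> r \<partial>R t)"
  proof (rule integral_mono)
    interpret R: finite_measure "R t" by (rule finite_measure_restrict_Icc)
    show "integrable (R t) (\<lambda>r. \<phi> t)" by simp
    show "integrable (R t) \<phi>" using Fubini_P(1)[OF int] by (simp add: \<phi>_def[abs_def])
    show "\<phi> t \<le> \<phi> r" if "r \<in> space (R t)" for r using that mono by (auto simp: space_restrict_space)
  qed
  also have "\<dots> = (\<integral>z. (\<Sum>k\<in>K. (X (fst z) (snd z) k)\<^sup>2) \<partial>P t)"
    using Fubini_P(2)[OF int] by (simp add: \<phi>_def)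
  finally have "c * (t * \<phi> t) \<le> c * (\<integral>z. (\<Sum>k\<in>K. (X (fst z) (snd z) k)\<^sup>2) \<partial>P t)"
    using c by (rule mult_left_mono)
  moreover have "(\<integral>z. \<psi> z \<partial>P t) \<le> (\<integral>z. - c * (\<Sum>k\<in>K. (X (fst z) (snd z) k)\<^sup>2) \<partial>P t)"
    using int by (intro integral_mono \<psi> t) auto
  ultimately show ?thesis using \<phi>[OF t] by (simp add: \<phi>_def algebra_simps)
qed

end

section \<open>The Galerkin system\<close>

text \<open>A density rather than a restricted space: Borel functions on the whole space remain the
  measurable ones, and the product of two such measures is again of this kind.\<close>

definition domain_measure :: "'c::euclidean_space set \<Rightarrow> 'c measure" where
  "domain_measure S = density lborel (\<lambda>x. ennreal (indicator S x))"

lemma sets_domain_measure [measurable_cong, simp]: "sets (domain_measure S) = sets borel"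
  and space_domain_measure [simp]: "space (domain_measure S) = UNIV"
  by (simp_all add: domain_measure_def)

text \<open>Set integrals constrain \<open>f\<close> on \<open>S\<close> alone, and \<open>f\<close>
  may fail to be Borel elsewhere. Any Borel \<open>g\<close> that agrees with it on \<open>S\<close>
  may stand in for it, in particular its extension by zero.\<close>

lemma domain_measure_integral:
  fixes f g :: "'c::euclidean_space \<Rightarrow> real"
  assumes "S \<in> sets borel" "g \<in> borel_measurable borel" "\<And>x. x \<in> S \<Longrightarrow> g x = f x"
  shows "integral\<^sup>L (domain_measure S) g = (LINT x:S|lborel. f x)"
    and "integrable (domain_measure S) g \<longleftrightarrow> set_integrable lborel S f"
proof -
  have eq: "(\<lambda>x. indicator S x *\<^sub>R g x) = (\<lambda>x. indicator S x *\<^sub>R f x)"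
    using assms(3) by (auto simp: fun_eq_iff indicator_def)
  show "integral\<^sup>L (domain_measure S) g = (LINT x:S|lborel. f x)"
    using assms unfolding domain_measure_def set_lebesgue_integral_def eq[symmetric]
    by (subst integral_density) auto
  show "integrable (domain_measure S) g \<longleftrightarrow> set_integrable lborel S f"
    using assms unfolding domain_measure_def set_integrable_def eq[symmetric]
    by (subst integrable_density) auto
qed

lemma finite_domain_measure:
  assumes "S \<in> sets borel" "bounded S"
  shows "finite_measure (domain_measure S)"
proof (rule finite_measureI)
  have "emeasure (domain_measure S) (space (domain_measure S)) = emeasure lborel S"
    using assms by (simp add: domain_measure_def emeasure_density ennreal_indicator)
  then show "emeasure (domain_measure S) (space (domain_measure S)) \<noteq> \<infinity>"
    using emeasure_bounded_finite[OF assms(2)] by simp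
qed

lemma domain_measure_Times:
  assumes "S \<in> sets borel" "bounded S"
  shows "domain_measure S \<Otimes>\<^sub>M domain_measure S = domain_measure (S \<times> S)"
proof -
  have "sigma_finite_measure (domain_measure S)"
    using finite_domain_measure[OF assms] by (simp add: finite_measure_def)
  then have "domain_measure S \<Otimes>\<^sub>M domain_measure S =
      density (lborel \<Otimes>\<^sub>M lborel) (\<lambda>(x, y). ennreal (indicator S x) * ennreal (indicator S y))"
    unfolding domain_measure_def using assms(1)
    by (intro pair_measure_density lborel.sigma_finite_measure_axioms) auto
  also have "\<dots> = domain_measure (S \<times> S)"
    unfolding domain_measure_def lborel_prod
    by (intro arg_cong2[where f=density] refl) (auto simp: indicator_def)
  finally show ?thesis .
qed

definition zero_ext :: "'c set \<Rightarrow> ('c \<Rightarrow> real) \<Rightarrow> 'c \<Rightarrow> real" where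
  "zero_ext S f x = indicator S x * f x"

lemma zero_ext_in [simp]: "x \<in> S \<Longrightarrow> zero_ext S f x = f x"
  by (simp add: zero_ext_def)

lemma zero_ext_measurable: "set_borel_measurable M S f \<Longrightarrow> zero_ext S f \<in> borel_measurable M"
  by (simp add: set_borel_measurable_def zero_ext_def[abs_def])

lemma L2_fun_iff_sq_int:
  assumes S: "S \<in> sets borel"
  shows "L2_fun S f \<longleftrightarrow> sq_int (domain_measure S) (zero_ext S f)"
proof -
  have "integrable (domain_measure S) (\<lambda>x. (zero_ext S f x)\<^sup>2) \<longleftrightarrow> set_integrable lborel S (\<lambda>x. (f x)\<^sup>2)"
    if "zero_ext S f \<in> borel_measurable borel"
    using that by (intro domain_measure_integral(2) S) auto
  then show ?thesis
    by (auto simp: L2_fun_def sq_int_def set_borel_measurable_def zero_ext_def[abs_def]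
        measurable_cong_sets[OF sets_domain_measure refl])
qed

lemma sq_int_domain_imp_L2_fun:
  assumes S: "S \<in> sets borel" and f: "sq_int (domain_measure S) f"
  shows "L2_fun S f"
proof -
  have [measurable]: "f \<in> borel_measurable borel" "S \<in> sets borel"
    using sq_int_measurable[OF f] S by (auto simp: measurable_cong_sets[OF sets_domain_measure refl])
  have "sq_int (domain_measure S) (zero_ext S f)"
    unfolding zero_ext_def[abs_def] by (rule sq_int_bounded_mult[OF f, where c=1]) auto
  then show ?thesis using L2_fun_iff_sq_int[OF S] by simp
qed

lemma L2_inner_eq_integral:
  assumes S: "S \<in> sets borel" and "L2_fun S f" "L2_fun S g"
  shows "L2_inner S f g = (\<integral>x. zero_ext S f x * zero_ext S g x \<partial>domain_measure S)"
  unfolding L2_inner_def using assms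
  by (intro domain_measure_integral(1)[symmetric] S borel_measurable_times zero_ext_measurable)
    (auto simp: L2_fun_def set_borel_measurable_def)

lemma orthonormal_basis_domain:
  assumes S: "S \<in> sets borel" and e: "L2_orthonormal_basis S e"
  shows "orthonormal_basis (domain_measure S) (\<lambda>l. zero_ext S (e l))"
  unfolding orthonormal_basis_def
proof (intro conjI allI impI)
  let ?\<mu> = "domain_measure S"
  have e1: "L2_fun S (e l)" if "1 \<le> l" for l using e that by (auto simp: L2_orthonormal_basis_def)
  have e2: "sq_int ?\<mu> (zero_ext S (e l))" if "1 \<le> l" for l using e1[OF that] L2_fun_iff_sq_int[OF S] by blast
  show "sq_int ?\<mu> (zero_ext S (e l))" if "1 \<le> l" for l by (rule e2[OF that])
  show "(\<integral>x. zero_ext S (e j) x * zero_ext S (e l) x \<partial>?\<mu>) = (if j = l then 1 else 0)" if "1 \<le> j" "1 \<le> l" for j l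
    using L2_inner_eq_integral[OF S e1[OF that(1)] e1[OF that(2)]] e that by (auto simp: L2_orthonormal_basis_def)
  fix g assume g: "sq_int ?\<mu> g"
  have gm: "g \<in> borel_measurable borel"
    using sq_int_measurable[OF g] by (simp add: measurable_cong_sets[OF sets_domain_measure refl])
  have g1: "L2_fun S g" by (rule sq_int_domain_imp_L2_fun[OF S g])
  let ?P = "\<lambda>n x. \<Sum>l=1..n. (\<integral>x. g x * zero_ext S (e l) x \<partial>?\<mu>) * zero_ext S (e l) x"
  have coef: "L2_inner S g (e l) = (\<integral>x. g x * zero_ext S (e l) x \<partial>?\<mu>)" if "1 \<le> l" for l
    unfolding L2_inner_def
    using gm zero_ext_measurable[of lborel S "e l"] e1[OF that] S
    by (intro domain_measure_integral(1)[symmetric]) (auto simp: L2_fun_def)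
  have P: "sq_int ?\<mu> (?P n)" for n by (intro sq_int_sum sq_int_scale e2) auto
  have Pm: "?P n \<in> borel_measurable borel" for n
    using sq_int_measurable[OF P[of n]] by (simp add: measurable_cong_sets[OF sets_domain_measure refl])
  have "(L2_norm S (\<lambda>x. g x - (\<Sum>k=1..n. L2_inner S g (e k) * e k x)))\<^sup>2 = (\<integral>x. (?P n x - g x)\<^sup>2 \<partial>?\<mu>)" for n
  proof -
    let ?d = "\<lambda>x. g x - (\<Sum>k=1..n. L2_inner S g (e k) * e k x)"
    have "L2_inner S ?d ?d = (\<integral>x. (?P n x - g x)\<^sup>2 \<partial>?\<mu>)"
      unfolding L2_inner_def[of S ?d ?d]
    proof (rule domain_measure_integral(1)[symmetric, OF S])
      show "(\<lambda>x. (?P n x - g x)\<^sup>2) \<in> borel_measurable borel"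
        using borel_measurable_diff[OF Pm[of n] gm] by (rule borel_measurable_power)
      fix x assume "x \<in> S"
      then have "?P n x = (\<Sum>k=1..n. L2_inner S g (e k) * e k x)"
        by (intro sum.cong refl) (auto simp: coef)
      then show "(?P n x - g x)\<^sup>2 = ?d x * ?d x" by (simp add: power2_eq_square algebra_simps)
    qed
    then show ?thesis by (simp add: L2_norm_def)
  qed
  moreover have "(\<lambda>n. L2_norm S (\<lambda>x. g x - (\<Sum>k=1..n. L2_inner S g (e k) * e k x))) \<longlonglongrightarrow> 0"
    using e g1 unfolding L2_orthonormal_basis_def by blast
  from tendsto_power[OF this, of 2]
  have "(\<lambda>n. (L2_norm S (\<lambda>x. g x - (\<Sum>k=1..n. L2_inner S g (e k) * e k x)))\<^sup>2) \<longlonglongrightarrow> 0" by simp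
  ultimately show "sq_lim ?\<mu> ?P g" using P g by (simp add: sq_lim_def)
qed

lemma positive_definite_on_zero_ext:
  assumes "positive_definite_on S q"
  shows "positive_definite_on UNIV (\<lambda>x y. indicator S x * indicator S y * q x y)"
  unfolding positive_definite_on_def
proof (intro conjI ballI allI impI)
  show "indicator S x * indicator S y * q x y = indicator S y * indicator S x * q y x" for x y
    using assms by (auto simp: positive_definite_on_def indicator_def)
  fix X :: "'a set" and c assume "finite X \<and> X \<subseteq> UNIV"
  then have X: "finite X" by simp
  have inner: "(\<Sum>y\<in>X. c x * c y * (indicator S x * indicator S y * q x y)) =
      (if x \<in> S then \<Sum>y\<in>X \<inter> S. c x * c y * q x y else 0)" for x
  proof (cases "x \<in> S")
    case True
    have "(\<Sum>y\<in>X. c x * c y * (indicator S x * indicator S y * q x y)) = (\<Sum>y\<in>X. if y \<in> S then c x * c y * q x y else 0)"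
      using True by (intro sum.cong refl) simp
    then show ?thesis using True by (simp add: sum.inter_restrict[OF X])
  qed simp
  have "0 \<le> (\<Sum>x\<in>X \<inter> S. \<Sum>y\<in>X \<inter> S. c x * c y * q x y)"
  proof -
    have "finite (X \<inter> S) \<and> X \<inter> S \<subseteq> S" using X by blast
    then show ?thesis using assms unfolding positive_definite_on_def by blast
  qed
  also have "\<dots> = (\<Sum>x\<in>X. \<Sum>y\<in>X. c x * c y * (indicator S x * indicator S y * q x y))"
    unfolding inner by (rule sum.inter_restrict[OF X])
  finally show "0 \<le> (\<Sum>x\<in>X. \<Sum>y\<in>X. c x * c y * (indicator S x * indicator S y * q x y))" .
qed

context psd_kernel
begin

text \<open>With \<open>f\<close> the combination of the \<open>e j\<close> with coefficients
  \<open>u j\<close>, the i-th inner double sum is the form of \<open>e i * f\<close> with itself.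
  Moving \<open>e i x * e i y\<close> into the kernel and summing over i produces the truncated
  kernel tested at \<open>f\<close>, whose squared norm is the sum of squares on the right.\<close>

lemma trace_form_le:
  assumes C: "form_bdd C" and e: "orthonormal_basis \<mu> e"
    and ee: "\<And>i k. 1 \<le> i \<Longrightarrow> 1 \<le> k \<Longrightarrow> sq_int \<mu> (\<lambda>x. e i x * e k x)"
    and tr: "\<And>f. sq_int \<mu> f \<Longrightarrow>
      (\<integral>(x, y). (\<Sum>l=1..n. k x y * e l x * e l y) * f x * f y \<partial>(\<mu> \<Otimes>\<^sub>M \<mu>)) \<le> \<kappa> * (\<integral>x. (f x)\<^sup>2 \<partial>\<mu>)"
  shows "(\<Sum>i=1..n. \<Sum>j=1..n. \<Sum>l=1..n. form (\<lambda>x. e i x * e j x) (\<lambda>x. e i x * e l x) * (u j * u l))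
    \<le> \<kappa> * (\<Sum>j=1..n. (u j)\<^sup>2)"
proof -
  define f where "f x = (\<Sum>j=1..n. u j * e j x)" for x
  have f: "sq_int \<mu> f"
    unfolding f_def using e by (intro sq_int_sum sq_int_scale) (auto simp: orthonormal_basis_def)
  have ef: "(\<lambda>x. e i x * f x) = (\<lambda>x. \<Sum>j=1..n. u j * (e i x * e j x))" for i
    by (simp add: f_def sum_distrib_left mult_ac)
  have efsq: "sq_int \<mu> (\<lambda>x. e i x * f x)" if "1 \<le> i" for i
    unfolding ef using that by (intro sq_int_sum sq_int_scale ee) auto
  have "(\<Sum>j=1..n. \<Sum>l=1..n. form (\<lambda>x. e i x * e j x) (\<lambda>x. e i x * e l x) * (u j * u l)) =
      form (\<lambda>x. e i x * f x) (\<lambda>x. e i x * f x)" if "1 \<le> i" for i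
    unfolding ef using that by (subst form_combination[OF C]) (auto intro: ee simp: mult_ac)
  then have "(\<Sum>i=1..n. \<Sum>j=1..n. \<Sum>l=1..n. form (\<lambda>x. e i x * e j x) (\<lambda>x. e i x * e l x) * (u j * u l)) =
      (\<Sum>i=1..n. form (\<lambda>x. e i x * f x) (\<lambda>x. e i x * f x))"
    by (intro sum.cong refl) auto
  also have "\<dots> = (\<integral>z. (\<Sum>i=1..n. case z of (x, y) \<Rightarrow> k x y * (e i x * f x) * (e i y * f y)) \<partial>(\<mu> \<Otimes>\<^sub>M \<mu>))"
    unfolding form_def
    by (intro Bochner_Integration.integral_sum[symmetric] form_bdd_integrable[OF C] efsq) auto
  also have "\<dots> = (\<integral>(x, y). (\<Sum>l=1..n. k x y * e l x * e l y) * f x * f y \<partial>(\<mu> \<Otimes>\<^sub>M \<mu>))"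
    by (intro Bochner_Integration.integral_cong refl)
      (auto simp: sum_distrib_left mult_ac)
  also have "\<dots> \<le> \<kappa> * (\<integral>x. (f x)\<^sup>2 \<partial>\<mu>)" by (rule tr[OF f])
  also have "(\<integral>x. (f x)\<^sup>2 \<partial>\<mu>) = (\<Sum>j=1..n. (u j)\<^sup>2)"
    unfolding f_def by (rule orthonormal_combination_norm[OF e]) auto
  finally show ?thesis .
qed

end

text \<open>Homogeneity turns a supremum over the unit ball into a quadratic bound: s = 1 / sqrt(a)
  normalises. For a = 0 every s is admissible, and a positive \<open>I\<close> would violate the
  bound for large s.\<close>

lemma scaling_bound:
  fixes a I \<kappa> :: real
  assumes "0 \<le> a" and s: "\<And>s. 0 < s \<Longrightarrow> s\<^sup>2 * a \<le> 1 \<Longrightarrow> s\<^sup>2 * I \<le> \<kappa>"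
  shows "I \<le> \<kappa> * a"
proof (cases "a = 0")
  case False
  then have a: "0 < a" using assms by simp
  then show ?thesis using s[of "1 / sqrt a"] by (simp add: power_divide field_simps)
next
  case True
  have "I \<le> 0"
  proof (rule ccontr)
    assume "\<not> I \<le> 0"
    then have I: "0 < I" by simp
    have "(sqrt ((\<bar>\<kappa>\<bar> + 1) / I))\<^sup>2 * I \<le> \<kappa>" using True I by (intro s) auto
    then show False using I by simp
  qed
  then show ?thesis using True by simp
qed

lemma tendsto_sqrt_inverse_linear:
  fixes c L :: real
  assumes "0 < c"
  shows "((\<lambda>t. sqrt (L / (1 + c * t))) \<longlongrightarrow> 0) at_top"
proof -
  have "filterlim (\<lambda>t. 1 + c * t) at_top at_top"
    using assms by (intro filterlim_tendsto_add_at_top[OF tendsto_const]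
        filterlim_tendsto_pos_mult_at_top[OF tendsto_const] filterlim_ident)
  then have "((\<lambda>t. L / (1 + c * t)) \<longlongrightarrow> 0) at_top"
    by (intro tendsto_divide_0[OF tendsto_const] filterlim_at_top_imp_at_infinity)
  from tendsto_real_sqrt[OF this] show ?thesis by simp
qed

theorem theorem3p1:
  fixes \<O> :: "'a::euclidean_space set"
    and lam :: "nat \<Rightarrow> real" and e :: "nat \<Rightarrow> 'a \<Rightarrow> real"
    and q :: "'a \<Rightarrow> 'a \<Rightarrow> real"
    and \<beta>0 \<beta>1 :: real and u0 :: "'a \<Rightarrow> real"
    and M :: "'w measure" and F :: "real \<Rightarrow> 'w measure"
    and B :: "nat \<Rightarrow> real \<Rightarrow> 'w \<Rightarrow> real"
    and U :: "nat \<Rightarrow> real \<Rightarrow> 'w \<Rightarrow> nat \<Rightarrow> real"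
    and \<kappa>1 :: ereal
  assumes domain: "bounded_smooth_domain \<O>"
    and eigenbasis: "dirichlet_eigenbasis \<O> lam e"
    and q_measurable: "set_borel_measurable borel (\<O> \<times> \<O>) (\<lambda>(x, y). q x y)"
    and q_positive: "\<And>x y. x \<in> \<O> \<Longrightarrow> y \<in> \<O> \<Longrightarrow> 0 \<le> q x y"
    and q_posdef: "positive_definite_on \<O> q"
    and alpha_defined: "\<And>i j. 1 \<le> i \<Longrightarrow> 1 \<le> j \<Longrightarrow>
      set_integrable lborel (\<O> \<times> \<O>) (\<lambda>(x, y). q x y * e i x * e j y)"
    and qN_defined: "\<And>N f. 1 \<le> N \<Longrightarrow> L2_fun \<O> f \<Longrightarrow>
      set_integrable lborel (\<O> \<times> \<O>) (\<lambda>(x, y). q_trunc q e N x y * f x * f y)"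
    and prob: "prob_space M"
    and filtration: "is_filtration M F"
    and brownian: "brownian_family M F (noise_cov \<O> q e) B"
    and u0: "L2_fun \<O> u0"
    and solution: "\<And>N. 1 \<le> N \<Longrightarrow> galerkin_solution \<O> lam e \<beta>0 \<beta>1 u0 M F B N (U N)"
    and kappa: "\<kappa>1 = (SUP N\<in>{1..}. kernel_norm \<O> (q_trunc q e N))"
    and kappa_finite: "\<kappa>1 < \<infinity>"
    and stability: "2 * (lam 1 + \<beta>0) - \<beta>1\<^sup>2 * real_of_ereal \<kappa>1 > 0"
  shows "((\<lambda>t. SUP N\<in>{1..}. rms_norm M N (U N t)) \<longlongrightarrow> 0) at_top"
proof -
  have O_open: "open \<O>" and O_bdd: "bounded \<O>"
    using domain by (auto simp: bounded_smooth_domain_def)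
  have O: "\<O> \<in> sets borel" using O_open by simp
  have OO: "\<O> \<times> \<O> \<in> sets borel" using O_open by (intro borel_open open_Times)
  define \<mu> where "\<mu> = domain_measure \<O>"
  define e' where "e' k = zero_ext \<O> (e k)" for k
  define k where "k x y = indicator \<O> x * indicator \<O> y * q x y" for x y
  have \<mu>\<mu>: "\<mu> \<Otimes>\<^sub>M \<mu> = domain_measure (\<O> \<times> \<O>)"
    unfolding \<mu>_def by (rule domain_measure_Times[OF O O_bdd])
  have \<mu>_meas: "f \<in> borel_measurable \<mu> \<longleftrightarrow> f \<in> borel_measurable borel" for f :: "'a \<Rightarrow> real"
    unfolding \<mu>_def by (simp add: measurable_cong_sets[OF sets_domain_measure refl])
  have \<mu>\<mu>_meas: "f \<in> borel_measurable (\<mu> \<Otimes>\<^sub>M \<mu>) \<longleftrightarrow> f \<in> borel_measurable borel" for f :: "'a \<times> 'a \<Rightarrow> real"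
    unfolding \<mu>\<mu> by (simp add: measurable_cong_sets[OF sets_domain_measure refl])
  have k_eq: "case_prod k = zero_ext (\<O> \<times> \<O>) (\<lambda>(x, y). q x y)"
    by (auto simp: k_def zero_ext_def indicator_def)
  interpret K: psd_kernel \<mu> k
  proof (intro psd_kernel.intro psd_kernel_axioms.intro)
    show "finite_measure \<mu>" unfolding \<mu>_def by (rule finite_domain_measure[OF O O_bdd])
    show "case_prod k \<in> borel_measurable (\<mu> \<Otimes>\<^sub>M \<mu>)"
      unfolding \<mu>\<mu>_meas k_eq by (rule zero_ext_measurable[OF q_measurable])
    show "0 \<le> k x y" for x y using q_positive[of x y] by (auto simp: k_def indicator_def)
    show "positive_definite_on (space \<mu>) k"
      using positive_definite_on_zero_ext[OF q_posdef] by (simp add: \<mu>_def k_def[abs_def])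
  qed
  have e_L2: "L2_fun \<O> (e l)" if "1 \<le> l" for l
    using eigenbasis that by (auto simp: dirichlet_eigenbasis_def L2_orthonormal_basis_def)
  have onb: "orthonormal_basis \<mu> e'"
    unfolding \<mu>_def e'_def using eigenbasis
    by (intro orthonormal_basis_domain[OF O]) (simp add: dirichlet_eigenbasis_def)
  have e'_sq: "sq_int \<mu> (e' l)" if "1 \<le> l" for l using onb that by (simp add: orthonormal_basis_def)
  \<comment> \<open>Dirichlet eigenfunctions are continuous on the compact closure of the domain.
    Their boundedness puts products of two of them in L^2, as the expansion of the noise
    coefficients requires.\<close>
  have e'_bdd: "\<exists>c. \<forall>x. \<bar>e' l x\<bar> \<le> c" if "1 \<le> l" for l
  proof -
    have "continuous_on (closure \<O>) (e l)"
      using eigenbasis that by (auto simp: dirichlet_eigenbasis_def dirichlet_eigenfunction_def)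
    then have "compact (e l ` closure \<O>)"
      using O_bdd by (intro compact_continuous_image) (auto simp: compact_closure)
    then have "bounded (e l ` closure \<O>)" by (rule compact_imp_bounded)
    then obtain c where c: "\<forall>x\<in>closure \<O>. \<bar>e l x\<bar> \<le> c" by (auto simp: bounded_iff)
    have "\<bar>e' l x\<bar> \<le> max 0 c" for x
      using c closure_subset[of \<O>] by (cases "x \<in> \<O>") (auto simp: e'_def zero_ext_def intro: max.coboundedI2)
    then show ?thesis by blast
  qed
  have ee: "sq_int \<mu> (\<lambda>x. e' i x * e' l x)" if "1 \<le> i" "1 \<le> l" for i l
  proof -
    from e'_bdd[OF that(1)] obtain c where "\<forall>x. \<bar>e' i x\<bar> \<le> c" by blast
    then show ?thesis
      using sq_int_measurable[OF e'_sq[OF that(1)]] by (intro sq_int_bounded_mult[OF e'_sq[OF that(2)], where c=c]) auto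
  qed
  define \<kappa> where "\<kappa> = real_of_ereal \<kappa>1"
  have \<kappa>_ge: "ereal (LINT (x, y):\<O> \<times> \<O>|lborel. q_trunc q e N x y * f x * f y) \<le> \<kappa>1"
    if "1 \<le> N" "L2_fun \<O> f" "L2_norm \<O> f \<le> 1" for N f
  proof -
    have "ereal (LINT (x, y):\<O> \<times> \<O>|lborel. q_trunc q e N x y * f x * f y) \<le> kernel_norm \<O> (q_trunc q e N)"
      unfolding kernel_norm_def using that by (intro SUP_upper) auto
    also have "\<dots> \<le> \<kappa>1" unfolding kappa using that by (intro SUP_upper) auto
    finally show ?thesis .
  qed
  \<comment> \<open>Testing with the zero function shows that \<open>\<kappa>1\<close> is
    nonnegative; together with \<open>kappa_finite\<close> this makes \<open>real_of_ereal\<close>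
    return its true value.\<close>
  have "L2_fun \<O> (\<lambda>x. 0)" "L2_norm \<O> (\<lambda>x. 0) \<le> 1"
    by (simp_all add: L2_fun_def set_borel_measurable_def set_integrable_def L2_norm_def L2_inner_def set_lebesgue_integral_def)
  from \<kappa>_ge[OF order_refl this] have \<kappa>1_0: "0 \<le> \<kappa>1"
    by (simp add: set_lebesgue_integral_def case_prod_beta' zero_ereal_def)
  have \<kappa>1: "\<kappa>1 = ereal \<kappa>" and \<kappa>0: "0 \<le> \<kappa>"
    using \<kappa>1_0 kappa_finite unfolding \<kappa>_def by (cases \<kappa>1; simp)+
  have trace: "(\<integral>(x, y). (\<Sum>l=1..n. k x y * e' l x * e' l y) * f x * f y \<partial>(\<mu> \<Otimes>\<^sub>M \<mu>)) \<le> \<kappa> * (\<integral>x. (f x)\<^sup>2 \<partial>\<mu>)"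
    if n: "1 \<le> n" and f: "sq_int \<mu> f" for n f
  proof (rule scaling_bound)
    let ?I = "\<integral>(x, y). (\<Sum>l=1..n. k x y * e' l x * e' l y) * f x * f y \<partial>(\<mu> \<Otimes>\<^sub>M \<mu>)"
    show "0 \<le> (\<integral>x. (f x)\<^sup>2 \<partial>\<mu>)" by simp
    fix s :: real assume s: "0 < s" "s\<^sup>2 * (\<integral>x. (f x)\<^sup>2 \<partial>\<mu>) \<le> 1"
    let ?g = "\<lambda>x. s * f x"
    have g: "sq_int \<mu> ?g" by (rule sq_int_scale[OF f])
    have gL2: "L2_fun \<O> ?g" by (rule sq_int_domain_imp_L2_fun[OF O g[unfolded \<mu>_def]])
    have "L2_inner \<O> ?g ?g = (\<integral>x. (?g x)\<^sup>2 \<partial>\<mu>)"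
      unfolding L2_inner_def \<mu>_def using sq_int_measurable[OF g] \<mu>_meas
      by (intro domain_measure_integral(1)[symmetric] O) (auto simp: power2_eq_square)
    then have norm: "L2_norm \<O> ?g \<le> 1" using s by (simp add: L2_norm_def power_mult_distrib)
    have "(LINT (x, y):\<O> \<times> \<O>|lborel. q_trunc q e n x y * ?g x * ?g y) =
        (\<integral>(x, y). (\<Sum>l=1..n. k x y * e' l x * e' l y) * ?g x * ?g y \<partial>(\<mu> \<Otimes>\<^sub>M \<mu>))"
      unfolding \<mu>\<mu>
    proof (rule domain_measure_integral(1)[symmetric, OF OO])
      have [measurable]: "e' l \<in> borel_measurable \<mu>" if "l \<in> {1..n}" for l
        using that by (intro sq_int_measurable[OF e'_sq]) auto
      have [measurable]: "f \<in> borel_measurable \<mu>" by (rule sq_int_measurable[OF f])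
      have "(\<lambda>z. (\<Sum>l=1..n. k (fst z) (snd z) * e' l (fst z) * e' l (snd z)) * ?g (fst z) * ?g (snd z)) \<in> borel_measurable (\<mu> \<Otimes>\<^sub>M \<mu>)"
        by measurable
      then show "(\<lambda>(x, y). (\<Sum>l=1..n. k x y * e' l x * e' l y) * ?g x * ?g y) \<in> borel_measurable borel"
        by (simp add: \<mu>\<mu>_meas case_prod_beta')
      show "(case z of (x, y) \<Rightarrow> (\<Sum>l=1..n. k x y * e' l x * e' l y) * ?g x * ?g y) =
          (case z of (x, y) \<Rightarrow> q_trunc q e n x y * ?g x * ?g y)" if "z \<in> \<O> \<times> \<O>" for z
        using that by (auto simp: k_def e'_def q_trunc_def)
    qed
    moreover have "(\<integral>(x, y). (\<Sum>l=1..n. k x y * e' l x * e' l y) * ?g x * ?g y \<partial>(\<mu> \<Otimes>\<^sub>M \<mu>)) = s\<^sup>2 * ?I"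
    proof -
      have "(\<integral>(x, y). (\<Sum>l=1..n. k x y * e' l x * e' l y) * ?g x * ?g y \<partial>(\<mu> \<Otimes>\<^sub>M \<mu>)) =
         (\<integral>z. s\<^sup>2 * (case z of (x, y) \<Rightarrow> (\<Sum>l=1..n. k x y * e' l x * e' l y) * f x * f y) \<partial>(\<mu> \<Otimes>\<^sub>M \<mu>))"
        by (intro Bochner_Integration.integral_cong refl) (simp add: power2_eq_square case_prod_beta')
      then show ?thesis by simp
    qed
    ultimately show "s\<^sup>2 * ?I \<le> \<kappa>"
      using \<kappa>_ge[OF n gL2 norm] by (simp add: \<kappa>1)
  qed
  have bdd: "K.form_bdd (\<kappa> * measure \<mu> (space \<mu>))"
    by (rule K.form_bdd_if_trace_bounded[OF onb \<kappa>0 trace])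
  have cov: "noise_cov \<O> q e i j = K.form (e' i) (e' j)" if "1 \<le> i" "1 \<le> j" for i j
    unfolding noise_cov_def K.form_def \<mu>\<mu>
  proof (rule domain_measure_integral(1)[symmetric, OF OO])
    show "(\<lambda>(x, y). k x y * e' i x * e' j y) \<in> borel_measurable borel"
      using K.weighted_measurable[OF e'_sq[OF that(1)] e'_sq[OF that(2)]] by (simp add: \<mu>\<mu>_meas case_prod_beta')
  qed (auto simp: k_def e'_def)
  \<comment> \<open>The triple product is symmetric, so an entry of the j-th noise matrix is the
    j-th Fourier coefficient of \<open>e' i * e' l\<close>; this is what lets
    \<open>form_double_series\<close> sum the noise.\<close>
  have A: "A_mat \<O> e j i l = (\<integral>x. (e' i x * e' l x) * e' j x \<partial>\<mu>)" if "1 \<le> i" "1 \<le> l" "1 \<le> j" for i j l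
    unfolding A_mat_def \<mu>_def
  proof (rule domain_measure_integral(1)[symmetric, OF O])
    show "(\<lambda>x. (e' i x * e' l x) * e' j x) \<in> borel_measurable borel"
      using sq_int_measurable[OF ee[OF that(1,2)]] sq_int_measurable[OF e'_sq[OF that(3)]] \<mu>_meas by simp
  qed (auto simp: e'_def)
  have series: "(\<lambda>n. \<Sum>j=1..n. \<Sum>j'=1..n. noise_cov \<O> q e j j' * A_mat \<O> e j i m * A_mat \<O> e j' i l)
      \<longlonglongrightarrow> K.form (\<lambda>x. e' i x * e' m x) (\<lambda>x. e' i x * e' l x)"
    if "1 \<le> i" "1 \<le> m" "1 \<le> l" for i m l
  proof -
    have "(\<Sum>j=1..n. \<Sum>j'=1..n. noise_cov \<O> q e j j' * A_mat \<O> e j i m * A_mat \<O> e j' i l) =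
      (\<Sum>j=1..n. \<Sum>j'=1..n. K.form (e' j) (e' j') * (\<integral>x. (e' i x * e' m x) * e' j x \<partial>\<mu>) * (\<integral>x. (e' i x * e' l x) * e' j' x \<partial>\<mu>))" for n
      using that by (intro sum.cong refl) (simp add: cov A)
    then show ?thesis
      using K.form_double_series[OF bdd onb ee[OF that(1,2)] ee[OF that(1,3)]] by simp
  qed
  interpret prob_space M by (rule prob)
  interpret brownian_motions M F "noise_cov \<O> q e" B
    by unfold_locales (rule filtration brownian)+
  have lam: "lam 1 \<le> lam i" if "1 \<le> i" for i
    using that
  proof (induction i rule: dec_induct)
    case (step i)
    then show ?case using eigenbasis by (auto simp: dirichlet_eigenbasis_def intro: order_trans)
  qed simp
  define c where "c = 2 * (lam 1 + \<beta>0) - \<beta>1\<^sup>2 * \<kappa>"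
  have c: "0 < c" using stability by (simp add: c_def \<kappa>_def)
  define L where "L = (\<integral>x. (zero_ext \<O> u0 x)\<^sup>2 \<partial>\<mu>)"
  have main: "rms_norm M N (U N t) \<le> ereal (sqrt (L / (1 + c * t)))" if N: "1 \<le> N" and t: "0 \<le> t" for N t
  proof -
    let ?x0 = "proj_coords \<O> e u0"
    have sol: "linear_ito_solution M F B N (\<lambda>i k. Lambda_mat lam i k + B_mat \<beta>0 i k) \<beta>1 (A_mat \<O> e) ?x0 (U N)"
      using solution[OF N] by (simp add: galerkin_solution_def)
    have diag: "mat_vec N (\<lambda>i k. Lambda_mat lam i k + B_mat \<beta>0 i k) v i = (lam i + \<beta>0) * v i" if "i \<in> {1..N}" for v i
    proof -
      have "mat_vec N (\<lambda>i k. Lambda_mat lam i k + B_mat \<beta>0 i k) v i = (\<Sum>k=1..N. if i = k then (lam i + \<beta>0) * v k else 0)"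
        unfolding mat_vec_def by (intro sum.cong refl) (auto simp: Lambda_mat_def B_mat_def)
      then show ?thesis using that by simp
    qed
    let ?q = "\<lambda>i m l. K.form (\<lambda>x. e' i x * e' m x) (\<lambda>x. e' i x * e' l x)"
    \<comment> \<open>The integrand of the energy identity, summed over the components. It is
      estimated pointwise in time and path, before any expectation is taken.\<close>
    define \<psi> where "\<psi> z = (\<Sum>i=1..N. - 2 * (lam i + \<beta>0) * (U N (fst z) (snd z) i)\<^sup>2)
      + \<beta>1\<^sup>2 * (\<Sum>i=1..N. \<Sum>m=1..N. \<Sum>l=1..N. ?q i m l * (U N (fst z) (snd z) m * U N (fst z) (snd z) l))" for z
    have moment: "sq_int M (\<lambda>\<omega>. U N r \<omega> i)"
      "expectation (\<lambda>\<omega>. (U N r \<omega> i)\<^sup>2) = (?x0 i)\<^sup>2 - 2 * (lam i + \<beta>0) * (\<integral>z. (U N (fst z) (snd z) i)\<^sup>2 \<partial>P r)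
        + \<beta>1\<^sup>2 * (\<Sum>m=1..N. \<Sum>l=1..N. ?q i m l * (\<integral>z. U N (fst z) (snd z) m * U N (fst z) (snd z) l \<partial>P r))"
      if "i \<in> {1..N}" "0 \<le> r" for i r
    proof -
      note * = ito_solution_second_moment[where q="?q i", OF sol that(1) diag[OF that(1)] that(2)]
      show "sq_int M (\<lambda>\<omega>. U N r \<omega> i)" using that by (intro * series) auto
      show "expectation (\<lambda>\<omega>. (U N r \<omega> i)\<^sup>2) = (?x0 i)\<^sup>2 - 2 * (lam i + \<beta>0) * (\<integral>z. (U N (fst z) (snd z) i)\<^sup>2 \<partial>P r)
        + \<beta>1\<^sup>2 * (\<Sum>m=1..N. \<Sum>l=1..N. ?q i m l * (\<integral>z. U N (fst z) (snd z) m * U N (fst z) (snd z) l \<partial>P r))"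
        using that by (intro * series) auto
    qed
    have Usq: "sq_int (P r) (\<lambda>z. U N (fst z) (snd z) i)" if "0 \<le> r" "i \<in> {1..N}" for r i
      by (rule ito_solution_sq_int[OF sol that(2,1)])
    have \<psi>: "has_bochner_integral (P r) \<psi> ((\<Sum>i=1..N. - 2 * (lam i + \<beta>0) * (\<integral>z. (U N (fst z) (snd z) i)\<^sup>2 \<partial>P r))
      + \<beta>1\<^sup>2 * (\<Sum>i=1..N. \<Sum>m=1..N. \<Sum>l=1..N. ?q i m l * (\<integral>z. U N (fst z) (snd z) m * U N (fst z) (snd z) l \<partial>P r)))"
      if "0 \<le> r" for r
      unfolding \<psi>_def
      by (intro has_bochner_integral_add has_bochner_integral_sum has_bochner_integral_mult_right
          has_bochner_integral_integrable sq_int_mult sq_int_square Usq that)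
    have sum_eq: "expectation (\<lambda>\<omega>. \<Sum>i\<in>{1..N}. (U N r \<omega> i)\<^sup>2) = (\<Sum>i=1..N. (?x0 i)\<^sup>2) + (\<integral>z. \<psi> z \<partial>P r)" if r: "0 \<le> r" for r
    proof -
      have "expectation (\<lambda>\<omega>. \<Sum>i\<in>{1..N}. (U N r \<omega> i)\<^sup>2) = (\<Sum>i=1..N. expectation (\<lambda>\<omega>. (U N r \<omega> i)\<^sup>2))"
        by (intro Bochner_Integration.integral_sum sq_int_square moment(1) r)
      also have "\<dots> = (\<Sum>i=1..N. (?x0 i)\<^sup>2) + (\<integral>z. \<psi> z \<partial>P r)"
        unfolding has_bochner_integral_integral_eq[OF \<psi>[OF r]]
        unfolding sum_distrib_left add.assoc[symmetric] sum.distrib[symmetric]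
        by (intro sum.cong refl) (simp add: moment(2)[OF _ r] sum_distrib_left algebra_simps)
      finally show ?thesis .
    qed
    have \<psi>_le: "\<psi> z \<le> - c * (\<Sum>i\<in>{1..N}. (U N (fst z) (snd z) i)\<^sup>2)" for z
    proof -
      let ?u = "U N (fst z) (snd z)"
      have "(\<Sum>i=1..N. - 2 * (lam i + \<beta>0) * (?u i)\<^sup>2) \<le> (\<Sum>i=1..N. - 2 * (lam 1 + \<beta>0) * (?u i)\<^sup>2)"
        using lam by (intro sum_mono mult_right_mono) auto
      also have "\<dots> = - 2 * (lam 1 + \<beta>0) * (\<Sum>i=1..N. (?u i)\<^sup>2)"
        by (simp add: sum_distrib_left)
      finally have 1: "(\<Sum>i=1..N. - 2 * (lam i + \<beta>0) * (?u i)\<^sup>2) \<le> - 2 * (lam 1 + \<beta>0) * (\<Sum>i=1..N. (?u i)\<^sup>2)" .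
      have "(\<Sum>i=1..N. \<Sum>m=1..N. \<Sum>l=1..N. ?q i m l * (?u m * ?u l)) \<le> \<kappa> * (\<Sum>i=1..N. (?u i)\<^sup>2)"
        by (rule K.trace_form_le[OF bdd onb ee trace[OF N]])
      then have "\<beta>1\<^sup>2 * (\<Sum>i=1..N. \<Sum>m=1..N. \<Sum>l=1..N. ?q i m l * (?u m * ?u l)) \<le> \<beta>1\<^sup>2 * (\<kappa> * (\<Sum>i=1..N. (?u i)\<^sup>2))"
        by (rule mult_left_mono) simp
      with 1 show ?thesis by (simp add: \<psi>_def c_def algebra_simps)
    qed
    have decay: "(1 + c * t) * expectation (\<lambda>\<omega>. \<Sum>i\<in>{1..N}. (U N t \<omega> i)\<^sup>2) \<le> (\<Sum>i=1..N. (?x0 i)\<^sup>2)"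
      using c t by (intro mean_square_decay[where \<psi>=\<psi>] \<psi>_le sum_eq Usq has_bochner_integral_iff[THEN iffD1, THEN conjunct1, OF \<psi>]) auto
    \<comment> \<open>Bessel's inequality frees the bound of N, so that it survives the supremum
      over N.\<close>
    have "(\<Sum>i=1..N. (?x0 i)\<^sup>2) = (\<Sum>i=1..N. (\<integral>x. zero_ext \<O> u0 x * e' i x \<partial>\<mu>)\<^sup>2)"
      by (intro sum.cong refl) (simp add: proj_coords_def L2_inner_eq_integral[OF O u0 e_L2] \<mu>_def e'_def)
    also have "\<dots> \<le> L"
      unfolding L_def using u0 L2_fun_iff_sq_int[OF O]
      by (intro Bessel_inequality[OF onb]) (auto simp: \<mu>_def)
    finally have "(1 + c * t) * expectation (\<lambda>\<omega>. \<Sum>i\<in>{1..N}. (U N t \<omega> i)\<^sup>2) \<le> L" using decay by simp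
    moreover have "0 < 1 + c * t" using c t by (simp add: add_pos_nonneg)
    ultimately have le: "expectation (\<lambda>\<omega>. \<Sum>i\<in>{1..N}. (U N t \<omega> i)\<^sup>2) \<le> L / (1 + c * t)"
      by (simp add: field_simps)
    have sq: "(L2_set (U N t \<omega>) {1..N})\<^sup>2 = (\<Sum>i\<in>{1..N}. (U N t \<omega> i)\<^sup>2)" for \<omega>
      by (simp add: L2_set_def sum_nonneg)
    have "integrable M (\<lambda>\<omega>. \<Sum>i\<in>{1..N}. (U N t \<omega> i)\<^sup>2)"
      by (intro Bochner_Integration.integrable_sum sq_int_square moment(1) t)
    then show ?thesis
      unfolding rms_norm_def sq using le by (simp add: real_sqrt_le_mono)
  qed
  have lower: "0 \<le> (SUP N\<in>{1..}. rms_norm M N (U N t))" for t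
    by (rule SUP_upper2[of 1]) (auto simp: rms_norm_def)
  show ?thesis
  proof (rule tendsto_sandwich[OF _ _ tendsto_const])
    show "((\<lambda>t. ereal (sqrt (L / (1 + c * t)))) \<longlongrightarrow> 0) at_top"
      using tendsto_sqrt_inverse_linear[OF c, of L] by (simp add: zero_ereal_def)
    show "\<forall>\<^sub>F t in at_top. (SUP N\<in>{1..}. rms_norm M N (U N t)) \<le> ereal (sqrt (L / (1 + c * t)))"
      using eventually_ge_at_top[of 0] by eventually_elim (auto intro!: SUP_least main)
    show "\<forall>\<^sub>F t in at_top. 0 \<le> (SUP N\<in>{1..}. rms_norm M N (U N t))"
      by (intro always_eventually allI lower)
  qed
qed

end
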